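(* Let $(\boldsymbol L(s))_{s\ge0}$ be a Lévy process in $\mathbb R_+^d$ with Lévy measure $\Pi\in\mathcal{MRV}(\alpha_i,b_i,\mu_i,\mathbb E_d^{(i)})$ for $i=1,\ldots,d$ whose univariate marginal Lévy measures are tail equivalent. Moreover, assume that $\alpha_i<\alpha_m+\alpha_{i-m}$ for all $m=1,\ldots,i-1$ and $i=2,\ldots,d$. Then for $s>0$, $$\boldsymbol L(s)\in\mathcal{MRV}(\alpha_i,b_i,s\mu_i,\mathbb E_d^{(i)})\qquad\text{for } i=1,\ldots,d.$$
   Context: A Lévy process in $\mathbb R_+^d$ is a Lévy process (stationary independent increments, càdlàg paths, $\boldsymbol L(0)=\boldsymbol 0$ a.s.) with values in $\mathbb R_+^d$, i.e. all its marginal processes are subordinators; its Lévy measure $\Pi(A)$ is the expected number of jumps in the time interval $[0,1]$ with jump size in $A$. The univariate marginal Lévy measures $\Pi_1,\ldots,\Pi_d$ are the Lévy measures of the coordinate processes; Borel measures $\mu,\nu$ on $\mathbb R_+$ are tail equivalent if $\mu((t,\infty))/\nu((t,\infty))\to c$ for some $c\in(0,\infty)$ as $t\to\infty$. $\mathbb R_+^d=[0,\infty)^d$ carries the sup-norm metric; $z_{(1)}\ge\cdots\ge z_{(d)}$ are the decreasing order statistics of $\boldsymbol z\in\mathbb R_+^d$. For $0\le i\le d-1$ let $\mathbb{CA}_d^{(i)}=\{\boldsymbol z\in\mathbb R_+^d: z_{(i+1)}=0\}$, and for $1\le i\le d$ let $\mathbb E_d^{(i)}=\mathbb R_+^d\setminus\mathbb{CA}_d^{(i-1)}=\{\boldsymbol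 z\in\mathbb R_+^d: z_{(i)}>0\}$. $\mathbb M(\mathbb E_d^{(i)})$ is the set of Borel measures on $\mathbb E_d^{(i)}$ that are finite on Borel sets bounded away from (at positive distance from) $\mathbb{CA}_d^{(i-1)}$; $\mu_t\to\mu$ in $\mathbb M(\mathbb E_d^{(i)})$ means $\int f\,d\mu_t\to\int f\,d\mu$ for all bounded continuous real $f$ on $\mathbb E_d^{(i)}$ with support bounded away from $\mathbb{CA}_d^{(i-1)}$. A function $f:\mathbb R_+\to\mathbb R_+$ is in $\mathcal{RV}_\beta$ if $f(tx)/f(t)\to x^\beta$ as $t\to\infty$ for all $x>0$. A Borel measure $\Pi$ is regularly varying, $\Pi\in\mathcal{MRV}(\alpha,b,\mu,\mathbb E_d^{(i)})$, if $\alpha>0$, $b\in\mathcal{RV}_{1/\alpha}$, $\mu\in\mathbb M(\mathbb E_d^{(i)})$ is non-null and $t\,\Pi(b(t)\,\cdot)\to\mu(\cdot)$ in $\mathbb M(\mathbb E_d^{(i)})$ as $t\to\infty$. A random vector $\boldsymbol Z\in\mathbb R_+^d$ satisfies $\boldsymbol Z\in\mathcal{MRV}(\alpha,b,\mu,\mathbb E_d^{(i)})$ if its distribution does, i.e. $t\,\mathbb P(\boldsymbol Z/b(t)\in\cdot)\to\mu(\cdot)$ in $\mathbb M(\mathbb E_d^{(i)})$. *)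

theory Defs
  imports "HOL-Probability.Probability"
begin

text \<open>Processes are indexed by \<^typ>\<open>real\<close>; only the values at times \<open>t \<ge> 0\<close> matter.\<close>

definition cadlag :: "(real \<Rightarrow> 'a::euclidean_space) \<Rightarrow> bool" where
  "cadlag x \<longleftrightarrow>
     (\<forall>t\<ge>0. (x \<longlongrightarrow> x t) (at_right t)) \<and> (\<forall>t>0. \<exists>l. (x \<longlongrightarrow> l) (at_left t))"

definition levy_process :: "'w measure \<Rightarrow> (real \<Rightarrow> 'w \<Rightarrow> 'a::euclidean_space) \<Rightarrow> bool" where
  "levy_process M L \<longleftrightarrow>
     prob_space M \<and>
     (\<forall>t\<ge>0. L t \<in> borel_measurable M) \<and>
     (AE \<omega> in M. L 0 \<omega> = 0) \<and>
     (\<forall>\<omega>\<in>space M. cadlag (\<lambda>t. L t \<omega>)) \<and>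
     (\<forall>(n::nat) (t::nat \<Rightarrow> real). 0 \<le> t 0 \<longrightarrow> (\<forall>k<n. t k < t (Suc k)) \<longrightarrow>
        prob_space.indep_vars M (\<lambda>_. borel) (\<lambda>k \<omega>. L (t (Suc k)) \<omega> - L (t k) \<omega>) {..<n}) \<and>
     (\<forall>u\<ge>0. \<forall>h\<ge>0. distr M borel (\<lambda>\<omega>. L (u + h) \<omega> - L u \<omega>) = distr M borel (L h))"

definition jump :: "(real \<Rightarrow> 'a::euclidean_space) \<Rightarrow> real \<Rightarrow> 'a" where
  "jump x t = x t - Lim (at_left t) x"

text \<open>There is no jump at time \<open>0\<close> (the usual convention \<open>x (0-) = x 0\<close>), so the jump times in
  \<open>[0,1]\<close> are those in \<open>(0,1]\<close>. The count is infinite if there are infinitely many of them.\<close>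

definition jump_count :: "(real \<Rightarrow> 'a::euclidean_space) \<Rightarrow> 'a set \<Rightarrow> ennreal" where
  "jump_count x A =
     emeasure (count_space UNIV) {t \<in> {0<..1}. jump x t \<noteq> 0 \<and> jump x t \<in> A}"

text \<open>The following predicate determines \<open>\<nu>\<close> uniquely. Since zero increments are not jumps,
  \<open>\<nu> {0} = 0\<close>.\<close>

definition is_levy_measure ::
  "'w measure \<Rightarrow> (real \<Rightarrow> 'w \<Rightarrow> 'a::euclidean_space) \<Rightarrow> 'a measure \<Rightarrow> bool" where
  "is_levy_measure M L \<nu> \<longleftrightarrow>
     sets \<nu> = sets borel \<and>
     (\<forall>A\<in>sets borel. emeasure \<nu> A = (\<integral>\<^sup>+ \<omega>. jump_count (\<lambda>t. L t \<omega>) A \<partial>M))"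

definition tail_equivalent :: "real measure \<Rightarrow> real measure \<Rightarrow> bool" where
  "tail_equivalent \<mu> \<nu> \<longleftrightarrow>
     (\<exists>c>0. ((\<lambda>t. measure \<mu> {t<..} / measure \<nu> {t<..}) \<longlongrightarrow> c) at_top)"

definition orthant :: "(real ^ 'd::finite) set" where
  "orthant = {z. \<forall>j. 0 \<le> z $ j}"

text \<open>Decreasing order statistics, numbered from \<open>1\<close>: \<open>order_stat z i\<close> is the \<open>i\<close>-th largest
  component of \<open>z\<close>, counted with multiplicity, for \<open>1 \<le> i \<le> CARD('d)\<close>.\<close>

definition order_stat :: "real ^ 'd::finite \<Rightarrow> nat \<Rightarrow> real" where
  "order_stat z i =
     rev (sorted_list_of_multiset (image_mset (\<lambda>j. z $ j) (mset_set UNIV))) ! (i - 1)"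

definition CA :: "nat \<Rightarrow> (real ^ 'd::finite) set" where
  "CA i = {z \<in> orthant. order_stat z (i + 1) = 0}"

definition EE :: "nat \<Rightarrow> (real ^ 'd::finite) set" where
  "EE i = orthant - CA (i - 1)"

text \<open>Positive distance with respect to the sup-norm metric.\<close>

definition bounded_away :: "(real ^ 'd::finite) set \<Rightarrow> (real ^ 'd) set \<Rightarrow> bool" where
  "bounded_away A C \<longleftrightarrow> (\<exists>\<epsilon>>0. \<forall>x\<in>A. \<forall>y\<in>C. \<epsilon> \<le> infnorm (x - y))"

definition MM :: "nat \<Rightarrow> (real ^ 'd::finite) measure set" where
  "MM i = {\<mu>. sets \<mu> = sets (restrict_space borel (EE i)) \<and>
              (\<forall>B\<in>sets \<mu>. bounded_away B (CA (i - 1)) \<longrightarrow> emeasure \<mu> B < \<infinity>)}"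

definition tendsto_MM ::
  "nat \<Rightarrow> (real \<Rightarrow> (real ^ 'd::finite) measure) \<Rightarrow> (real ^ 'd) measure \<Rightarrow> bool" where
  "tendsto_MM i N \<mu> \<longleftrightarrow>
     (\<forall>\<^sub>F t in at_top. N t \<in> MM i) \<and> \<mu> \<in> MM i \<and>
     (\<forall>f :: real ^ 'd \<Rightarrow> real.
        continuous_on (EE i) f \<longrightarrow> bounded (f ` EE i) \<longrightarrow>
        bounded_away {z \<in> EE i. f z \<noteq> 0} (CA (i - 1)) \<longrightarrow>
        ((\<lambda>t. LINT z|N t. f z) \<longlongrightarrow> (LINT z|\<mu>. f z)) at_top)"

definition RV :: "real \<Rightarrow> (real \<Rightarrow> real) set" where
  "RV \<beta> = {f. (\<forall>t\<ge>0. 0 \<le> f t) \<and> (\<forall>x>0. ((\<lambda>t. f (t * x) / f t) \<longlongrightarrow> x powr \<beta>) at_top)}"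

text \<open>For \<open>c > 0\<close> the next definition is the measure \<open>A \<mapsto> t * \<nu> (c A)\<close> on the Borel sets of
  \<open>EE i\<close>, because \<open>c A = {z. z / c \<in> A}\<close>. A function \<open>b\<close> as in \<open>MRV\<close> is eventually positive.\<close>

definition rescaled ::
  "nat \<Rightarrow> real \<Rightarrow> real \<Rightarrow> (real ^ 'd::finite) measure \<Rightarrow> (real ^ 'd) measure" where
  "rescaled i t c \<nu> =
     scale_measure (ennreal t) (restrict_space (distr \<nu> borel (\<lambda>z. z /\<^sub>R c)) (EE i))"

definition MRV ::
  "real \<Rightarrow> (real \<Rightarrow> real) \<Rightarrow> (real ^ 'd::finite) measure \<Rightarrow> nat \<Rightarrow> (real ^ 'd) measure \<Rightarrow> bool"
where
  "MRV \<alpha> b \<mu> i \<nu> \<longleftrightarrow>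
     0 < \<alpha> \<and> b \<in> RV (1 / \<alpha>) \<and> \<mu> \<in> MM i \<and> emeasure \<mu> (space \<mu>) \<noteq> 0 \<and>
     tendsto_MM i (\<lambda>t. rescaled i t (b t) \<nu>) \<mu>"

definition MRV_rv ::
  "'w measure \<Rightarrow> real \<Rightarrow> (real \<Rightarrow> real) \<Rightarrow> (real ^ 'd::finite) measure \<Rightarrow> nat \<Rightarrow>
   ('w \<Rightarrow> real ^ 'd) \<Rightarrow> bool"
where
  "MRV_rv M \<alpha> b \<mu> i Z \<longleftrightarrow> MRV \<alpha> b \<mu> i (distr M borel Z)"

end

theory Submission
  imports Defs
begin

text \<open>
Write \<open>z_(i)\<close> for \<open>order_stat z i\<close> and \<open>T_i(c)\<close> for the mass that the Levy measure
\<open>\<nu>\<close> gives to the vectors with \<open>z_(i) \<ge> c\<close>. By regular variation, \<open>T_i(b_i(t))\<close> has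
order \<open>1 / t\<close>. So \<open>L s\<close> inherits the limit of \<open>s \<nu>\<close> as soon as
\<open>E f(L s / c)\<close> and \<open>s \<integral> f(z / c) d\<nu>\<close> differ by \<open>o(T_i(c))\<close> for every bounded Lipschitz
function \<open>f\<close> that vanishes for small \<open>z_(i)\<close>. Inf-convolutions then extend the limit to all
continuous test functions (\<open>tendsto_MM_of_lipschitz_limits\<close>).

The comparison works on a mesh instead of a Levy-Ito decomposition. Cut \<open>[0,s]\<close> into \<open>n\<close>
steps with increments \<open>X_k\<close> and partial sums \<open>S_k\<close>. For continuous \<open>g\<close> vanishing near zero,
\<open>n E g(L(s/n))\<close> tends to \<open>s \<integral> g d\<nu>\<close> (\<open>small_time_limit\<close>): on each path the sum of \<open>g\<close>
over the increments of a fine mesh tends to the sum over the jumps, and the Levy measure is the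
mean of the latter. On the other hand, \<open>E f(L s) - n E f(L(s/n))\<close> telescopes into the sum of
\<open>E [f(S_k + X_k) - f(S_k) - f(X_k)]\<close>. Such a term feels only three events: \<open>S_k\<close> has \<open>i\<close>
large coordinates, or \<open>X_k\<close> has, or \<open>X_k\<close> has \<open>m\<close> and \<open>S_k\<close> has \<open>i - m\<close> of them with
\<open>1 \<le> m < i\<close>. In the first two cases the Lipschitz bound contributes a factor that vanishes
as \<open>c\<close> grows, uniformly in \<open>n\<close>; the uniformity comes from the logarithm of the Laplace transform of
\<open>L s\<close>. In the third case independence gives a product of two tails. Letting \<open>n\<close> tend to
infinity yields \<open>one_big_jump\<close>.

Two facts make this error \<open>o(T_i(c))\<close>. Up to small changes of the exponent \<open>T_i(c)\<close> decays
like \<open>c\<close> to the power \<open>- \<alpha>_i\<close>, so that the condition \<open>\<alpha>_i < \<alpha>_m + \<alpha>_(i-m)\<close> gives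
\<open>T_m T_(i-m) = o(T_i)\<close> (\<open>tail_product_negligible\<close>). And the tail of the \<open>i\<close>-th order
statistic of \<open>L s\<close> is \<open>O(T_i)\<close> (\<open>exceed_le_tail\<close>), by induction on \<open>i\<close>: the comparison
itself yields a recursive inequality in which this tail reappears at a smaller argument with a
vanishing coefficient.
\<close>

section \<open>Order statistics and the pointwise big jump inequality\<close>

text \<open>The description of order statistics by counting large coordinates. It is the only place where the
sorted list of the definition is opened; everything else follows from this equivalence.\<close>

lemma order_stat_ge_iff:
  fixes z :: "real ^ 'd::finite"
  assumes "1 \<le> i" "i \<le> CARD('d)"
  shows "c \<le> order_stat z i \<longleftrightarrow> i \<le> card {j. c \<le> z $ j}"
proof -
  define A where "A = image_mset (\<lambda>j. z $ j) (mset_set (UNIV :: 'd set))"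
  define xs where "xs = sorted_list_of_multiset A"
  define n where "n = CARD('d)"
  have mset: "mset xs = A" by (simp add: xs_def)
  have len: "length xs = n"
    using arg_cong[OF mset, of size] by (simp add: A_def n_def)
  have srt: "sorted xs" by (simp add: xs_def)
  have i: "1 \<le> i" "i \<le> n" using assms by (auto simp: n_def)
  have os: "order_stat z i = xs ! (n - i)"
    using i len by (simp add: order_stat_def A_def[symmetric] xs_def[symmetric] rev_nth)
  have "card {j. c \<le> z $ j} = size (filter_mset ((\<le>) c) A)"
    by (simp add: A_def filter_mset_image_mset)
  also have "\<dots> = length (filter ((\<le>) c) xs)"
    by (metis mset mset_filter size_mset)
  also have "\<dots> = card {k. k < n \<and> c \<le> xs ! k}"
    by (simp add: length_filter_conv_card len)
  finally have c: "card {j. c \<le> z $ j} = card {k. k < n \<and> c \<le> xs ! k}" .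
  show ?thesis
  proof
    assume "c \<le> order_stat z i"
    hence "{n - i..<n} \<subseteq> {k. k < n \<and> c \<le> xs ! k}"
      using os srt len by (force intro: order_trans[OF _ sorted_nth_mono])
    hence "card {n - i..<n} \<le> card {k. k < n \<and> c \<le> xs ! k}"
      by (intro card_mono) auto
    thus "i \<le> card {j. c \<le> z $ j}" using c i by simp
  next
    assume a: "i \<le> card {j. c \<le> z $ j}"
    show "c \<le> order_stat z i"
    proof (rule ccontr)
      assume "\<not> c \<le> order_stat z i"
      hence lt: "xs ! (n - i) < c" using os by simp
      have "{k. k < n \<and> c \<le> xs ! k} \<subseteq> {Suc (n - i)..<n}"
      proof
        fix k assume k: "k \<in> {k. k < n \<and> c \<le> xs ! k}"
        show "k \<in> {Suc (n - i)..<n}"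
        proof (rule ccontr)
          assume "k \<notin> {Suc (n - i)..<n}"
          hence "k \<le> n - i" using k by auto
          hence "xs ! k \<le> xs ! (n - i)" using srt len i by (intro sorted_nth_mono) auto
          thus False using k lt by auto
        qed
      qed
      hence "card {k. k < n \<and> c \<le> xs ! k} \<le> card {Suc (n - i)..<n}"
        by (intro card_mono) auto
      thus False using a c i by simp
    qed
  qed
qed

lemma order_stat_shift:
  fixes z w :: "real ^ 'd::finite"
  assumes "1 \<le> i" "i \<le> CARD('d)" "\<And>j. z $ j - e \<le> w $ j"
  shows "order_stat z i - e \<le> order_stat w i"
proof -
  have "i \<le> card {j. order_stat z i \<le> z $ j}"
    using order_stat_ge_iff[OF assms(1,2), of "order_stat z i" z] by simp
  also have "\<dots> \<le> card {j. order_stat z i - e \<le> w $ j}"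
  proof (rule card_mono)
    show "{j. order_stat z i \<le> z $ j} \<subseteq> {j. order_stat z i - e \<le> w $ j}"
    proof safe
      fix j assume "order_stat z i \<le> z $ j"
      thus "order_stat z i - e \<le> w $ j" using assms(3)[of j] by linarith
    qed
  qed simp
  finally show ?thesis using order_stat_ge_iff[OF assms(1,2)] by blast
qed

lemma order_stat_mono:
  fixes z w :: "real ^ 'd::finite"
  assumes "1 \<le> i" "i \<le> CARD('d)" "\<And>j. z $ j \<le> w $ j"
  shows "order_stat z i \<le> order_stat w i"
  using order_stat_shift[OF assms(1,2), of z 0 w] assms(3) by simp

lemma order_stat_lipschitz_infnorm:
  fixes z w :: "real ^ 'd::finite"
  assumes "1 \<le> i" "i \<le> CARD('d)"
  shows "\<bar>order_stat z i - order_stat w i\<bar> \<le> infnorm (z - w)"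
proof -
  have c: "\<bar>z $ j - w $ j\<bar> \<le> infnorm (z - w)" for j
    using component_le_infnorm_cart[of "z - w" j] by simp
  have "z $ j - infnorm (z - w) \<le> w $ j" "w $ j - infnorm (z - w) \<le> z $ j" for j
    using c[of j] by linarith+
  thus ?thesis
    using order_stat_shift[OF assms, of z "infnorm (z - w)" w]
      order_stat_shift[OF assms, of w "infnorm (z - w)" z] by (simp add: abs_le_iff)
qed

lemma order_stat_lipschitz:
  fixes z w :: "real ^ 'd::finite"
  assumes "1 \<le> i" "i \<le> CARD('d)"
  shows "\<bar>order_stat z i - order_stat w i\<bar> \<le> norm (z - w)"
  using order_stat_lipschitz_infnorm[OF assms, of z w] infnorm_le_norm[of "z - w"] by linarith

lemma continuous_on_order_stat:
  fixes A :: "(real ^ 'd::finite) set"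
  assumes "1 \<le> i" "i \<le> CARD('d)"
  shows "continuous_on A (\<lambda>z. order_stat z i)"
proof (rule continuous_onI)
  fix x :: "real ^ 'd" and e :: real assume "e > 0"
  thus "\<exists>d>0. \<forall>x'\<in>A. dist x' x < d \<longrightarrow> dist (order_stat x' i) (order_stat x i) \<le> e"
    using order_stat_lipschitz[OF assms]
    by (intro exI[of _ e]) (auto simp: dist_norm intro: order_trans[OF _ less_imp_le])
qed

lemma borel_measurable_order_stat [measurable]:
  assumes "1 \<le> i" "i \<le> CARD('d::finite)"
  shows "(\<lambda>z :: real ^ 'd. order_stat z i) \<in> borel_measurable borel"
  by (intro borel_measurable_continuous_onI continuous_on_order_stat assms)

lemma order_stat_scaleR:
  fixes z :: "real ^ 'd::finite"
  assumes "1 \<le> i" "i \<le> CARD('d)" "0 < a"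
  shows "order_stat (a *\<^sub>R z) i = a * order_stat z i"
proof (rule antisym)
  have e: "{j. c \<le> (a *\<^sub>R z) $ j} = {j. c / a \<le> z $ j}" for c
    using assms(3) by (auto simp: field_simps)
  have ge: "c \<le> order_stat (a *\<^sub>R z) i \<longleftrightarrow> c / a \<le> order_stat z i" for c
    unfolding order_stat_ge_iff[OF assms(1,2)] e ..
  show "order_stat (a *\<^sub>R z) i \<le> a * order_stat z i"
    using ge[of "order_stat (a *\<^sub>R z) i"] assms(3) by (simp add: field_simps)
  show "a * order_stat z i \<le> order_stat (a *\<^sub>R z) i"
    using ge[of "a * order_stat z i"] assms(3) by simp
qed

lemma order_stat_nonneg:
  fixes z :: "real ^ 'd::finite"
  assumes "1 \<le> i" "i \<le> CARD('d)" "z \<in> orthant"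
  shows "0 \<le> order_stat z i"
  unfolding order_stat_ge_iff[OF assms(1,2)] using assms by (simp add: orthant_def)

lemma EE_iff:
  fixes z :: "real ^ 'd::finite"
  assumes "1 \<le> i" "i \<le> CARD('d)"
  shows "z \<in> EE i \<longleftrightarrow> z \<in> orthant \<and> 0 < order_stat z i"
  using assms order_stat_nonneg[OF assms, of z] by (auto simp: EE_def CA_def)

text \<open>The sup-distance of a point \<open>x\<close> of the orthant to \<open>CA (i - 1)\<close> is exactly
\<open>order_stat x i\<close>: a nearest point is obtained by setting the coordinates up to that value to
zero, and the lower bound is the Lipschitz property of the order statistic.\<close>

lemma bounded_away_CA_iff:
  fixes A :: "(real ^ 'd::finite) set"
  assumes i: "1 \<le> i" "i \<le> CARD('d)" and A: "A \<subseteq> orthant"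
  shows "bounded_away A (CA (i - 1)) \<longleftrightarrow> (\<exists>e>0. \<forall>x\<in>A. e \<le> order_stat x i)"
proof
  assume "bounded_away A (CA (i - 1))"
  then obtain e where e: "e > 0" "\<And>x y. x \<in> A \<Longrightarrow> y \<in> CA (i - 1) \<Longrightarrow> e \<le> infnorm (x - y)"
    unfolding bounded_away_def by blast
  have "e \<le> order_stat x i" if x: "x \<in> A" for x
  proof -
    define c where "c = order_stat x i"
    have c0: "c \<ge> 0" using order_stat_nonneg[OF i] x A by (auto simp: c_def)
    \<comment> \<open>the point of \<open>CA (i - 1)\<close> nearest to \<open>x\<close>\<close>
    define y :: "real ^ 'd" where "y = (\<chi> j. if x $ j \<le> c then 0 else x $ j)"
    have xo: "x \<in> orthant" using x A by blast
    hence yo: "y \<in> orthant" by (auto simp: orthant_def y_def)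
    have "order_stat y i \<le> 0"
    proof (rule ccontr)
      assume n: "\<not> order_stat y i \<le> 0"
      define S where "S = {j. c < x $ j}"
      have "i \<le> card {j. order_stat y i \<le> y $ j}"
        using order_stat_ge_iff[OF i, of "order_stat y i" y] by simp
      also have "\<dots> \<le> card S"
        using n by (intro card_mono) (auto simp: y_def S_def split: if_splits)
      finally have iS: "i \<le> card S" .
      hence Sne: "S \<noteq> {}" using i by auto
      define d where "d = Min ((\<lambda>j. x $ j) ` S)"
      have "d > c" using Sne by (auto simp: d_def S_def)
      have "card S \<le> card {j. d \<le> x $ j}"
        by (intro card_mono) (auto simp: d_def)
      hence "d \<le> order_stat x i" using iS order_stat_ge_iff[OF i] by (metis le_trans)
      thus False using \<open>d > c\<close> c_def by simp
    qed
    hence "y \<in> CA (i - 1)" using yo i order_stat_nonneg[OF i yo] by (simp add: CA_def)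
    hence "e \<le> infnorm (x - y)" using e x by blast
    also have "infnorm (x - y) \<le> c"
    proof -
      have "\<bar>(x - y) $ j\<bar> \<le> c" for j
        using c0 xo by (auto simp: y_def orthant_def abs_if dest: spec[of _ j])
      thus ?thesis
        unfolding infnorm_cart by (intro cSup_least) auto
    qed
    finally show ?thesis by (simp add: c_def)
  qed
  thus "\<exists>e>0. \<forall>x\<in>A. e \<le> order_stat x i" using e(1) by blast
next
  assume "\<exists>e>0. \<forall>x\<in>A. e \<le> order_stat x i"
  then obtain e where e: "e > 0" "\<forall>x\<in>A. e \<le> order_stat x i" by blast
  have "e \<le> infnorm (x - y)" if "x \<in> A" "y \<in> CA (i - 1)" for x y
    using order_stat_lipschitz_infnorm[OF i, of x y] that e(2) i by (auto simp: CA_def)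
  thus "bounded_away A (CA (i - 1))" unfolding bounded_away_def using e(1) by blast
qed

text \<open>On the orthant this is the \<open>l1\<close> norm. Being additive, it turns independent increments into
products of Laplace transforms.\<close>

definition coord_sum :: "real ^ 'd::finite \<Rightarrow> real" where
  "coord_sum z = (\<Sum>j\<in>UNIV. z $ j)"

lemma coord_sum_add: "coord_sum (x + y) = coord_sum x + coord_sum y"
  by (simp add: coord_sum_def sum.distrib)

lemma coord_sum_scaleR: "coord_sum (a *\<^sub>R x) = a * coord_sum x"
  by (simp add: coord_sum_def sum_distrib_left)

lemma coord_sum_nonneg: "x \<in> orthant \<Longrightarrow> 0 \<le> coord_sum x"
  by (auto simp: coord_sum_def orthant_def intro: sum_nonneg)

lemma norm_le_coord_sum: "x \<in> orthant \<Longrightarrow> norm x \<le> coord_sum x"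
  using norm_le_l1_cart[of x] by (simp add: coord_sum_def orthant_def)

lemma order_stat_le_norm:
  fixes z :: "real ^ 'd::finite"
  assumes "1 \<le> i" "i \<le> CARD('d)"
  shows "order_stat z i \<le> norm z"
proof -
  have "i \<le> card {j. order_stat z i \<le> z $ j}"
    using order_stat_ge_iff[OF assms, of "order_stat z i" z] by simp
  hence "card {j. order_stat z i \<le> z $ j} \<noteq> 0" using assms by linarith
  hence "{j. order_stat z i \<le> z $ j} \<noteq> {}" by (metis card.empty)
  then obtain j where "order_stat z i \<le> z $ j" by blast
  thus ?thesis using component_le_norm_cart[of z j] by simp
qed

lemma borel_measurable_coord_sum [measurable]: "coord_sum \<in> borel_measurable borel"
  unfolding coord_sum_def by measurable

lemma lipschitz_bound_nonneg:
  fixes f :: "real ^ 'd::finite \<Rightarrow> real"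
  assumes "\<And>z w. \<bar>f z - f w\<bar> \<le> K * norm (z - w)"
  shows "0 \<le> K"
proof -
  have "0 \<le> K * norm (axis undefined 1 - 0 :: real ^ 'd)"
    using assms[of "axis undefined 1" 0] by (rule order_trans[OF abs_ge_zero])
  thus ?thesis by simp
qed

lemma jump_constant_nonneg:
  fixes f :: "real ^ 'd::finite \<Rightarrow> real"
  assumes "0 < e" "\<And>z. \<bar>f z\<bar> \<le> C" "\<And>z w. \<bar>f z - f w\<bar> \<le> K * norm (z - w)"
  shows "0 \<le> K + 3 * C + 6 * C / e"
proof -
  have "0 \<le> C" using assms(2)[of 0] by linarith
  moreover have "0 \<le> K" using assms(3) by (rule lipschitz_bound_nonneg)
  ultimately show ?thesis using assms(1) by (intro add_nonneg_nonneg divide_nonneg_nonneg) auto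
qed

text \<open>A counting argument behind the single big jump: at least \<open>i\<close> coordinates of \<open>x + y\<close> reach
\<open>e\<close> only if each of them reaches \<open>e / 2\<close> in \<open>x\<close> or in \<open>y\<close>. If neither vector alone
has \<open>i\<close> such coordinates, then for some \<open>1 \<le> m < i\<close> the vector \<open>y\<close> has \<open>m\<close> of them
and \<open>x\<close> has \<open>i - m\<close>. Otherwise the Lipschitz bound makes the error small with the other
summand.\<close>

lemma one_big_jump_pointwise:
  fixes f :: "real ^ 'd::finite \<Rightarrow> real"
  assumes i: "1 \<le> i" "i \<le> CARD('d)" and x: "x \<in> orthant" and y: "y \<in> orthant"
    and e: "0 < e" and C: "\<And>z. \<bar>f z\<bar> \<le> C" and K: "\<And>z w. \<bar>f z - f w\<bar> \<le> K * norm (z - w)"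
    and supp: "\<And>z. order_stat z i < e \<Longrightarrow> f z = 0"
  defines "U \<equiv> \<lambda>m. {z. e / 2 \<le> order_stat z m}"
  shows "\<bar>f (x + y) - f x - f y\<bar> \<le> (K + 3 * C + 6 * C / e) *
    (indicator (U i) x * min 1 (coord_sum y) + indicator (U i) y * min 1 (coord_sum x)
      + (\<Sum>m\<in>{1..i-1}. indicator (U m) y * indicator (U (i - m)) x))"
proof -
  define D where "D = K + 3 * C + 6 * C / e"
  define R where "R = (\<Sum>m\<in>{1..i-1}. indicator (U m) y * indicator (U (i - m)) x :: real)"
  have C0: "C \<ge> 0" using C[of 0] by linarith
  have K0: "K \<ge> 0" using K by (rule lipschitz_bound_nonneg)
  have Ce: "C / e \<ge> 0" using C0 e by simp
  have D: "D \<ge> 0" "3 * C \<le> D" "2 * C + K \<le> D" "3 * C \<le> D * (e / 2)"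
    using K0 C0 Ce e unfolding D_def by (auto simp: field_simps)
  have R0: "R \<ge> 0" unfolding R_def by (intro sum_nonneg) auto
  have tot: "coord_sum x \<ge> 0" "coord_sum y \<ge> 0" using x y by (auto intro: coord_sum_nonneg)
  have b3: "\<bar>f (x + y) - f x - f y\<bar> \<le> 3 * C"
    using C[of "x + y"] C[of x] C[of y] by linarith
  have lip: "\<bar>f (x + y) - f x\<bar> \<le> D * min 1 (coord_sum y)" if y: "y \<in> orthant" for x y
  proof (cases "coord_sum y \<le> 1")
    case True
    have "\<bar>f (x + y) - f x\<bar> \<le> K * norm y" using K[of "x + y" x] by simp
    also have "\<dots> \<le> K * coord_sum y" using norm_le_coord_sum[OF y] K0 by (intro mult_left_mono)
    also have "\<dots> \<le> D * coord_sum y" using D C0 coord_sum_nonneg[OF y] by (intro mult_right_mono) auto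
    finally show ?thesis using True by simp
  next
    case False
    thus ?thesis using C[of "x + y"] C[of x] D K0 by simp
  qed
  have big: "e / 2 \<le> coord_sum z" if "z \<in> U i" "z \<in> orthant" for z
    using that order_stat_le_norm[OF i, of z] norm_le_coord_sum[of z] by (auto simp: U_def)
  have zero: "f z = 0" if "z \<notin> U i" for z
    using that e by (intro supp) (auto simp: U_def)
  have "\<bar>f (x + y) - f x - f y\<bar> \<le>
      D * (indicator (U i) x * min 1 (coord_sum y) + indicator (U i) y * min 1 (coord_sum x) + R)"
  proof (cases "x \<in> U i")
    case xU: True
    show ?thesis
    proof (cases "y \<in> U i")
      case True
      have "\<bar>f (x + y) - f x - f y\<bar> \<le> D * min 1 (coord_sum y)"
      proof (cases "coord_sum y \<le> 1")
        case t: True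
        have "D * (e / 2) \<le> D * coord_sum y" using big[OF True y] D by (intro mult_left_mono)
        thus ?thesis using t b3 D by simp
      qed (use b3 D in simp)
      also have "\<dots> \<le> D * (min 1 (coord_sum y) + min 1 (coord_sum x) + R)"
        using tot R0 D by (intro mult_left_mono) auto
      finally show ?thesis using xU True by simp
    next
      case False
      have "\<bar>f (x + y) - f x - f y\<bar> \<le> D * min 1 (coord_sum y)"
        using lip[OF y, of x] zero[OF False] by simp
      also have "\<dots> \<le> D * (min 1 (coord_sum y) + R)"
        using R0 D by (intro mult_left_mono) auto
      finally show ?thesis using xU False by simp
    qed
  next
    case xU: False
    show ?thesis
    proof (cases "y \<in> U i")
      case True
      have "\<bar>f (x + y) - f x - f y\<bar> \<le> D * min 1 (coord_sum x)"
        using lip[OF x, of y] zero[OF xU] by (simp add: add.commute)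
      also have "\<dots> \<le> D * (min 1 (coord_sum x) + R)"
        using R0 D by (intro mult_left_mono) auto
      finally show ?thesis using xU True by simp
    next
      case yU: False
      show ?thesis
      proof (cases "f (x + y) = 0")
        case True
        thus ?thesis using zero[OF xU] zero[OF yU] xU yU R0 D by simp
      next
        case False
        define P where "P z = {j. e / 2 \<le> z $ j}" for z :: "real ^ 'd"
        have "e \<le> order_stat (x + y) i" using False supp by force
        hence "i \<le> card {j. e \<le> (x + y) $ j}" using order_stat_ge_iff[OF i] by blast
        also have "\<dots> \<le> card (P x \<union> P y)"
          by (intro card_mono) (auto simp: P_def)
        also have "\<dots> \<le> card (P x) + card (P y)" by (rule card_Un_le)
        finally have ic: "i \<le> card (P x) + card (P y)" .
        have Px: "card (P x) < i" using xU order_stat_ge_iff[OF i, of "e/2" x]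
          by (auto simp: U_def P_def)
        have Py: "card (P y) < i" using yU order_stat_ge_iff[OF i, of "e/2" y]
          by (auto simp: U_def P_def)
        define m where "m = card (P y)"
        have m: "m \<in> {1..i-1}" using ic Px Py by (auto simp: m_def)
        have "y \<in> U m" using m i order_stat_ge_iff[of m "e/2" y]
          by (auto simp: U_def m_def P_def)
        moreover have "x \<in> U (i - m)"
          using m i ic order_stat_ge_iff[of "i - m" "e/2" x]
          by (auto simp: U_def m_def P_def)
        ultimately have "(1::real) = indicator (U m) y * indicator (U (i - m)) x" by simp
        also have "\<dots> \<le> R" unfolding R_def
          by (rule member_le_sum[OF m]) auto
        finally have "D * 1 \<le> D * R" using D by (intro mult_left_mono)
        thus ?thesis using b3 D xU yU by simp
      qed
    qed
  qed
  thus ?thesis by (simp add: D_def R_def)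
qed

section \<open>Increments of cadlag paths over fine meshes\<close>

lemma cadlag_jump:
  fixes x :: "real \<Rightarrow> 'a::euclidean_space"
  assumes "cadlag x" "0 < u"
  shows "(x \<longlongrightarrow> x u - jump x u) (at_left u)"
proof -
  obtain l where l: "(x \<longlongrightarrow> l) (at_left u)" using assms by (auto simp: cadlag_def)
  hence "Lim (at_left u) x = l" by (intro tendsto_Lim) simp
  thus ?thesis using l by (simp add: jump_def)
qed

lemma cadlag_local_oscillation:
  fixes x :: "real \<Rightarrow> 'a::euclidean_space"
  assumes "cadlag x" "0 \<le> u" "0 < r"
  obtains d where "0 < d" "\<And>v. u \<le> v \<Longrightarrow> v < u + d \<Longrightarrow> dist (x v) (x u) < r"
    "\<And>v. 0 \<le> v \<Longrightarrow> u - d < v \<Longrightarrow> v < u \<Longrightarrow> dist (x v) (x u - jump x u) < r"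
proof -
  have "(x \<longlongrightarrow> x u) (at_right u)" using assms by (auto simp: cadlag_def)
  hence "\<forall>\<^sub>F v in at_right u. dist (x v) (x u) < r" using assms(3) by (rule tendstoD)
  then obtain b where b: "b > u" "\<And>v. u < v \<Longrightarrow> v < b \<Longrightarrow> dist (x v) (x u) < r"
    unfolding eventually_at_right_field by blast
  obtain d where d: "0 < d"
    "\<And>v. 0 \<le> v \<Longrightarrow> u - d < v \<Longrightarrow> v < u \<Longrightarrow> dist (x v) (x u - jump x u) < r"
  proof (cases "u = 0")
    case True
    thus ?thesis by (intro that[of 1]) auto
  next
    case False
    hence "\<forall>\<^sub>F v in at_left u. dist (x v) (x u - jump x u) < r"
      using cadlag_jump[OF assms(1), of u] assms by (intro tendstoD) auto
    then obtain a where a: "a < u" "\<And>v. a < v \<Longrightarrow> v < u \<Longrightarrow> dist (x v) (x u - jump x u) < r"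
      unfolding eventually_at_left_field by blast
    thus ?thesis by (intro that[of "u - a"]) auto
  qed
  show ?thesis
  proof (rule that[of "min d (b - u)"])
    show "0 < min d (b - u)" using d b by simp
    fix v
    show "dist (x v) (x u) < r" if "u \<le> v" "v < u + min d (b - u)"
      using b(2)[of v] that assms(3) by (cases "v = u") auto
    show "dist (x v) (x u - jump x u) < r" if "0 \<le> v" "u - min d (b - u) < v" "v < u"
      using d(2)[of v] that by auto
  qed
qed

text \<open>By compactness a cadlag path has only finitely many times that can be responsible for increments
of size \<open>r\<close> over short intervals.\<close>

lemma cadlag_small_increments:
  fixes x :: "real \<Rightarrow> 'a::euclidean_space"
  assumes x: "cadlag x" and r: "0 < r"
  obtains U \<delta> where "finite U" "0 < \<delta>"
    "\<And>a b. 0 \<le> a \<Longrightarrow> a \<le> b \<Longrightarrow> b \<le> c \<Longrightarrow> b - a < \<delta> \<Longrightarrow> U \<inter> {a<..b} = {} \<Longrightarrow>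
      dist (x b) (x a) < r"
proof -
  have "\<exists>d>0. (\<forall>v. u \<le> v \<longrightarrow> v < u + d \<longrightarrow> dist (x v) (x u) < r / 2) \<and>
     (\<forall>v. 0 \<le> v \<longrightarrow> u - d < v \<longrightarrow> v < u \<longrightarrow> dist (x v) (x u - jump x u) < r / 2)"
    if "u \<in> {0..c}" for u
    using cadlag_local_oscillation[OF x, of u "r/2"] r that by (metis atLeastAtMost_iff half_gt_zero)
  then obtain d where d: "\<And>u. u \<in> {0..c} \<Longrightarrow> 0 < d u"
    "\<And>u v. u \<in> {0..c} \<Longrightarrow> u \<le> v \<Longrightarrow> v < u + d u \<Longrightarrow> dist (x v) (x u) < r / 2"
    "\<And>u v. u \<in> {0..c} \<Longrightarrow> 0 \<le> v \<Longrightarrow> u - d u < v \<Longrightarrow> v < u \<Longrightarrow> dist (x v) (x u - jump x u) < r / 2"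
    by metis
  have "compact {0..c}" by simp
  then obtain U where U: "U \<subseteq> {0..c}" "finite U" "{0..c} \<subseteq> (\<Union>u\<in>U. ball u (d u))"
  proof (rule compactE_image[where C = "{0..c}" and f = "\<lambda>u. ball u (d u)"])
    show "{0..c} \<subseteq> (\<Union>u\<in>{0..c}. ball u (d u))" using d(1) by (auto simp del: ball_def)
  qed auto
  obtain \<delta> where \<delta>: "0 < \<delta>"
    "\<And>a. a \<in> {0..c} \<Longrightarrow> \<exists>G\<in>(\<lambda>u. ball u (d u)) ` U. ball a \<delta> \<subseteq> G"
    using Heine_Borel_lemma[of "{0..c}" "(\<lambda>u. ball u (d u)) ` U"] U(3) by auto
  show ?thesis
  proof (rule that[OF U(2) \<delta>(1)])
    fix a b assume ab: "0 \<le> a" "a \<le> b" "b \<le> c" "b - a < \<delta>" "U \<inter> {a<..b} = {}"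
    obtain u where u: "u \<in> U" "ball a \<delta> \<subseteq> ball u (d u)" using \<delta>(2)[of a] ab by auto
    have "a \<in> ball u (d u)" "b \<in> ball u (d u)"
      using u(2) \<delta>(1) ab by (auto simp: dist_real_def subset_iff)
    hence cl: "\<bar>a - u\<bar> < d u" "\<bar>b - u\<bar> < d u" by (auto simp: dist_real_def)
    have uc: "u \<in> {0..c}" using u U by blast
    consider "u \<le> a" | "b < u" using ab(5) u(1) by force
    thus "dist (x b) (x a) < r"
    proof cases
      case 1
      hence "dist (x a) (x u) < r / 2" "dist (x b) (x u) < r / 2"
        using d(2)[OF uc, of a] d(2)[OF uc, of b] 1 cl ab by auto
      thus ?thesis by (metis dist_triangle_half_l dist_commute)
    next
      case 2
      hence "dist (x a) (x u - jump x u) < r / 2" "dist (x b) (x u - jump x u) < r / 2"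
        using d(3)[OF uc, of a] d(3)[OF uc, of b] 2 cl ab by auto
      thus ?thesis by (metis dist_triangle_half_l dist_commute)
    qed
  qed
qed

lemma increments_tendsto_jump:
  fixes x :: "real \<Rightarrow> 'a::euclidean_space"
  assumes x: "cadlag x" and u: "0 < u"
    and ab: "\<forall>\<^sub>F n in F. 0 \<le> a n \<and> a n < u \<and> u \<le> b n" "(a \<longlongrightarrow> u) F" "(b \<longlongrightarrow> u) F"
  shows "((\<lambda>n. x (b n) - x (a n)) \<longlongrightarrow> jump x u) F"
proof (rule tendstoI)
  fix e :: real assume e: "0 < e"
  obtain d where d: "0 < d" "\<And>v. u \<le> v \<Longrightarrow> v < u + d \<Longrightarrow> dist (x v) (x u) < e / 2"
    "\<And>v. 0 \<le> v \<Longrightarrow> u - d < v \<Longrightarrow> v < u \<Longrightarrow> dist (x v) (x u - jump x u) < e / 2"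
    using cadlag_local_oscillation[OF x, of u "e / 2"] u e by auto
  have "\<forall>\<^sub>F n in F. dist (a n) u < d" "\<forall>\<^sub>F n in F. dist (b n) u < d"
    using ab d(1) by (auto dest: tendstoD)
  thus "\<forall>\<^sub>F n in F. dist (x (b n) - x (a n)) (jump x u) < e"
    using ab(1)
  proof eventually_elim
    case (elim n)
    have "dist (x (b n)) (x u) < e / 2" using elim by (intro d(2)) (auto simp: dist_real_def)
    moreover have "dist (x (a n)) (x u - jump x u) < e / 2"
      using elim by (intro d(3)) (auto simp: dist_real_def)
    moreover have "dist (x (b n) - x (a n)) (jump x u) \<le>
        dist (x (b n)) (x u) + dist (x (a n)) (x u - jump x u)"
      unfolding dist_norm
      using norm_triangle_ineq4[of "x (b n) - x u" "x (a n) - (x u - jump x u)"]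
      by (simp add: algebra_simps)
    ultimately show ?case by linarith
  qed
qed

text \<open>The number of steps is rounded up so that the last mesh interval \<open>(k h, (k + 1) h]\<close> contains
time \<open>1\<close>; a jump at time \<open>1\<close> is then counted without a null set having to be removed.\<close>

definition mesh_count :: "real \<Rightarrow> nat" where
  "mesh_count h = nat \<lceil>1 / h\<rceil>"

lemma mesh_count_bounds:
  assumes "0 < h"
  shows "1 \<le> real (mesh_count h) * h" "real (mesh_count h) * h < 1 + h"
proof -
  have "real (mesh_count h) = of_int \<lceil>1 / h\<rceil>" using assms by (simp add: mesh_count_def)
  hence "1 / h \<le> real (mesh_count h)" "real (mesh_count h) < 1 / h + 1" by linarith+
  thus "1 \<le> real (mesh_count h) * h" "real (mesh_count h) * h < 1 + h"
    using assms by (auto simp: field_simps)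
qed

text \<open>On a fine mesh the finitely many exceptional times lie in different intervals. The increments
over these intervals tend to the jumps, and all other increments are too small for \<open>g\<close> to see.\<close>

lemma mesh_sum_tendsto_jump_sum:
  fixes x :: "real \<Rightarrow> 'a::euclidean_space"
  assumes x: "cadlag x" and r: "0 < r"
  obtains V where "finite V" "V \<subseteq> {0<..1}"
    "\<And>u. u \<in> {0<..1} - V \<Longrightarrow> norm (jump x u) \<le> r"
    "\<And>(g :: 'a \<Rightarrow> real) h. continuous_on UNIV g \<Longrightarrow> (\<And>z. norm z \<le> r \<Longrightarrow> g z = 0) \<Longrightarrow>
      (\<And>n. 0 < h n) \<Longrightarrow> h \<longlonglongrightarrow> 0 \<Longrightarrow>
      (\<lambda>n. \<Sum>k<mesh_count (h n). g (x (real (Suc k) * h n) - x (real k * h n)))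
        \<longlonglongrightarrow> (\<Sum>u\<in>V. g (jump x u))"
proof -
  obtain U \<delta> where U: "finite U" "0 < \<delta>"
    "\<And>a b. 0 \<le> a \<Longrightarrow> a \<le> b \<Longrightarrow> b \<le> 2 \<Longrightarrow> b - a < \<delta> \<Longrightarrow> U \<inter> {a<..b} = {} \<Longrightarrow>
      dist (x b) (x a) < r"
    using cadlag_small_increments[OF x r, where c = 2] by metis
  define V where "V = U \<inter> {0<..1}"
  have finV: "finite V" using U by (simp add: V_def)
  show ?thesis
  proof (rule that[OF finV])
    show "V \<subseteq> {0<..1}" by (simp add: V_def)
  next
    fix u assume u: "u \<in> {0<..1} - V"
    have lim: "((\<lambda>a. x u - x a) \<longlongrightarrow> jump x u) (at_left u)"
      using tendsto_diff[OF tendsto_const cadlag_jump[OF x, of u], of "x u"] u by simp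
    \<comment> \<open>no exceptional time lies in \<open>(m, u)\<close>\<close>
    define m where "m = Max (insert (max 0 (u - \<delta>)) (U \<inter> {..<u}))"
    have m: "m < u" unfolding m_def using U u by (subst Max_less_iff) auto
    have "\<forall>\<^sub>F a in at_left u. m < a \<and> a < u"
      unfolding eventually_at_left_field using m by blast
    hence "\<forall>\<^sub>F a in at_left u. norm (x u - x a) \<le> r"
    proof eventually_elim
      case (elim a)
      have m_ge: "y \<le> m" if "y \<in> insert (max 0 (u - \<delta>)) (U \<inter> {..<u})" for y
        unfolding m_def using U(1) that by (intro Max_ge) auto
      have "max 0 (u - \<delta>) \<le> m" by (rule m_ge) simp
      moreover have "U \<inter> {a<..u} = {}"
      proof (rule ccontr)
        assume "U \<inter> {a<..u} \<noteq> {}"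
        then obtain y where y: "y \<in> U" "a < y" "y \<le> u" by auto
        have "u \<notin> U" using u by (auto simp: V_def)
        hence "y < u" using y by (metis order_le_less)
        hence "y \<le> m" using y by (intro m_ge) auto
        thus False using y elim by simp
      qed
      ultimately have "dist (x u) (x a) < r" using elim u by (intro U(3)) auto
      thus ?case by (simp add: dist_norm)
    qed
    moreover have "((\<lambda>a. norm (x u - x a)) \<longlongrightarrow> norm (jump x u)) (at_left u)"
      using lim by (rule tendsto_norm)
    ultimately show "norm (jump x u) \<le> r"
      by (intro tendsto_upperbound[of _ _ "at_left u"]) auto
  next
    fix g :: "'a \<Rightarrow> real" and h :: "nat \<Rightarrow> real"
    assume g: "continuous_on UNIV g" "\<And>z. norm z \<le> r \<Longrightarrow> g z = 0"
      and h: "\<And>n. 0 < h n" "h \<longlonglongrightarrow> 0"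
    define X where "X n k = x (real (Suc k) * h n) - x (real k * h n)" for n k
    \<comment> \<open>the index of the mesh interval that contains \<open>u\<close>\<close>
    define \<kappa> where "\<kappa> n u = nat \<lceil>u / h n\<rceil> - 1" for n u
    have \<kappa>1: "real (\<kappa> n u) * h n < u \<and> u \<le> real (Suc (\<kappa> n u)) * h n" if "0 < u" for n u
    proof -
      have "0 < u / h n" using that h by simp
      hence "1 \<le> \<lceil>u / h n\<rceil>" by linarith
      hence "real (Suc (\<kappa> n u)) = of_int \<lceil>u / h n\<rceil>" by (simp add: \<kappa>_def)
      hence "real (\<kappa> n u) < u / h n" "u / h n \<le> real (Suc (\<kappa> n u))" by linarith+
      thus ?thesis using h(1)[of n] by (auto simp: field_simps)
    qed
    have \<kappa>2: "\<kappa> n u = k" if "real k * h n < u" "u \<le> real (Suc k) * h n" for n u k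
    proof -
      have "real k < u / h n" "u / h n \<le> real k + 1"
        using that h(1)[of n] by (auto simp: field_simps)
      hence "\<lceil>u / h n\<rceil> = int k + 1" by (intro ceiling_unique) auto
      thus ?thesis by (simp add: \<kappa>_def)
    qed
    have small: "\<forall>\<^sub>F n in sequentially. h n < e" if "0 < e" for e
      using order_tendstoD(2)[OF h(2) that] .
    have inj: "\<forall>\<^sub>F n in sequentially. inj_on (\<kappa> n) V"
    proof -
      have "\<forall>\<^sub>F n in sequentially. \<forall>p\<in>V \<times> V. fst p \<noteq> snd p \<longrightarrow> h n < \<bar>fst p - snd p\<bar>"
        using finV small by (intro eventually_ball_finite) (auto intro: eventually_mono)
      thus ?thesis
      proof eventually_elim
        case (elim n)
        show ?case
        proof (rule inj_onI)
          fix u v assume uv: "u \<in> V" "v \<in> V" "\<kappa> n u = \<kappa> n v"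
          have "\<bar>u - v\<bar> \<le> h n"
            using \<kappa>1[of u n] \<kappa>1[of v n] uv by (auto simp: V_def algebra_simps)
          thus "u = v" using elim uv by force
        qed
      qed
    qed
    have gap: "\<forall>\<^sub>F n in sequentially. \<forall>u\<in>U. 1 < u \<longrightarrow> h n < u - 1"
      using U(1) small by (intro eventually_ball_finite) (auto intro: eventually_mono)
    have "\<forall>\<^sub>F n in sequentially.
        (\<Sum>u\<in>V. g (X n (\<kappa> n u))) = (\<Sum>k<mesh_count (h n). g (X n k))"
      using inj gap small[OF U(2)] small[OF zero_less_one]
    proof eventually_elim
      case (elim n)
      have "(\<Sum>u\<in>V. g (X n (\<kappa> n u))) = (\<Sum>k\<in>\<kappa> n ` V. g (X n k))"
        using elim(1) by (simp add: sum.reindex)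
      also have "\<dots> = (\<Sum>k<mesh_count (h n). g (X n k))"
      proof (rule sum.mono_neutral_left)
        show "\<kappa> n ` V \<subseteq> {..<mesh_count (h n)}"
        proof safe
          fix u assume u: "u \<in> V"
          have "real (\<kappa> n u) * h n < real (mesh_count (h n)) * h n"
            using \<kappa>1[of u n] u mesh_count_bounds(1)[OF h(1), of n] by (auto simp: V_def)
          thus "\<kappa> n u < mesh_count (h n)" using h(1)[of n] by simp
        qed
        show "\<forall>k\<in>{..<mesh_count (h n)} - \<kappa> n ` V. g (X n k) = 0"
        proof
          fix k assume k: "k \<in> {..<mesh_count (h n)} - \<kappa> n ` V"
          have "real (Suc k) * h n \<le> real (mesh_count (h n)) * h n"
            using k h(1)[of n] by (intro mult_right_mono) auto
          hence top: "real (Suc k) * h n < 1 + h n"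
            using mesh_count_bounds(2)[OF h(1), of n] by linarith
          have "U \<inter> {real k * h n<..real (Suc k) * h n} = {}"
          proof (rule ccontr)
            assume "U \<inter> {real k * h n<..real (Suc k) * h n} \<noteq> {}"
            then obtain u where u: "u \<in> U" "real k * h n < u" "u \<le> real (Suc k) * h n" by auto
            have "0 \<le> real k * h n" using h(1)[of n] by simp
            hence "0 < u" using u by linarith
            moreover have "u \<le> 1"
            proof (rule ccontr)
              assume "\<not> u \<le> 1"
              hence "h n < u - 1" using elim(2) u by auto
              thus False using u top by linarith
            qed
            ultimately have "u \<in> V" using u by (simp add: V_def)
            thus False using k \<kappa>2[OF u(2,3)] by blast
          qed
          hence "dist (x (real (Suc k) * h n)) (x (real k * h n)) < r"
            using h(1)[of n] elim top by (intro U(3)) (auto simp: algebra_simps)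
          thus "g (X n k) = 0" by (intro g(2)) (simp add: X_def dist_norm)
        qed
      qed simp
      finally show ?case .
    qed
    moreover have "(\<lambda>n. \<Sum>u\<in>V. g (X n (\<kappa> n u))) \<longlonglongrightarrow> (\<Sum>u\<in>V. g (jump x u))"
    proof (rule tendsto_sum)
      fix u assume "u \<in> V"
      hence u: "0 < u" by (simp add: V_def)
      have *: "(\<lambda>n. u - h n) \<longlonglongrightarrow> u" "(\<lambda>n. u + h n) \<longlonglongrightarrow> u"
        using tendsto_diff[OF tendsto_const h(2), of u] tendsto_add[OF tendsto_const h(2), of u] by auto
      have "(\<lambda>n. X n (\<kappa> n u)) \<longlonglongrightarrow> jump x u"
        unfolding X_def
      proof (rule increments_tendsto_jump[OF x u])
        show "\<forall>\<^sub>F n in sequentially. 0 \<le> real (\<kappa> n u) * h n \<and> real (\<kappa> n u) * h n < u \<and>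
            u \<le> real (Suc (\<kappa> n u)) * h n"
          using \<kappa>1[OF u] h(1) by (intro always_eventually) (auto simp: less_imp_le)
        have lo: "u - h n \<le> real (\<kappa> n u) * h n" for n
          using \<kappa>1[OF u, of n] by (simp add: algebra_simps)
        have hi: "real (Suc (\<kappa> n u)) * h n \<le> u + h n" for n
          using \<kappa>1[OF u, of n] by (simp add: algebra_simps)
        show "(\<lambda>n. real (\<kappa> n u) * h n) \<longlonglongrightarrow> u"
          by (rule tendsto_sandwich[OF _ _ *(1) tendsto_const])
             (use lo \<kappa>1[OF u] in \<open>auto intro!: always_eventually less_imp_le\<close>)
        show "(\<lambda>n. real (Suc (\<kappa> n u)) * h n) \<longlonglongrightarrow> u"
          by (rule tendsto_sandwich[OF _ _ tendsto_const *(2)])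
             (use hi \<kappa>1[OF u] in \<open>auto intro!: always_eventually less_imp_le simp del: of_nat_Suc\<close>)
      qed
      thus "(\<lambda>n. g (X n (\<kappa> n u))) \<longlonglongrightarrow> g (jump x u)"
        using g(1) by (auto intro: continuous_on_tendsto_compose)
    qed
    ultimately show "(\<lambda>n. \<Sum>k<mesh_count (h n). g (x (real (Suc k) * h n) - x (real k * h n)))
        \<longlonglongrightarrow> (\<Sum>u\<in>V. g (jump x u))"
      unfolding X_def by (rule Lim_transform_eventually[rotated])
  qed
qed

section \<open>Sums over the jumps of a Levy process\<close>

text \<open>The sum of \<open>F\<close> over the jumps in \<open>(0,1]\<close>. The value \<open>F 0\<close> is counted at every continuity
point, so only functions with \<open>F 0 = 0\<close> are of interest.\<close>

definition jump_integral :: "(real \<Rightarrow> 'a::euclidean_space) \<Rightarrow> ('a \<Rightarrow> ennreal) \<Rightarrow> ennreal" where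
  "jump_integral x F = (\<integral>\<^sup>+ u. F (jump x u) \<partial>count_space {0<..1})"

lemma jump_count_eq_jump_integral:
  "jump_count x A = jump_integral x (indicator (A - {0}))"
proof -
  have "jump_count x A = (\<integral>\<^sup>+ u. indicator {t \<in> {0<..1}. jump x t \<noteq> 0 \<and> jump x t \<in> A} u \<partial>count_space UNIV)"
    unfolding jump_count_def by (rule nn_integral_indicator[symmetric]) simp
  also have "\<dots> = (\<integral>\<^sup>+ u. indicator (A - {0}) (jump x u) * indicator {0<..1} u \<partial>count_space UNIV)"
    by (intro nn_integral_cong) (auto simp: indicator_def)
  also have "\<dots> = jump_integral x (indicator (A - {0}))"
    unfolding jump_integral_def by (subst (2) nn_integral_count_space_indicator) (simp_all add: NO_MATCH_def)
  finally show ?thesis .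
qed

lemma mesh_sum_tendsto_jump_integral:
  fixes x :: "real \<Rightarrow> 'a::euclidean_space" and g :: "'a \<Rightarrow> real"
  assumes x: "cadlag x" and r: "0 < r"
    and g: "continuous_on UNIV g" "\<And>z. norm z \<le> r \<Longrightarrow> g z = 0" "\<And>z. 0 \<le> g z"
    and h: "\<And>n. 0 < h n" "h \<longlonglongrightarrow> 0"
  shows "(\<lambda>n. \<Sum>k<mesh_count (h n). g (x (real (Suc k) * h n) - x (real k * h n)))
           \<longlonglongrightarrow> enn2real (jump_integral x g)"
    and "jump_integral x g < \<infinity>"
proof -
  obtain V where V: "finite V" "V \<subseteq> {0<..1}"
    "\<And>u. u \<in> {0<..1} - V \<Longrightarrow> norm (jump x u) \<le> r"
    "\<And>(g :: 'a \<Rightarrow> real) h. continuous_on UNIV g \<Longrightarrow> (\<And>z. norm z \<le> r \<Longrightarrow> g z = 0) \<Longrightarrow>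
      (\<And>n. 0 < h n) \<Longrightarrow> h \<longlonglongrightarrow> 0 \<Longrightarrow>
      (\<lambda>n. \<Sum>k<mesh_count (h n). g (x (real (Suc k) * h n) - x (real k * h n)))
        \<longlonglongrightarrow> (\<Sum>u\<in>V. g (jump x u))"
    by (rule mesh_sum_tendsto_jump_sum[OF x r]) blast
  have "jump_integral x g = (\<Sum>u\<in>V. ennreal (g (jump x u)))"
    unfolding jump_integral_def
    by (rule nn_integral_count_space'[OF V(1) _ V(2)]) (use V(3) g(2) in auto)
  also have "\<dots> = ennreal (\<Sum>u\<in>V. g (jump x u))"
    by (rule sum_ennreal) (rule g(3))
  finally have e: "jump_integral x g = ennreal (\<Sum>u\<in>V. g (jump x u))" .
  show "jump_integral x g < \<infinity>" unfolding e by simp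
  have "enn2real (jump_integral x g) = (\<Sum>u\<in>V. g (jump x u))"
    unfolding e using g(3) by (simp add: sum_nonneg)
  thus "(\<lambda>n. \<Sum>k<mesh_count (h n). g (x (real (Suc k) * h n) - x (real k * h n)))
           \<longlonglongrightarrow> enn2real (jump_integral x g)"
    using V(4)[OF g(1,2) h] by simp
qed

lemma jump_integral_add:
  assumes "F = (\<lambda>z. F1 z + F2 z)"
  shows "jump_integral x F = jump_integral x F1 + jump_integral x F2"
  unfolding jump_integral_def assms by (rule nn_integral_add) auto

lemma jump_integral_cmult: "jump_integral x (\<lambda>z. c * F z) = c * jump_integral x F"
  unfolding jump_integral_def by (rule nn_integral_cmult) auto

lemma jump_integral_SUP:
  assumes "incseq F"
  shows "jump_integral x (\<lambda>z. SUP i. F i z) = (SUP i. jump_integral x (F i))"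
  unfolding jump_integral_def
  by (rule nn_integral_monotone_convergence_SUP)
     (use assms in \<open>auto simp: incseq_def le_fun_def\<close>)

lemma jump_integral_mono: "(\<And>z. F z \<le> G z) \<Longrightarrow> jump_integral x F \<le> jump_integral x G"
  unfolding jump_integral_def by (intro nn_integral_mono) auto

locale levy = prob_space M for M :: "'w measure" +
  fixes L :: "real \<Rightarrow> 'w \<Rightarrow> 'a::euclidean_space"
  assumes levy_process: "levy_process M L"
begin

lemma measurable_L: "0 \<le> t \<Longrightarrow> L t \<in> borel_measurable M"
  using levy_process by (simp add: levy_process_def)

lemma AE_L_0: "AE \<omega> in M. L 0 \<omega> = 0"
  using levy_process by (simp add: levy_process_def)

lemma cadlag_path: "\<omega> \<in> space M \<Longrightarrow> cadlag (\<lambda>t. L t \<omega>)"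
  using levy_process by (simp add: levy_process_def)

lemma distr_increment:
  "0 \<le> u \<Longrightarrow> 0 \<le> h \<Longrightarrow> distr M borel (\<lambda>\<omega>. L (u + h) \<omega> - L u \<omega>) = distr M borel (L h)"
  using levy_process by (simp add: levy_process_def)

lemma indep_increments:
  "0 \<le> t 0 \<Longrightarrow> (\<And>k. k < n \<Longrightarrow> t k < t (Suc k)) \<Longrightarrow>
     indep_vars (\<lambda>_. borel) (\<lambda>k \<omega>. L (t (Suc k)) \<omega> - L (t k) \<omega>) {..<n}"
  using levy_process unfolding levy_process_def by blast

abbreviation path :: "'w \<Rightarrow> real \<Rightarrow> 'a" where
  "path \<omega> \<equiv> \<lambda>t. L t \<omega>"

lemma measurable_jump_integral_continuous:
  fixes g :: "'a \<Rightarrow> real"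
  assumes r: "0 < r"
    and g: "continuous_on UNIV g" "\<And>z. norm z \<le> r \<Longrightarrow> g z = 0" "\<And>z. 0 \<le> g z"
  shows "(\<lambda>\<omega>. jump_integral (path \<omega>) g) \<in> borel_measurable M"
proof -
  define h :: "nat \<Rightarrow> real" where "h n = 1 / real (Suc n)" for n
  have h: "\<And>n. 0 < h n" "h \<longlonglongrightarrow> 0"
    using LIMSEQ_Suc[OF lim_1_over_n[where 'a=real]] by (auto simp: h_def[abs_def])
  have gm: "g \<in> borel_measurable borel" using g(1) by (rule borel_measurable_continuous_onI)
  have [simp]: "0 \<le> h n" for n using h(1)[of n] by simp
  have "(\<lambda>\<omega>. enn2real (jump_integral (path \<omega>) g)) \<in> borel_measurable M"
  proof (rule borel_measurable_LIMSEQ_real)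
    fix \<omega> assume "\<omega> \<in> space M"
    thus "(\<lambda>n. \<Sum>k<mesh_count (h n). g (L (real (Suc k) * h n) \<omega> - L (real k * h n) \<omega>))
           \<longlonglongrightarrow> enn2real (jump_integral (path \<omega>) g)"
      by (intro mesh_sum_tendsto_jump_integral[OF cadlag_path r g h])
  next
    fix n
    have "(\<lambda>\<omega>. L (real (Suc k) * h n) \<omega> - L (real k * h n) \<omega>) \<in> borel_measurable M" for k
      by (intro borel_measurable_diff measurable_L mult_nonneg_nonneg) auto
    hence "(\<lambda>\<omega>. g (L (real (Suc k) * h n) \<omega> - L (real k * h n) \<omega>)) \<in> borel_measurable M" for k
      using gm by (rule measurable_compose)
    thus "(\<lambda>\<omega>. \<Sum>k<mesh_count (h n). g (L (real (Suc k) * h n) \<omega> - L (real k * h n) \<omega>)) \<in> borel_measurable M"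
      by (rule borel_measurable_sum)
  qed
  hence "(\<lambda>\<omega>. ennreal (enn2real (jump_integral (path \<omega>) g))) \<in> borel_measurable M"
    by (rule measurable_compose[OF _ measurable_ennreal])
  moreover have "(\<lambda>\<omega>. ennreal (enn2real (jump_integral (path \<omega>) g))) \<in> borel_measurable M \<longleftrightarrow> ?thesis"
  proof (rule measurable_cong)
    fix \<omega> assume "\<omega> \<in> space M"
    hence "jump_integral (path \<omega>) g < top"
      using mesh_sum_tendsto_jump_integral(2)[OF cadlag_path r g h] by simp
    thus "ennreal (enn2real (jump_integral (path \<omega>) g)) = jump_integral (path \<omega>) g"
      by (rule ennreal_enn2real)
  qed
  ultimately show ?thesis by (rule rev_iffD1)
qed

text \<open>The indicator of an open set is an increasing limit of continuous functions, and for these the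
sum over jumps is a limit of measurable mesh sums.\<close>

lemma measurable_jump_integral_open:
  fixes A :: "'a set"
  assumes r: "0 < r" and A: "open A"
  shows "(\<lambda>\<omega>. jump_integral (path \<omega>) (indicator (A \<inter> {z. r < norm z}))) \<in> borel_measurable M"
proof -
  define B where "B = A \<inter> {z. r < norm z}"
  have B: "open B" using A unfolding B_def
    by (intro open_Int open_Collect_less continuous_intros)
  have B0: "0 \<notin> B" using r by (simp add: B_def)
  \<comment> \<open>\<open>B\<close> avoids \<open>0\<close>, so its complement is nonempty and \<open>infdist\<close> is not the default \<open>0\<close>\<close>
  define g where "g n z = min 1 (real n * infdist z (- B))" for n z
  have "jump_integral (path \<omega>) (indicator B) = (SUP n. jump_integral (path \<omega>) (g n))" for \<omega>
  proof -
    have "incseq (\<lambda>n z. ennreal (g n z))"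
      by (auto simp: incseq_def le_fun_def g_def intro!: ennreal_leI min.mono mult_right_mono infdist_nonneg)
    hence "jump_integral (path \<omega>) (\<lambda>z. SUP n. ennreal (g n z)) = (SUP n. jump_integral (path \<omega>) (g n))"
      by (rule jump_integral_SUP)
    moreover have "(SUP n. ennreal (g n z)) = indicator B z" for z
    proof (cases "z \<in> B")
      case True
      have "infdist z (- B) \<noteq> 0"
        using True B B0 in_closed_iff_infdist_zero[of "- B" z] by auto
      hence p: "0 < infdist z (- B)" using infdist_nonneg[of z "- B"] by simp
      obtain n where "1 / infdist z (- B) < real n" using reals_Archimedean2 by blast
      hence "g n z = 1" using p by (simp add: g_def field_simps)
      hence "1 \<le> (SUP n. ennreal (g n z))" by (intro SUP_upper2[of n]) auto
      moreover have "(SUP n. ennreal (g n z)) \<le> 1"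
        by (intro SUP_least) (simp add: g_def)
      ultimately show ?thesis using True by (auto intro: antisym)
    next
      case False
      hence "g n z = 0" for n by (simp add: g_def)
      thus ?thesis using False by simp
    qed
    ultimately show ?thesis by simp
  qed
  moreover have "(\<lambda>\<omega>. jump_integral (path \<omega>) (g n)) \<in> borel_measurable M" for n
  proof (rule measurable_jump_integral_continuous[OF r])
    show "continuous_on UNIV (g n)" unfolding g_def by (intro continuous_intros)
    show "g n z = 0" if "norm z \<le> r" for z using that by (simp add: g_def B_def)
    show "0 \<le> g n z" for z by (simp add: g_def infdist_nonneg)
  qed
  ultimately have "(\<lambda>\<omega>. jump_integral (path \<omega>) (indicator B)) \<in> borel_measurable M"
    by (simp only: ) (rule borel_measurable_SUP, auto)
  thus ?thesis by (simp only: B_def)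
qed

lemma jump_integral_finite:
  assumes r: "0 < r" and \<omega>: "\<omega> \<in> space M"
  shows "jump_integral (path \<omega>) (indicator (A \<inter> {z. r < norm z})) < \<infinity>"
proof -
  define g :: "'a \<Rightarrow> real" where "g z = max 0 (min 1 (2 * norm z / r - 1))" for z
  have "g z = 1" if "r < norm z" for z
    using that r by (simp add: g_def field_simps)
  hence "jump_integral (path \<omega>) (indicator (A \<inter> {z. r < norm z})) \<le> jump_integral (path \<omega>) g"
    by (intro jump_integral_mono) (simp add: indicator_def)
  also have "\<dots> < \<infinity>"
  proof (rule mesh_sum_tendsto_jump_integral(2)[OF cadlag_path[OF \<omega>], of "r / 2"])
    show "continuous_on UNIV g" unfolding g_def by (intro continuous_intros) (use r in auto)
    show "g z = 0" if "norm z \<le> r / 2" for z using that r by (simp add: g_def field_simps)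
    show "(\<lambda>n. 1 / real (Suc n)) \<longlonglongrightarrow> 0"
      using LIMSEQ_Suc[OF lim_1_over_n[where 'a=real]] by simp
  qed (use r in \<open>auto simp: g_def\<close>)
  finally show ?thesis .
qed

text \<open>The passage from open to Borel sets uses a Dynkin system. Away from zero every path has finitely
many jumps, which makes the subtraction for complements legitimate.\<close>

lemma measurable_jump_integral_away:
  fixes A :: "'a set"
  assumes r: "0 < r" and A: "A \<in> sets borel"
  shows "(\<lambda>\<omega>. jump_integral (path \<omega>) (indicator (A \<inter> {z. r < norm z}))) \<in> borel_measurable M"
proof -
  have gen: "Int_stable {S :: 'a set. open S}" "{S :: 'a set. open S} \<subseteq> Pow UNIV"
    by (auto simp: Int_stable_def)
  have "A \<in> sigma_sets UNIV {S. open S}" using A by (simp add: borel_def)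
  thus ?thesis
  proof (induction A rule: sigma_sets_induct_disjoint[OF gen, consumes 1, case_names basic empty compl union])
    case (basic A)
    thus ?case by (intro measurable_jump_integral_open r) simp
  next
    case empty
    show ?case by (simp add: jump_integral_def)
  next
    case (compl A)
    have diff: "jump_integral (path \<omega>) (indicator ((UNIV - A) \<inter> {z. r < norm z})) =
        jump_integral (path \<omega>) (indicator (UNIV \<inter> {z. r < norm z})) -
        jump_integral (path \<omega>) (indicator (A \<inter> {z. r < norm z}))" if "\<omega> \<in> space M" for \<omega>
    proof -
      have "jump_integral (path \<omega>) (indicator (UNIV \<inter> {z. r < norm z})) =
        jump_integral (path \<omega>) (indicator (A \<inter> {z. r < norm z})) +
        jump_integral (path \<omega>) (indicator ((UNIV - A) \<inter> {z. r < norm z}))"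
        by (rule jump_integral_add) (auto simp: fun_eq_iff indicator_def)
      moreover have "jump_integral (path \<omega>) (indicator (A \<inter> {z. r < norm z})) \<noteq> top"
        using jump_integral_finite[OF r that, of A] by (intro notI) simp
      ultimately show ?thesis by simp
    qed
    moreover have "(\<lambda>\<omega>. jump_integral (path \<omega>) (indicator (UNIV \<inter> {z. r < norm z}))) \<in> borel_measurable M"
      by (intro measurable_jump_integral_open r) simp
    moreover note compl(2)
    ultimately have "(\<lambda>\<omega>. jump_integral (path \<omega>) (indicator (UNIV \<inter> {z. r < norm z})) -
        jump_integral (path \<omega>) (indicator (A \<inter> {z. r < norm z}))) \<in> borel_measurable M"
      by (intro borel_measurable_minus_ennreal)
    moreover have "(\<lambda>\<omega>. jump_integral (path \<omega>) (indicator ((UNIV - A) \<inter> {z. r < norm z}))) \<in> borel_measurable M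
        \<longleftrightarrow> (\<lambda>\<omega>. jump_integral (path \<omega>) (indicator (UNIV \<inter> {z. r < norm z})) -
        jump_integral (path \<omega>) (indicator (A \<inter> {z. r < norm z}))) \<in> borel_measurable M"
      by (rule measurable_cong) (rule diff)
    ultimately show ?case by (rule iffD2[rotated])
  next
    case (union A)
    have "jump_integral (path \<omega>) (indicator ((\<Union>i. A i) \<inter> {z. r < norm z})) =
      (\<Sum>i. jump_integral (path \<omega>) (indicator (A i \<inter> {z. r < norm z})))" for \<omega>
    proof -
      have d: "disjoint_family (\<lambda>i. A i \<inter> {z. r < norm z})"
        using union(1) by (auto simp: disjoint_family_on_def)
      have "indicator ((\<Union>i. A i) \<inter> {z. r < norm z}) z =
          (\<Sum>i. indicator (A i \<inter> {z. r < norm z}) z :: ennreal)" for z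
        using suminf_indicator[OF d, of z] by simp
      thus ?thesis unfolding jump_integral_def by (simp add: nn_integral_suminf)
    qed
    thus ?case using union(3) by (simp only: borel_measurable_suminf_order)
  qed
qed

lemma measurable_jump_integral_set:
  fixes A :: "'a set"
  assumes A: "A \<in> sets borel"
  shows "(\<lambda>\<omega>. jump_integral (path \<omega>) (indicator (A - {0}))) \<in> borel_measurable M"
proof -
  define R where "R n = 1 / real (Suc n)" for n
  have "jump_integral (path \<omega>) (indicator (A - {0})) =
      (SUP n. jump_integral (path \<omega>) (indicator (A \<inter> {z. R n < norm z})))" for \<omega>
  proof -
    have "R n \<le> R m" if "m \<le> n" for m n using that by (simp add: R_def frac_le)
    hence "incseq (\<lambda>n. indicator (A \<inter> {z. R n < norm z}) :: 'a \<Rightarrow> ennreal)"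
      by (fastforce simp: incseq_def le_fun_def indicator_def)
    hence "jump_integral (path \<omega>) (\<lambda>z. SUP n. indicator (A \<inter> {z. R n < norm z}) z) =
      (SUP n. jump_integral (path \<omega>) (indicator (A \<inter> {z. R n < norm z})))"
      by (rule jump_integral_SUP)
    moreover have "(SUP n. indicator (A \<inter> {z. R n < norm z}) z :: ennreal) = indicator (A - {0}) z" for z
    proof (cases "z \<in> A - {0}")
      case True
      then obtain n where "R n < norm z"
        unfolding R_def by (metis DiffE insertI1 nat_approx_posE zero_less_norm_iff singletonI)
      hence "indicator (A \<inter> {z. R n < norm z}) z = (1 :: ennreal)" using True by simp
      hence "1 \<le> (SUP n. indicator (A \<inter> {z. R n < norm z}) z :: ennreal)"
        by (intro SUP_upper2[of n]) auto
      moreover have "(SUP n. indicator (A \<inter> {z. R n < norm z}) z :: ennreal) \<le> 1"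
        by (intro SUP_least) (simp add: indicator_def)
      ultimately show ?thesis using True by (auto intro: antisym)
    next
      case False
      have "R n \<ge> 0" for n by (simp add: R_def)
      hence "indicator (A \<inter> {z. R n < norm z}) z = (0 :: ennreal)" for n
        using False by (auto simp: indicator_def not_less)
      thus ?thesis using False by simp
    qed
    ultimately show ?thesis by simp
  qed
  moreover have "(\<lambda>\<omega>. jump_integral (path \<omega>) (indicator (A \<inter> {z. R n < norm z}))) \<in> borel_measurable M" for n
    by (intro measurable_jump_integral_away A) (simp add: R_def)
  ultimately show ?thesis by (simp only: ) (rule borel_measurable_SUP, auto)
qed

text \<open>Campbell's formula for the jumps of the process.\<close>

lemma nn_integral_levy_measure:
  assumes \<nu>: "is_levy_measure M L \<nu>" and F: "F \<in> borel_measurable borel" "F 0 = 0"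
  shows "(\<integral>\<^sup>+ z. F z \<partial>\<nu>) = (\<integral>\<^sup>+ \<omega>. jump_integral (path \<omega>) F \<partial>M)"
    and "(\<lambda>\<omega>. jump_integral (path \<omega>) F) \<in> borel_measurable M"
proof -
  define E where "E F = (\<lambda>z. F z * indicator (- {0}) z)" for F :: "'a \<Rightarrow> ennreal"
  have sets: "sets \<nu> = sets borel" using \<nu> by (simp add: is_levy_measure_def)
  note [measurable_cong] = sets
  have [measurable]: "E F \<in> borel_measurable borel" if "F \<in> borel_measurable borel" for F
    using that unfolding E_def by measurable
  have "(\<integral>\<^sup>+ z. E F z \<partial>\<nu>) = (\<integral>\<^sup>+ \<omega>. jump_integral (path \<omega>) (E F) \<partial>M) \<and>
      (\<lambda>\<omega>. jump_integral (path \<omega>) (E F)) \<in> borel_measurable M"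
    using F(1)
  proof (induction F rule: borel_measurable_induct)
    case (cong f g)
    hence "f = g" by (intro ext) simp
    thus ?case using cong by simp
  next
    case (set A)
    have e: "E (indicator A) = indicator (A - {0})" by (auto simp: E_def fun_eq_iff indicator_def)
    have "\<forall>A\<in>sets borel. emeasure \<nu> A = (\<integral>\<^sup>+ \<omega>. jump_count (path \<omega>) A \<partial>M)"
      using \<nu> unfolding is_levy_measure_def by (rule conjunct2)
    hence "emeasure \<nu> (A - {0}) = (\<integral>\<^sup>+ \<omega>. jump_count (path \<omega>) (A - {0}) \<partial>M)"
      using set by (elim bspec) auto
    also have "\<dots> = (\<integral>\<^sup>+ \<omega>. jump_integral (path \<omega>) (indicator (A - {0})) \<partial>M)"
      by (simp add: jump_count_eq_jump_integral)
    finally show ?case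
      unfolding e using set measurable_jump_integral_set[OF set] by (simp add: sets)
  next
    case (mult u v)
    have e: "E (\<lambda>x. v * u x) = (\<lambda>x. v * E u x)" by (auto simp: E_def fun_eq_iff mult_ac)
    have [measurable]: "(\<lambda>\<omega>. jump_integral (path \<omega>) (E u)) \<in> borel_measurable M"
      using mult by blast
    have [measurable]: "u \<in> borel_measurable borel" using mult by blast
    have "(\<lambda>\<omega>. v * jump_integral (path \<omega>) (E u)) \<in> borel_measurable M" by measurable
    moreover have "(\<integral>\<^sup>+ z. E u z \<partial>\<nu>) = (\<integral>\<^sup>+ \<omega>. jump_integral (path \<omega>) (E u) \<partial>M)"
      using mult by blast
    ultimately show ?case unfolding e jump_integral_cmult
      by (simp add: nn_integral_cmult)
  next
    case (add u v)
    have e: "E (\<lambda>x. v x + u x) = (\<lambda>x. E v x + E u x)"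
      by (auto simp: E_def fun_eq_iff distrib_right)
    have [measurable]: "(\<lambda>\<omega>. jump_integral (path \<omega>) (E u)) \<in> borel_measurable M"
      "(\<lambda>\<omega>. jump_integral (path \<omega>) (E v)) \<in> borel_measurable M"
      using add by blast+
    have [measurable]: "u \<in> borel_measurable borel" "v \<in> borel_measurable borel"
      using add by blast+
    have "(\<lambda>\<omega>. jump_integral (path \<omega>) (E v) + jump_integral (path \<omega>) (E u)) \<in> borel_measurable M"
      by measurable
    moreover have "(\<integral>\<^sup>+ z. E u z \<partial>\<nu>) = (\<integral>\<^sup>+ \<omega>. jump_integral (path \<omega>) (E u) \<partial>M)"
      "(\<integral>\<^sup>+ z. E v z \<partial>\<nu>) = (\<integral>\<^sup>+ \<omega>. jump_integral (path \<omega>) (E v) \<partial>M)"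
      using add by blast+
    ultimately show ?case unfolding e jump_integral_add[OF refl]
      by (simp add: nn_integral_add)
  next
    case (seq U)
    have e: "E (\<lambda>x. SUP i. U i x) = (\<lambda>x. SUP i. E (U i) x)"
      by (auto simp: E_def fun_eq_iff indicator_def)
    have inc: "incseq (\<lambda>i. E (U i))"
      using seq by (auto simp: E_def incseq_def le_fun_def intro!: mult_right_mono)
    have inc': "incseq (\<lambda>i \<omega>. jump_integral (path \<omega>) (E (U i)))"
      using inc by (auto simp: incseq_def le_fun_def intro!: jump_integral_mono)
    have m: "(\<lambda>\<omega>. jump_integral (path \<omega>) (E (U i))) \<in> borel_measurable M"
      "E (U i) \<in> borel_measurable \<nu>"
      "(\<integral>\<^sup>+ z. E (U i) z \<partial>\<nu>) = (\<integral>\<^sup>+ \<omega>. jump_integral (path \<omega>) (E (U i)) \<partial>M)" for i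
      using seq by (auto simp: measurable_cong_sets[OF sets refl])
    have "(\<integral>\<^sup>+ z. (SUP i. E (U i) z) \<partial>\<nu>) = (SUP i. \<integral>\<^sup>+ z. E (U i) z \<partial>\<nu>)"
      by (rule nn_integral_monotone_convergence_SUP[OF inc m(2)])
    also have "\<dots> = (SUP i. \<integral>\<^sup>+ \<omega>. jump_integral (path \<omega>) (E (U i)) \<partial>M)"
      by (simp only: m(3))
    also have "\<dots> = (\<integral>\<^sup>+ \<omega>. (SUP i. jump_integral (path \<omega>) (E (U i))) \<partial>M)"
      by (rule nn_integral_monotone_convergence_SUP[OF inc' m(1), symmetric])
    finally have eq: "(\<integral>\<^sup>+ z. (SUP i. E (U i) z) \<partial>\<nu>) =
      (\<integral>\<^sup>+ \<omega>. (SUP i. jump_integral (path \<omega>) (E (U i))) \<partial>M)" .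
    have "(\<lambda>\<omega>. SUP i. jump_integral (path \<omega>) (E (U i))) \<in> borel_measurable M"
      by (rule borel_measurable_SUP[OF _ m(1)]) simp
    with eq have "(\<integral>\<^sup>+ z. E (\<lambda>x. SUP i. U i x) z \<partial>\<nu>) =
        (\<integral>\<^sup>+ \<omega>. jump_integral (path \<omega>) (E (\<lambda>x. SUP i. U i x)) \<partial>M) \<and>
      (\<lambda>\<omega>. jump_integral (path \<omega>) (E (\<lambda>x. SUP i. U i x))) \<in> borel_measurable M"
      unfolding e jump_integral_SUP[OF inc] by (rule conjI)
    moreover have "(\<Squnion> range U) = (\<lambda>x. SUP i. U i x)" by (simp add: fun_eq_iff image_image)
    ultimately show ?case by simp
  qed
  moreover have "E F = F" using F(2) by (auto simp: E_def fun_eq_iff indicator_def)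
  ultimately show "(\<integral>\<^sup>+ z. F z \<partial>\<nu>) = (\<integral>\<^sup>+ \<omega>. jump_integral (path \<omega>) F \<partial>M)"
    "(\<lambda>\<omega>. jump_integral (path \<omega>) F) \<in> borel_measurable M" by simp_all
qed

end

section \<open>Expectations of mesh sums\<close>

text \<open>Bounded second moments give uniform integrability: truncation at \<open>K\<close> changes an expectation
by at most \<open>Q / K\<close>, and truncated variables converge by dominated convergence.\<close>

lemma (in prob_space) expectation_tendsto_of_bounded_second_moment:
  fixes Z :: "nat \<Rightarrow> 'a \<Rightarrow> real" and Y :: "'a \<Rightarrow> real"
  assumes Z: "\<And>n. Z n \<in> borel_measurable M" and nonneg: "\<And>n \<omega>. 0 \<le> Z n \<omega>"
    and lim: "\<And>\<omega>. \<omega> \<in> space M \<Longrightarrow> (\<lambda>n. Z n \<omega>) \<longlonglongrightarrow> Y \<omega>"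
    and int2: "\<And>n. integrable M (\<lambda>\<omega>. (Z n \<omega>)\<^sup>2)" and Q: "\<And>n. expectation (\<lambda>\<omega>. (Z n \<omega>)\<^sup>2) \<le> Q"
  shows "integrable M Y" and "(\<lambda>n. expectation (Z n)) \<longlonglongrightarrow> expectation Y"
proof -
  note [measurable] = Z
  have Ym [measurable]: "Y \<in> borel_measurable M" using lim Z by (rule borel_measurable_LIMSEQ_real)
  have Y0: "0 \<le> Y \<omega>" if "\<omega> \<in> space M" for \<omega>
    using lim[OF that] nonneg by (intro LIMSEQ_le_const) auto
  have Q0: "0 \<le> Q" using Q[of 0] by (rule order_trans[rotated]) simp
  have "(\<integral>\<^sup>+ \<omega>. ennreal ((Y \<omega>)\<^sup>2) \<partial>M) = (\<integral>\<^sup>+ \<omega>. liminf (\<lambda>n. ennreal ((Z n \<omega>)\<^sup>2)) \<partial>M)"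
  proof (rule nn_integral_cong)
    fix \<omega> assume "\<omega> \<in> space M"
    hence "(\<lambda>n. ennreal ((Z n \<omega>)\<^sup>2)) \<longlonglongrightarrow> ennreal ((Y \<omega>)\<^sup>2)"
      by (intro tendsto_intros lim)
    thus "ennreal ((Y \<omega>)\<^sup>2) = liminf (\<lambda>n. ennreal ((Z n \<omega>)\<^sup>2))"
      by (intro lim_imp_Liminf[symmetric]) simp
  qed
  also have "\<dots> \<le> liminf (\<lambda>n. \<integral>\<^sup>+ \<omega>. ennreal ((Z n \<omega>)\<^sup>2) \<partial>M)"
    by (rule nn_integral_liminf) measurable
  also have "\<dots> \<le> liminf (\<lambda>n. ennreal Q)"
  proof (intro Liminf_mono always_eventually allI)
    fix n
    have "(\<integral>\<^sup>+ \<omega>. ennreal ((Z n \<omega>)\<^sup>2) \<partial>M) = ennreal (expectation (\<lambda>\<omega>. (Z n \<omega>)\<^sup>2))"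
      by (rule nn_integral_eq_integral[OF int2]) simp
    thus "(\<integral>\<^sup>+ \<omega>. ennreal ((Z n \<omega>)\<^sup>2) \<partial>M) \<le> ennreal Q"
      using Q[of n] by (simp add: ennreal_leI)
  qed
  also have "\<dots> = ennreal Q" by (simp add: Liminf_const)
  finally have fatou: "(\<integral>\<^sup>+ \<omega>. ennreal ((Y \<omega>)\<^sup>2) \<partial>M) \<le> ennreal Q" .
  have Y2: "integrable M (\<lambda>\<omega>. (Y \<omega>)\<^sup>2)"
    using le_less_trans[OF fatou ennreal_less_top] by (intro integrableI_nonneg) auto
  have "ennreal (expectation (\<lambda>\<omega>. (Y \<omega>)\<^sup>2)) \<le> ennreal Q"
    using fatou by (subst (asm) nn_integral_eq_integral[OF Y2]) auto
  hence QY: "expectation (\<lambda>\<omega>. (Y \<omega>)\<^sup>2) \<le> Q" using Q0 by simp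
  have int: "integrable M W" if W: "W \<in> borel_measurable M" "integrable M (\<lambda>\<omega>. (W \<omega>)\<^sup>2)" for W :: "'a \<Rightarrow> real"
  proof (rule Bochner_Integration.integrable_bound)
    show "integrable M (\<lambda>\<omega>. 1 + (W \<omega>)\<^sup>2)" using W by simp
    show "AE \<omega> in M. norm (W \<omega>) \<le> norm (1 + (W \<omega>)\<^sup>2)"
    proof (rule AE_I2)
      fix \<omega>
      have "0 \<le> (\<bar>W \<omega>\<bar> - 1)\<^sup>2" by simp
      hence "2 * \<bar>W \<omega>\<bar> \<le> 1 + (W \<omega>)\<^sup>2" by (simp add: power2_diff)
      thus "norm (W \<omega>) \<le> norm (1 + (W \<omega>)\<^sup>2)" by simp
    qed
  qed (use W in simp)
  show Yint: "integrable M Y" by (rule int[OF Ym Y2])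
  have Zint: "integrable M (Z n)" for n by (rule int[OF Z int2])
  have trunc: "\<bar>expectation W - expectation (\<lambda>\<omega>. min (W \<omega>) K)\<bar> \<le> Q / K"
    if W: "W \<in> borel_measurable M" "integrable M (\<lambda>\<omega>. (W \<omega>)\<^sup>2)" "expectation (\<lambda>\<omega>. (W \<omega>)\<^sup>2) \<le> Q"
      "\<And>\<omega>. \<omega> \<in> space M \<Longrightarrow> 0 \<le> W \<omega>" and K: "0 < K" for W :: "'a \<Rightarrow> real" and K
  proof -
    have i: "integrable M W" "integrable M (\<lambda>\<omega>. min (W \<omega>) K)"
      using int[OF W(1,2)] by auto
    have pw: "0 \<le> W \<omega> - min (W \<omega>) K \<and> W \<omega> - min (W \<omega>) K \<le> (W \<omega>)\<^sup>2 / K" if "\<omega> \<in> space M" for \<omega>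
    proof -
      have "W \<omega> \<le> (W \<omega>)\<^sup>2 / K" if "K < W \<omega>"
        using that K by (simp add: field_simps power2_eq_square)
      thus ?thesis using W(4)[OF that] K by (auto simp: min_def)
    qed
    have "0 \<le> expectation (\<lambda>\<omega>. W \<omega> - min (W \<omega>) K)"
      using pw by (intro Bochner_Integration.integral_nonneg) auto
    moreover have "expectation (\<lambda>\<omega>. W \<omega> - min (W \<omega>) K) \<le> expectation (\<lambda>\<omega>. (W \<omega>)\<^sup>2 / K)"
      using pw i W(2) by (intro integral_mono) auto
    moreover have "expectation (\<lambda>\<omega>. (W \<omega>)\<^sup>2 / K) \<le> Q / K"
      using W(3) K by (simp add: divide_right_mono)
    ultimately show ?thesis using i by simp
  qed
  show "(\<lambda>n. expectation (Z n)) \<longlonglongrightarrow> expectation Y"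
  proof (rule tendstoI)
    fix e :: real assume e: "0 < e"
    define K where "K = 4 * (Q + 1) / e"
    have K: "0 < K" using e Q0 by (simp add: K_def)
    have QK: "Q / K < e / 4" using e Q0 by (simp add: K_def field_simps)
    have "(\<lambda>n. expectation (\<lambda>\<omega>. min (Z n \<omega>) K)) \<longlonglongrightarrow> expectation (\<lambda>\<omega>. min (Y \<omega>) K)"
    proof (rule integral_dominated_convergence[where w = "\<lambda>_. K"])
      show "AE \<omega> in M. (\<lambda>n. min (Z n \<omega>) K) \<longlonglongrightarrow> min (Y \<omega>) K"
        by (intro AE_I2 tendsto_intros lim)
      show "AE \<omega> in M. norm (min (Z n \<omega>) K) \<le> K" for n
        using K nonneg[of n] by (intro AE_I2) (auto simp: min_def)
    qed auto
    hence "\<forall>\<^sub>F n in sequentially.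
        dist (expectation (\<lambda>\<omega>. min (Z n \<omega>) K)) (expectation (\<lambda>\<omega>. min (Y \<omega>) K)) < e / 2"
      using e by (intro tendstoD) auto
    thus "\<forall>\<^sub>F n in sequentially. dist (expectation (Z n)) (expectation Y) < e"
    proof eventually_elim
      case (elim n)
      show ?case
        using elim trunc[OF Z int2 Q nonneg K, of n] trunc[OF Ym Y2 QY Y0 K] QK
        unfolding dist_real_def by linarith
    qed
  qed
qed

context levy
begin

lemma expectation_increment:
  fixes f :: "'a \<Rightarrow> real"
  assumes [measurable]: "f \<in> borel_measurable borel" and u: "0 \<le> u" "0 \<le> h"
  shows "expectation (\<lambda>\<omega>. f (L (u + h) \<omega> - L u \<omega>)) = expectation (\<lambda>\<omega>. f (L h \<omega>))"
proof -
  have m: "L (u + h) \<in> borel_measurable M" "L u \<in> borel_measurable M" "L h \<in> borel_measurable M"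
    using u by (auto intro: measurable_L)
  note [measurable] = m
  have "expectation (\<lambda>\<omega>. f (L (u + h) \<omega> - L u \<omega>)) =
      integral\<^sup>L (distr M borel (\<lambda>\<omega>. L (u + h) \<omega> - L u \<omega>)) f"
    by (rule integral_distr[symmetric]) measurable
  also have "\<dots> = integral\<^sup>L (distr M borel (L h)) f" using distr_increment[OF u] by simp
  also have "\<dots> = expectation (\<lambda>\<omega>. f (L h \<omega>))" by (rule integral_distr) measurable
  finally show ?thesis .
qed

text \<open>At \<open>u = 0\<close> the factor \<open>f (L 0)\<close> is almost surely constant; for \<open>u > 0\<close> one uses that \<open>L u\<close> is
almost surely the increment over \<open>[0,u]\<close>.\<close>

lemma expectation_indep_increment:
  fixes f g :: "'a \<Rightarrow> real"
  assumes fm [measurable]: "f \<in> borel_measurable borel" and gm [measurable]: "g \<in> borel_measurable borel"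
    and bdd: "\<And>z. \<bar>f z\<bar> \<le> C" "\<And>z. \<bar>g z\<bar> \<le> D" and u: "0 \<le> u" "0 < h"
  shows "expectation (\<lambda>\<omega>. f (L u \<omega>) * g (L (u + h) \<omega> - L u \<omega>)) =
    expectation (\<lambda>\<omega>. f (L u \<omega>)) * expectation (\<lambda>\<omega>. g (L h \<omega>))"
proof -
  have m: "L (u + h) \<in> borel_measurable M" "L u \<in> borel_measurable M" "L 0 \<in> borel_measurable M"
    using u by (auto intro: measurable_L)
  note [measurable] = m
  define Y where "Y k = (if k = (0::nat) then f else g)" for k
  have Ym: "Y k \<in> borel_measurable borel" for k by (simp add: Y_def fm gm)
  have eg: "expectation (\<lambda>\<omega>. g (L (u + h) \<omega> - L u \<omega>)) = expectation (\<lambda>\<omega>. g (L h \<omega>))"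
    using u by (intro expectation_increment) auto
  show ?thesis
  proof (cases "u = 0")
    case True
    have "expectation (\<lambda>\<omega>. f (L u \<omega>) * g (L (u + h) \<omega> - L u \<omega>)) =
        expectation (\<lambda>\<omega>. f 0 * g (L (u + h) \<omega> - L u \<omega>))"
    proof (rule integral_cong_AE)
      show "AE \<omega> in M. f (L u \<omega>) * g (L (u + h) \<omega> - L u \<omega>) = f 0 * g (L (u + h) \<omega> - L u \<omega>)"
        using AE_L_0 by eventually_elim (simp add: True)
    qed measurable
    also have "\<dots> = f 0 * expectation (\<lambda>\<omega>. g (L h \<omega>))" using eg by simp
    also have "f 0 = expectation (\<lambda>\<omega>. f 0)" using prob_space by simp
    also have "\<dots> = expectation (\<lambda>\<omega>. f (L u \<omega>))"
    proof (rule integral_cong_AE)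
      show "AE \<omega> in M. f 0 = f (L u \<omega>)"
        using AE_L_0 by eventually_elim (simp add: True)
    qed measurable
    finally show ?thesis .
  next
    case False
    define t where "t k = (if k = (0::nat) then 0 else if k = 1 then u else u + h)" for k
    have "indep_vars (\<lambda>_. borel) (\<lambda>k \<omega>. L (t (Suc k)) \<omega> - L (t k) \<omega>) {..<2}"
      using u False by (intro indep_increments) (auto simp: t_def)
    hence ind: "indep_vars (\<lambda>_. borel) (\<lambda>k \<omega>. Y k (L (t (Suc k)) \<omega> - L (t k) \<omega>)) {..<2}"
      by (rule indep_vars_compose2) (rule Ym)
    have int: "integrable M (\<lambda>\<omega>. Y k (L (t (Suc k)) \<omega> - L (t k) \<omega>))" for k
    proof (rule integrable_const_bound[where B = "max C D"])
      show "AE \<omega> in M. norm (Y k (L (t (Suc k)) \<omega> - L (t k) \<omega>)) \<le> max C D"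
        using bdd by (intro AE_I2) (auto simp: Y_def le_max_iff_disj)
      have "(\<lambda>\<omega>. L (t (Suc k)) \<omega> - L (t k) \<omega>) \<in> borel_measurable M"
        using u by (intro borel_measurable_diff measurable_L) (auto simp: t_def)
      thus "(\<lambda>\<omega>. Y k (L (t (Suc k)) \<omega> - L (t k) \<omega>)) \<in> borel_measurable M"
        using Ym by (rule measurable_compose)
    qed
    have "expectation (\<lambda>\<omega>. \<Prod>k<2. Y k (L (t (Suc k)) \<omega> - L (t k) \<omega>)) =
      (\<Prod>k<2. expectation (\<lambda>\<omega>. Y k (L (t (Suc k)) \<omega> - L (t k) \<omega>)))"
      by (rule indep_vars_lebesgue_integral[OF _ ind int]) simp
    hence "expectation (\<lambda>\<omega>. f (L u \<omega> - L 0 \<omega>) * g (L (u + h) \<omega> - L u \<omega>)) =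
        expectation (\<lambda>\<omega>. f (L u \<omega> - L 0 \<omega>)) * expectation (\<lambda>\<omega>. g (L (u + h) \<omega> - L u \<omega>))"
      by (simp add: numeral_2_eq_2 Y_def t_def)
    moreover have "expectation (\<lambda>\<omega>. f (L u \<omega> - L 0 \<omega>) * g (L (u + h) \<omega> - L u \<omega>)) =
        expectation (\<lambda>\<omega>. f (L u \<omega>) * g (L (u + h) \<omega> - L u \<omega>))"
      using AE_L_0 by (intro integral_cong_AE) (auto elim: AE_mp)
    moreover have "expectation (\<lambda>\<omega>. f (L u \<omega> - L 0 \<omega>)) = expectation (\<lambda>\<omega>. f (L u \<omega>))"
      using AE_L_0 by (intro integral_cong_AE) (auto elim: AE_mp)
    ultimately show ?thesis using eg by simp
  qed
qed

text \<open>The mesh sums converge on every path to the sum over jumps, whose mean is the integral against the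
Levy measure. Means converge as well because independence bounds the second moment of a sum of
\<open>N\<close> terms by \<open>(N p)^2 + C N p\<close>, where \<open>p\<close> is the mean of one term.\<close>

lemma mesh_expectation_tendsto:
  fixes g :: "'a \<Rightarrow> real"
  assumes \<nu>: "is_levy_measure M L \<nu>" and r: "0 < r"
    and g: "continuous_on UNIV g" "\<And>z. norm z \<le> r \<Longrightarrow> g z = 0" "\<And>z. 0 \<le> g z" "\<And>z. g z \<le> C"
    and h: "\<And>n. 0 < h n" "h \<longlonglongrightarrow> 0"
    and B: "\<And>n. real (mesh_count (h n)) * expectation (\<lambda>\<omega>. g (L (h n) \<omega>)) \<le> B"
  shows "integrable \<nu> g"
    and "(\<lambda>n. real (mesh_count (h n)) * expectation (\<lambda>\<omega>. g (L (h n) \<omega>))) \<longlonglongrightarrow> integral\<^sup>L \<nu> g"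
proof -
  have gm [measurable]: "g \<in> borel_measurable borel" using g(1) by (rule borel_measurable_continuous_onI)
  define p where "p n = expectation (\<lambda>\<omega>. g (L (h n) \<omega>))" for n
  define N where "N n = mesh_count (h n)" for n
  define X where "X n k \<omega> = g (L (real (Suc k) * h n) \<omega> - L (real k * h n) \<omega>)" for n k \<omega>
  define Z where "Z n \<omega> = (\<Sum>k<N n. X n k \<omega>)" for n \<omega>
  define Y where "Y \<omega> = enn2real (jump_integral (path \<omega>) g)" for \<omega>
  have h0: "0 \<le> real k * h n" for k n using h(1)[of n] by simp
  have [measurable]: "(\<lambda>\<omega>. L (real k * h n) \<omega>) \<in> borel_measurable M" for k n
    using h0 by (intro measurable_L)
  have [measurable]: "X n k \<in> borel_measurable M" for n k unfolding X_def by measurable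
  have X: "0 \<le> X n k \<omega>" "X n k \<omega> \<le> C" for n k \<omega> using g by (auto simp: X_def)
  have C0: "0 \<le> C" using X[of 0 0 undefined] by linarith
  have Xint: "integrable M (X n k)" "integrable M (\<lambda>\<omega>. X n j \<omega> * X n k \<omega>)" for n j k
  proof -
    show "integrable M (X n k)"
      by (rule integrable_const_bound[where B = C]) (use X in auto)
    show "integrable M (\<lambda>\<omega>. X n j \<omega> * X n k \<omega>)"
      by (rule integrable_const_bound[where B = "C * C"]) (use X C0 in \<open>auto intro!: mult_mono simp: abs_mult\<close>)
  qed
  have EX: "expectation (X n k) = p n" for n k
  proof -
    have "real (Suc k) * h n = real k * h n + h n" by (simp add: algebra_simps)
    thus ?thesis unfolding X_def p_def
      using expectation_increment[OF gm h0[of k n], of "h n"] h(1)[of n] by simp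
  qed
  have p0: "0 \<le> p n" for n unfolding p_def using g by (intro Bochner_Integration.integral_nonneg) auto
  have EXX: "expectation (\<lambda>\<omega>. X n j \<omega> * X n k \<omega>) \<le> p n * p n + (if j = k then C * p n else 0)"
    if jk: "j < N n" "k < N n" for n j k
  proof (cases "j = k")
    case True
    have "expectation (\<lambda>\<omega>. X n k \<omega> * X n k \<omega>) \<le> expectation (\<lambda>\<omega>. C * X n k \<omega>)"
      using X Xint by (intro integral_mono mult_right_mono) auto
    also have "\<dots> = C * p n" using EX by simp
    finally show ?thesis using True p0[of n] by (simp add: add_increasing)
  next
    case False
    have "indep_vars (\<lambda>_. borel) (\<lambda>k \<omega>. L (real (Suc k) * h n) \<omega> - L (real k * h n) \<omega>) {..<N n}"
      using h(1)[of n] by (intro indep_increments[where t = "\<lambda>k. real k * h n"]) auto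
    hence "indep_vars (\<lambda>_. borel) (X n) {..<N n}"
      unfolding X_def by (rule indep_vars_compose2) (rule gm)
    hence "indep_vars (\<lambda>_. borel) (X n) {j, k}"
      by (rule indep_vars_subset) (use jk in auto)
    hence "expectation (\<lambda>\<omega>. \<Prod>i\<in>{j, k}. X n i \<omega>) = (\<Prod>i\<in>{j, k}. expectation (X n i))"
      by (intro indep_vars_lebesgue_integral Xint) auto
    thus ?thesis using False EX by simp
  qed
  have Z2: "(Z n \<omega>)\<^sup>2 = (\<Sum>j<N n. \<Sum>k<N n. X n j \<omega> * X n k \<omega>)" for n \<omega>
    by (simp add: Z_def power2_eq_square sum_product)
  have Z2int: "integrable M (\<lambda>\<omega>. (Z n \<omega>)\<^sup>2)" for n
    unfolding Z2 by (intro Bochner_Integration.integrable_sum Xint)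
  have NpB: "0 \<le> real (N n) * p n" "real (N n) * p n \<le> B" for n
    using B[of n] p0[of n] by (auto simp: N_def p_def)
  have EZ2: "expectation (\<lambda>\<omega>. (Z n \<omega>)\<^sup>2) \<le> B * B + C * B" for n
  proof -
    have "expectation (\<lambda>\<omega>. (Z n \<omega>)\<^sup>2) = (\<Sum>j<N n. \<Sum>k<N n. expectation (\<lambda>\<omega>. X n j \<omega> * X n k \<omega>))"
      unfolding Z2 by (simp add: Xint)
    also have "\<dots> \<le> (\<Sum>j<N n. \<Sum>k<N n. p n * p n + (if j = k then C * p n else 0))"
      by (intro sum_mono EXX) auto
    also have "\<dots> = (real (N n) * p n) * (real (N n) * p n) + C * (real (N n) * p n)"
      by (simp add: sum.distrib algebra_simps)
    also have "\<dots> \<le> B * B + C * B"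
      using NpB[of n] C0 by (intro add_mono mult_mono) auto
    finally show ?thesis .
  qed
  have lim: "(\<lambda>n. Z n \<omega>) \<longlonglongrightarrow> Y \<omega>" if "\<omega> \<in> space M" for \<omega>
    unfolding Z_def X_def Y_def N_def
    by (rule mesh_sum_tendsto_jump_integral(1)[OF cadlag_path[OF that] r g(1,2,3) h])
  have EZ: "expectation (Z n) = real (N n) * p n" for n
    unfolding Z_def using Xint EX by simp
  have Zm: "Z n \<in> borel_measurable M" for n unfolding Z_def by measurable
  have Z0: "0 \<le> Z n \<omega>" for n \<omega> unfolding Z_def by (intro sum_nonneg X)
  have Yint: "integrable M Y" and EY: "(\<lambda>n. expectation (Z n)) \<longlonglongrightarrow> expectation Y"
    using expectation_tendsto_of_bounded_second_moment[OF Zm Z0 lim Z2int EZ2] by simp_all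
  have "(\<integral>\<^sup>+ z. ennreal (g z) \<partial>\<nu>) = (\<integral>\<^sup>+ \<omega>. jump_integral (path \<omega>) g \<partial>M)"
    using r g(2)[of 0] by (intro nn_integral_levy_measure(1)[OF \<nu>]) auto
  also have "\<dots> = (\<integral>\<^sup>+ \<omega>. ennreal (Y \<omega>) \<partial>M)"
  proof (rule nn_integral_cong)
    fix \<omega> assume "\<omega> \<in> space M"
    hence "jump_integral (path \<omega>) g < top"
      using mesh_sum_tendsto_jump_integral(2)[OF cadlag_path r g(1,2,3) h] by simp
    thus "jump_integral (path \<omega>) g = ennreal (Y \<omega>)" unfolding Y_def by simp
  qed
  also have "\<dots> = ennreal (expectation Y)"
    by (rule nn_integral_eq_integral[OF Yint]) (simp add: Y_def)
  finally have nn: "(\<integral>\<^sup>+ z. ennreal (g z) \<partial>\<nu>) = ennreal (expectation Y)" .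
  have EY0: "0 \<le> expectation Y" by (intro Bochner_Integration.integral_nonneg) (simp add: Y_def)
  have sets: "sets \<nu> = sets borel" using \<nu> by (simp add: is_levy_measure_def)
  have "has_bochner_integral \<nu> g (expectation Y)"
    using nn g(3) EY0 gm
    by (intro has_bochner_integral_nn_integral) (auto simp: measurable_cong_sets[OF sets refl])
  thus "integrable \<nu> g"
    "(\<lambda>n. real (mesh_count (h n)) * expectation (\<lambda>\<omega>. g (L (h n) \<omega>))) \<longlonglongrightarrow> integral\<^sup>L \<nu> g"
    using EY unfolding EZ N_def p_def by (auto simp: has_bochner_integral_iff)
qed

end

section \<open>Levy processes in the orthant at small times\<close>

lemma closed_orthant: "closed (orthant :: (real ^ 'd::finite) set)"
proof -
  have "orthant = (\<Inter>j. {z :: real ^ 'd. 0 \<le> z $ j})" by (auto simp: orthant_def)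
  moreover have "closed (\<Inter>j. {z :: real ^ 'd. 0 \<le> z $ j})"
    by (intro closed_INT ballI closed_Collect_le continuous_intros)
  ultimately show ?thesis by simp
qed

lemma orthant_borel [measurable]: "orthant \<in> sets borel"
  using closed_orthant by (rule borel_closed)

lemma scaleR_orthant: "z \<in> orthant \<Longrightarrow> 0 \<le> a \<Longrightarrow> a *\<^sub>R z \<in> orthant"
  by (simp add: orthant_def)

lemma min_one_le_exp:
  assumes "0 \<le> (x::real)" shows "min 1 x \<le> 2 * (1 - exp (- x))"
proof -
  have "1 + x \<le> exp x" by (rule exp_ge_add_one_self)
  hence "exp (- x) \<le> 1 / (1 + x)" using assms by (simp add: exp_minus field_simps)
  moreover have "min 1 x \<le> 2 * (1 - 1 / (1 + x))"
  proof (cases "1 \<le> x")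
    case False
    hence "x * x \<le> 1 * x" using assms by (intro mult_right_mono) auto
    thus ?thesis using assms False by (simp add: field_simps)
  qed (simp add: field_simps)
  ultimately show ?thesis by simp
qed

locale orthant_levy = levy M L for M :: "'w measure" and L :: "real \<Rightarrow> 'w \<Rightarrow> real ^ 'd::finite" +
  assumes L_orthant: "0 \<le> t \<Longrightarrow> \<omega> \<in> space M \<Longrightarrow> L t \<omega> \<in> orthant"
begin

lemma AE_increment_orthant:
  assumes "0 \<le> u" "0 \<le> h"
  shows "AE \<omega> in M. L (u + h) \<omega> - L u \<omega> \<in> orthant"
proof -
  have m: "L (u + h) \<in> borel_measurable M" "L u \<in> borel_measurable M" "L h \<in> borel_measurable M"
    using assms by (auto intro: measurable_L)
  note [measurable] = m
  have "AE z in distr M borel (L h). z \<in> orthant"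
    using L_orthant[OF assms(2)] by (subst AE_distr_iff) auto
  hence "AE z in distr M borel (\<lambda>\<omega>. L (u + h) \<omega> - L u \<omega>). z \<in> orthant"
    by (simp only: distr_increment[OF assms])
  thus ?thesis by (subst (asm) AE_distr_iff) auto
qed

text \<open>The Laplace transform of \<open>coord_sum (L u)\<close> at \<open>1 / c\<close>. It is multiplicative in \<open>u\<close>, so its
logarithm controls sums of small increments uniformly in the mesh.\<close>

definition laplace :: "real \<Rightarrow> real \<Rightarrow> real" where
  "laplace c u = expectation (\<lambda>\<omega>. exp (- (coord_sum (L u \<omega>) / c)))"

lemma integrable_laplace:
  assumes "0 < c" "0 \<le> u"
  shows "integrable M (\<lambda>\<omega>. exp (- (coord_sum (L u \<omega>) / c)))"
proof (rule integrable_const_bound[where B = 1])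
  show "AE \<omega> in M. norm (exp (- (coord_sum (L u \<omega>) / c))) \<le> 1"
    using coord_sum_nonneg[OF L_orthant[OF assms(2)]] assms by (intro AE_I2) simp
  have [measurable]: "L u \<in> borel_measurable M" using assms by (intro measurable_L)
  show "(\<lambda>\<omega>. exp (- (coord_sum (L u \<omega>) / c))) \<in> borel_measurable M" by measurable
qed

lemma laplace_add:
  assumes c: "0 < c" and u: "0 \<le> u" "0 < h"
  shows "laplace c (u + h) = laplace c u * laplace c h"
proof -
  \<comment> \<open>increments are nonnegative only almost surely, so a globally bounded version is used\<close>
  define f where "f z = exp (- (max 0 (coord_sum z) / c))" for z :: "real ^ 'd"
  have m: "L (u + h) \<in> borel_measurable M" "L u \<in> borel_measurable M"
    using u by (auto intro: measurable_L)
  note [measurable] = m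
  have fm [measurable]: "f \<in> borel_measurable borel" unfolding f_def by measurable
  have fb: "\<bar>f z\<bar> \<le> 1" for z using c by (simp add: f_def)
  have f_pos: "f z = exp (- (coord_sum z / c))" if "z \<in> orthant" for z
    using coord_sum_nonneg[OF that] by (simp add: f_def)
  have e: "laplace c v = expectation (\<lambda>\<omega>. f (L v \<omega>))" if "0 \<le> v" for v
    unfolding laplace_def using L_orthant[OF that] f_pos
    by (intro Bochner_Integration.integral_cong) auto
  have "laplace c (u + h) = expectation (\<lambda>\<omega>. f (L u \<omega>) * f (L (u + h) \<omega> - L u \<omega>))"
    unfolding laplace_def
  proof (rule integral_cong_AE)
    have "AE \<omega> in M. \<omega> \<in> space M" by simp
    thus "AE \<omega> in M. exp (- (coord_sum (L (u + h) \<omega>) / c)) = f (L u \<omega>) * f (L (u + h) \<omega> - L u \<omega>)"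
      using AE_increment_orthant[OF u(1), of h, OF less_imp_le[OF u(2)]]
    proof eventually_elim
      case (elim \<omega>)
      have "coord_sum (L (u + h) \<omega>) = coord_sum (L u \<omega>) + coord_sum (L (u + h) \<omega> - L u \<omega>)"
        by (simp flip: coord_sum_add)
      thus ?case using elim f_pos L_orthant[OF u(1)]
        by (simp add: add_divide_distrib flip: exp_add)
    qed
  qed measurable
  also have "\<dots> = laplace c u * laplace c h"
    using expectation_indep_increment[OF fm fm fb fb u] e[OF u(1)] e[of h] u by simp
  finally show ?thesis .
qed

lemma laplace_pos:
  assumes "0 < c" "0 \<le> u" shows "0 < laplace c u"
proof -
  have "0 \<le> laplace c u" unfolding laplace_def by (intro Bochner_Integration.integral_nonneg) simp
  moreover have "laplace c u \<noteq> 0"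
  proof
    assume "laplace c u = 0"
    hence "AE \<omega> in M. exp (- (coord_sum (L u \<omega>) / c)) = 0"
      unfolding laplace_def using integral_nonneg_eq_0_iff_AE[OF integrable_laplace[OF assms]] by simp
    hence "AE \<omega> in M. False" by simp
    thus False by simp
  qed
  ultimately show ?thesis by simp
qed

lemma laplace_mult:
  assumes "0 < c" "0 < h"
  shows "laplace c (real (Suc n) * h) = laplace c h ^ Suc n"
proof (induction n)
  case (Suc n)
  have "real (Suc (Suc n)) * h = real (Suc n) * h + h" by (simp add: algebra_simps)
  thus ?case using laplace_add[OF assms(1), of "real (Suc n) * h" h] Suc assms by simp
qed simp

text \<open>A bound for the mean total truncated size of the increments over any equidistant mesh of
\<open>[0,s]\<close>, measured on the scale \<open>c\<close>. The factor \<open>2\<close> comes from \<open>min 1 x \<le> 2 * (1 - exp (- x))\<close>.\<close>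

definition smallness :: "real \<Rightarrow> real \<Rightarrow> real" where
  "smallness s c = - 2 * ln (laplace c s)"

text \<open>With \<open>\<phi> = laplace c\<close> and \<open>h = s / n\<close> one has
\<open>n * (1 - \<phi> h) \<le> - n * ln (\<phi> h) = - ln (\<phi> s)\<close>, which does not depend on \<open>n\<close>.\<close>

lemma mesh_truncated_mean_le:
  assumes c: "0 < c" and s: "0 < s"
  shows "real (Suc n) * expectation (\<lambda>\<omega>. min 1 (coord_sum (L (s / real (Suc n)) \<omega>) / c)) \<le> smallness s c"
proof -
  define h where "h = s / real (Suc n)"
  have h: "0 < h" "0 \<le> h" using s by (auto simp: h_def)
  have [measurable]: "L h \<in> borel_measurable M" using h by (intro measurable_L)
  have pos: "0 \<le> coord_sum (L h \<omega>) / c" if "\<omega> \<in> space M" for \<omega>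
    using coord_sum_nonneg[OF L_orthant[OF h(2) that]] c by simp
  have "expectation (\<lambda>\<omega>. min 1 (coord_sum (L h \<omega>) / c)) \<le>
      expectation (\<lambda>\<omega>. 2 * (1 - exp (- (coord_sum (L h \<omega>) / c))))"
  proof (rule integral_mono)
    show "integrable M (\<lambda>\<omega>. min 1 (coord_sum (L h \<omega>) / c))"
      by (rule integrable_const_bound[where B = 1]) (use pos in \<open>auto simp: min_def\<close>)
    show "integrable M (\<lambda>\<omega>. 2 * (1 - exp (- (coord_sum (L h \<omega>) / c))))"
      using integrable_laplace[OF c h(2)] by simp
    show "min 1 (coord_sum (L h \<omega>) / c) \<le> 2 * (1 - exp (- (coord_sum (L h \<omega>) / c)))"
      if "\<omega> \<in> space M" for \<omega> using pos[OF that] by (rule min_one_le_exp)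
  qed
  also have "\<dots> = 2 * (1 - laplace c h)"
    using integrable_laplace[OF c h(2)] prob_space by (simp add: laplace_def)
  also have "\<dots> \<le> 2 * (- ln (laplace c h))"
    using ln_le_minus_one[OF laplace_pos[OF c h(2)]] by simp
  finally have "real (Suc n) * expectation (\<lambda>\<omega>. min 1 (coord_sum (L h \<omega>) / c)) \<le>
      real (Suc n) * (2 * (- ln (laplace c h)))" by (intro mult_left_mono) auto
  also have "\<dots> = - 2 * ln (laplace c h ^ Suc n)"
    using laplace_pos[OF c h(2)] by (subst ln_realpow) auto
  also have "laplace c h ^ Suc n = laplace c s"
    using laplace_mult[OF c h(1), of n] by (simp add: h_def)
  finally show ?thesis by (simp add: h_def smallness_def)
qed

lemma smallness_nonneg:
  assumes "0 < c" "0 < s" shows "0 \<le> smallness s c"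
proof -
  have "0 \<le> expectation (\<lambda>\<omega>. min 1 (coord_sum (L (s / real (Suc 0)) \<omega>) / c))"
    using coord_sum_nonneg[OF L_orthant] assms by (intro Bochner_Integration.integral_nonneg) auto
  thus ?thesis using mesh_truncated_mean_le[OF assms, of 0] by simp
qed

lemma smallness_tendsto_0:
  assumes s: "0 < s" shows "(smallness s \<longlongrightarrow> 0) at_top"
proof -
  have [measurable]: "L s \<in> borel_measurable M" using s by (intro measurable_L) simp
  have "((\<lambda>c. laplace c s) \<longlongrightarrow> expectation (\<lambda>\<omega>. exp (- 0))) at_top"
    unfolding laplace_def
  proof (rule integral_dominated_convergence_at_top[where w = "\<lambda>_. 1"])
    show "AE \<omega> in M. ((\<lambda>c. exp (- (coord_sum (L s \<omega>) / c))) \<longlongrightarrow> exp (- 0)) at_top"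
      by (intro AE_I2 tendsto_intros tendsto_divide_0[OF tendsto_const] filterlim_at_top_imp_at_infinity filterlim_ident)
    show "\<forall>\<^sub>F c in at_top. AE \<omega> in M. norm (exp (- (coord_sum (L s \<omega>) / c))) \<le> 1"
      using eventually_gt_at_top[of 0]
    proof eventually_elim
      case (elim c)
      show ?case using coord_sum_nonneg[OF L_orthant[OF less_imp_le[OF s]]] elim
        by (intro AE_I2) simp
    qed
  qed auto
  hence "((\<lambda>c. laplace c s) \<longlongrightarrow> 1) at_top" using prob_space by simp
  hence "((\<lambda>c. - 2 * ln (laplace c s)) \<longlongrightarrow> - 2 * ln 1) at_top"
    by (intro tendsto_intros) simp_all
  thus ?thesis unfolding smallness_def[abs_def] by simp
qed

text \<open>The Levy measure as the small-time limit of the rescaled laws. The truncated mean bound supplies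
the boundedness that the convergence of mesh expectations asks for. Since \<open>\<nu>\<close> counts jumps in
\<open>[0,1]\<close> while the mesh width is \<open>s / n\<close>, the factor \<open>s\<close> is the limit of \<open>n\<close> divided by the
number of mesh steps up to time \<open>1\<close>.\<close>

lemma small_time_limit_nonneg:
  fixes g :: "real ^ 'd \<Rightarrow> real"
  assumes \<nu>: "is_levy_measure M L \<nu>" and s: "0 < s" and r: "0 < r"
    and g: "continuous_on UNIV g" "\<And>z. norm z \<le> r \<Longrightarrow> g z = 0" "\<And>z. 0 \<le> g z" "\<And>z. g z \<le> C"
  shows "integrable \<nu> g"
    and "(\<lambda>n. real (Suc n) * expectation (\<lambda>\<omega>. g (L (s / real (Suc n)) \<omega>))) \<longlonglongrightarrow> s * integral\<^sup>L \<nu> g"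
proof -
  define h where "h n = s / real (Suc n)" for n
  have h: "\<And>n. 0 < h n" "h \<longlonglongrightarrow> 0"
    using s LIMSEQ_Suc[OF lim_const_over_n[of s]] by (auto simp: h_def[abs_def])
  have C0: "0 \<le> C" using order_trans[OF g(3) g(4)] .
  define p where "p n = expectation (\<lambda>\<omega>. g (L (h n) \<omega>))" for n
  have gm [measurable]: "g \<in> borel_measurable borel" using g(1) by (rule borel_measurable_continuous_onI)
  have p0: "0 \<le> p n" for n unfolding p_def using g by (intro Bochner_Integration.integral_nonneg) auto
  define D where "D = C * smallness s r"
  have pD: "real (Suc n) * p n \<le> D" for n
  proof -
    have h0: "0 \<le> h n" using h(1)[of n] by simp
    have [measurable]: "L (h n) \<in> borel_measurable M" using h0 by (intro measurable_L)
    have pos: "0 \<le> coord_sum (L (h n) \<omega>) / r" if "\<omega> \<in> space M" for \<omega>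
      using coord_sum_nonneg[OF L_orthant[OF h0 that]] r by simp
    have "p n \<le> expectation (\<lambda>\<omega>. C * min 1 (coord_sum (L (h n) \<omega>) / r))"
      unfolding p_def
    proof (rule integral_mono)
      show "integrable M (\<lambda>\<omega>. g (L (h n) \<omega>))"
        by (rule integrable_const_bound[where B = C]) (use g in auto)
      show "integrable M (\<lambda>\<omega>. C * min 1 (coord_sum (L (h n) \<omega>) / r))"
        by (intro integrable_mult_right integrable_const_bound[where B = 1]) (use pos in \<open>auto simp: min_def\<close>)
      fix \<omega> assume w: "\<omega> \<in> space M"
      show "g (L (h n) \<omega>) \<le> C * min 1 (coord_sum (L (h n) \<omega>) / r)"
      proof (cases "norm (L (h n) \<omega>) \<le> r")
        case True
        thus ?thesis using g(2) pos[OF w] C0 by simp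
      next
        case False
        hence "1 \<le> coord_sum (L (h n) \<omega>) / r"
          using norm_le_coord_sum[OF L_orthant[OF h0 w]] r by simp
        thus ?thesis using g(4) by simp
      qed
    qed
    hence "real (Suc n) * p n \<le> real (Suc n) * (C * expectation (\<lambda>\<omega>. min 1 (coord_sum (L (h n) \<omega>) / r)))"
      by (intro mult_left_mono) auto
    also have "\<dots> = C * (real (Suc n) * expectation (\<lambda>\<omega>. min 1 (coord_sum (L (h n) \<omega>) / r)))"
      by simp
    also have "\<dots> \<le> D" unfolding D_def h_def
      by (intro mult_left_mono mesh_truncated_mean_le r s C0)
    finally show ?thesis .
  qed
  have hs: "real (Suc n) = s / h n" for n using s by (simp add: h_def)
  have B: "real (mesh_count (h n)) * expectation (\<lambda>\<omega>. g (L (h n) \<omega>)) \<le> D / s + C" for n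
  proof -
    have h0: "0 \<le> h n" using h(1)[of n] by simp
    have [measurable]: "L (h n) \<in> borel_measurable M" using h0 by (intro measurable_L)
    have "p n \<le> expectation (\<lambda>\<omega>. C)" unfolding p_def
      by (intro integral_mono integrable_const_bound[where B = C]) (use g C0 in auto)
    hence "p n \<le> C" using prob_space by simp
    have "real (mesh_count (h n)) < 1 / h n + 1"
      using mesh_count_bounds(2)[OF h(1), of n] h(1)[of n] by (simp add: field_simps)
    hence "real (mesh_count (h n)) * p n \<le> (1 / h n + 1) * p n"
      using p0[of n] by (intro mult_right_mono) auto
    also have "\<dots> = real (Suc n) * p n / s + p n" unfolding hs using s by (simp add: algebra_simps)
    also have "\<dots> \<le> D / s + C" using pD[of n] s \<open>p n \<le> C\<close>
      by (intro add_mono divide_right_mono) auto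
    finally show ?thesis by (simp add: p_def)
  qed
  have I: "integrable \<nu> g"
    and lim: "(\<lambda>n. real (mesh_count (h n)) * p n) \<longlonglongrightarrow> integral\<^sup>L \<nu> g"
    using mesh_expectation_tendsto[OF \<nu> r g h B] by (simp_all add: p_def)
  show "integrable \<nu> g" by (rule I)
  have one: "(\<lambda>n. real (mesh_count (h n)) * h n) \<longlonglongrightarrow> 1"
  proof (rule tendsto_sandwich[OF _ _ tendsto_const])
    show "\<forall>\<^sub>F n in sequentially. 1 \<le> real (mesh_count (h n)) * h n"
      using mesh_count_bounds(1)[OF h(1)] by simp
    show "\<forall>\<^sub>F n in sequentially. real (mesh_count (h n)) * h n \<le> 1 + h n"
      using mesh_count_bounds(2)[OF h(1)] by (intro always_eventually allI less_imp_le)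
    show "(\<lambda>n. 1 + h n) \<longlonglongrightarrow> 1" using tendsto_add[OF tendsto_const h(2), of 1] by simp
  qed
  have "(\<lambda>n. s * (real (mesh_count (h n)) * p n) / (real (mesh_count (h n)) * h n)) \<longlonglongrightarrow> s * integral\<^sup>L \<nu> g / 1"
    by (intro tendsto_intros lim one) simp
  moreover have "s * (real (mesh_count (h n)) * p n) / (real (mesh_count (h n)) * h n) = real (Suc n) * p n" for n
  proof -
    have "0 < real (mesh_count (h n)) * h n" using mesh_count_bounds(1)[OF h(1), of n] by linarith
    hence "real (mesh_count (h n)) \<noteq> 0" by (metis mult_zero_left less_irrefl)
    thus ?thesis unfolding hs by simp
  qed
  ultimately show "(\<lambda>n. real (Suc n) * expectation (\<lambda>\<omega>. g (L (s / real (Suc n)) \<omega>))) \<longlonglongrightarrow> s * integral\<^sup>L \<nu> g"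
    by (simp add: p_def h_def)
qed

lemma small_time_limit:
  fixes g :: "real ^ 'd \<Rightarrow> real"
  assumes \<nu>: "is_levy_measure M L \<nu>" and s: "0 < s" and r: "0 < r"
    and g: "continuous_on UNIV g" "\<And>z. norm z \<le> r \<Longrightarrow> g z = 0" "\<And>z. \<bar>g z\<bar> \<le> C"
  shows "integrable \<nu> g"
    and "(\<lambda>n. real (Suc n) * expectation (\<lambda>\<omega>. g (L (s / real (Suc n)) \<omega>))) \<longlonglongrightarrow> s * integral\<^sup>L \<nu> g"
proof -
  define f1 where "f1 z = max 0 (g z)" for z
  define f2 where "f2 z = max 0 (- g z)" for z
  have C0: "0 \<le> C" using g(3)[of 0] by linarith
  have gd: "g z = f1 z - f2 z" for z by (simp add: f1_def f2_def)
  have f: "continuous_on UNIV f1" "continuous_on UNIV f2"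
    unfolding f1_def f2_def using g(1) by (intro continuous_intros; simp)+
  have b: "f1 z \<le> C" "f2 z \<le> C" for z using g(3)[of z] C0 by (auto simp: f1_def f2_def)
  have f0: "0 \<le> f1 z" "0 \<le> f2 z" for z by (auto simp: f1_def f2_def)
  note 1 = small_time_limit_nonneg[OF \<nu> s r f(1), where C = C]
  note 2 = small_time_limit_nonneg[OF \<nu> s r f(2), where C = C]
  have i: "integrable \<nu> f1" "integrable \<nu> f2"
    and l: "(\<lambda>n. real (Suc n) * expectation (\<lambda>\<omega>. f1 (L (s / real (Suc n)) \<omega>))) \<longlonglongrightarrow> s * integral\<^sup>L \<nu> f1"
      "(\<lambda>n. real (Suc n) * expectation (\<lambda>\<omega>. f2 (L (s / real (Suc n)) \<omega>))) \<longlonglongrightarrow> s * integral\<^sup>L \<nu> f2"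
    using 1 2 b g(2) by (auto simp: f1_def f2_def)
  show "integrable \<nu> g" unfolding gd using i by simp
  have "integrable M (\<lambda>\<omega>. f (L (s / real (Suc n)) \<omega>))"
    if "continuous_on UNIV f" "\<And>z. 0 \<le> f z" "\<And>z. f z \<le> C" for n and f :: "real ^ 'd \<Rightarrow> real"
  proof (rule integrable_const_bound[where B = C])
    show "(\<lambda>\<omega>. f (L (s / real (Suc n)) \<omega>)) \<in> borel_measurable M"
      using s borel_measurable_continuous_onI[OF that(1)]
      by (intro measurable_compose[OF measurable_L]) auto
  qed (use that in auto)
  hence "integrable M (\<lambda>\<omega>. f1 (L (s / real (Suc n)) \<omega>))" "integrable M (\<lambda>\<omega>. f2 (L (s / real (Suc n)) \<omega>))" for n
    using f b f0 by blast+
  hence "real (Suc n) * expectation (\<lambda>\<omega>. g (L (s / real (Suc n)) \<omega>)) =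
    real (Suc n) * expectation (\<lambda>\<omega>. f1 (L (s / real (Suc n)) \<omega>)) -
    real (Suc n) * expectation (\<lambda>\<omega>. f2 (L (s / real (Suc n)) \<omega>))" for n
    unfolding gd by (simp add: right_diff_distrib)
  moreover have "s * integral\<^sup>L \<nu> g = s * integral\<^sup>L \<nu> f1 - s * integral\<^sup>L \<nu> f2"
    unfolding gd using i by (simp add: right_diff_distrib)
  ultimately show "(\<lambda>n. real (Suc n) * expectation (\<lambda>\<omega>. g (L (s / real (Suc n)) \<omega>))) \<longlonglongrightarrow> s * integral\<^sup>L \<nu> g"
    using tendsto_diff[OF l] by simp
qed

text \<open>The values of the process have no negative coordinates, and away from zero \<open>\<nu>\<close> is the limit
of their rescaled laws at small times.\<close>

lemma levy_measure_AE_orthant: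
  assumes \<nu>: "is_levy_measure M L \<nu>"
  shows "AE z in \<nu>. z \<in> orthant"
proof -
  have sets: "sets \<nu> = sets borel" using \<nu> by (simp add: is_levy_measure_def)
  have "AE z in \<nu>. - (1 / real (Suc m)) \<le> z $ j" for j m
  proof -
    define r where "r = 1 / real (Suc m)"
    have r: "0 < r" by (simp add: r_def)
    define g where "g z = min 1 (max 0 (- (z $ j) - r))" for z :: "real ^ 'd"
    have c: "continuous_on UNIV g" unfolding g_def by (intro continuous_intros)
    have z: "g z = 0" if "norm z \<le> r" for z
      using component_le_norm_cart[of z j] that by (simp add: g_def)
    have b: "0 \<le> g z" "g z \<le> 1" for z by (auto simp: g_def)
    note lim = small_time_limit_nonneg[OF \<nu> zero_less_one r c z b]
    have "expectation (\<lambda>\<omega>. g (L (1 / real (Suc n)) \<omega>)) = 0" for n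
    proof -
      have "expectation (\<lambda>\<omega>. g (L (1 / real (Suc n)) \<omega>)) = expectation (\<lambda>\<omega>. 0)"
      proof (rule Bochner_Integration.integral_cong)
        fix \<omega> assume "\<omega> \<in> space M"
        hence "0 \<le> L (1 / real (Suc n)) \<omega> $ j" using L_orthant[of "1 / real (Suc n)"] by (auto simp: orthant_def)
        thus "g (L (1 / real (Suc n)) \<omega>) = 0" using r by (simp add: g_def)
      qed simp
      thus ?thesis by simp
    qed
    hence "(\<lambda>n::nat. 0 :: real) \<longlonglongrightarrow> 1 * integral\<^sup>L \<nu> g" using lim(2) by simp
    hence "integral\<^sup>L \<nu> g = 0" using LIMSEQ_unique[OF tendsto_const] by fastforce
    hence "AE z in \<nu>. g z = 0" using integral_nonneg_eq_0_iff_AE[OF lim(1)] b by simp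
    thus ?thesis by (auto simp: g_def r_def elim!: AE_mp split: if_splits)
  qed
  hence "AE z in \<nu>. \<forall>j m. - (1 / real (Suc m)) \<le> z $ j"
    by (simp add: AE_all_countable AE_finite_all)
  thus ?thesis
  proof eventually_elim
    case (elim z)
    have "0 \<le> z $ j" for j
    proof (rule ccontr)
      assume "\<not> 0 \<le> z $ j"
      then obtain m where "1 / real (Suc m) < - (z $ j)" by (metis nat_approx_posE neg_0_less_iff_less not_le)
      thus False using elim[rule_format, of m j] by simp
    qed
    thus ?case by (simp add: orthant_def)
  qed
qed

end

section \<open>Comparison with the Levy measure\<close>

definition upper :: "nat \<Rightarrow> real \<Rightarrow> (real ^ 'd::finite) set" where
  "upper m y = {z. y \<le> order_stat z m}"

lemma upper_borel [measurable]:
  assumes "1 \<le> m" "m \<le> CARD('d::finite)"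
  shows "(upper m y :: (real ^ 'd) set) \<in> sets borel"
  unfolding upper_def using borel_measurable_order_stat[OF assms] by measurable

lemma upper_scaleR:
  assumes "1 \<le> m" "m \<le> CARD('d::finite)" "0 < c"
  shows "(1 / c) *\<^sub>R z \<in> (upper m y :: (real ^ 'd) set) \<longleftrightarrow> z \<in> upper m (y * c)"
proof -
  have "order_stat z m = c * order_stat ((1 / c) *\<^sub>R z) m"
    using order_stat_scaleR[OF assms, of "(1 / c) *\<^sub>R z"] assms by simp
  thus ?thesis using assms by (simp add: upper_def mult.commute[of y])
qed

text \<open>A Lipschitz function between the indicators of \<open>upper m y\<close> and \<open>upper m (y / 2)\<close>. It transfers
tail probabilities through limits that are available for continuous functions only.\<close>

definition ramp :: "nat \<Rightarrow> real \<Rightarrow> real ^ 'd::finite \<Rightarrow> real" where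
  "ramp m y z = max 0 (min 1 (2 * order_stat z m / y - 1))"

lemma ramp_bounds: "0 \<le> ramp m y z" "ramp m y z \<le> 1"
  by (auto simp: ramp_def)

lemma indicator_le_ramp: "0 < y \<Longrightarrow> indicator (upper m y) z \<le> ramp m y z"
  by (auto simp: ramp_def upper_def indicator_def field_simps)

lemma ramp_le_indicator: "0 < y \<Longrightarrow> ramp m y z \<le> indicator (upper m (y / 2)) z"
  by (auto simp: ramp_def upper_def indicator_def field_simps)

lemma ramp_eq_0: "0 < y \<Longrightarrow> order_stat z m < y / 2 \<Longrightarrow> ramp m y z = 0"
  by (auto simp: ramp_def field_simps)

lemma ramp_lipschitz:
  fixes z w :: "real ^ 'd::finite"
  assumes "1 \<le> m" "m \<le> CARD('d)" "0 < y"
  shows "\<bar>ramp m y z - ramp m y w\<bar> \<le> 2 / y * norm (z - w)"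
proof -
  have "\<bar>ramp m y z - ramp m y w\<bar> \<le> \<bar>2 * order_stat z m / y - 2 * order_stat w m / y\<bar>"
    by (auto simp: ramp_def max_def min_def)
  also have "\<dots> = 2 / y * \<bar>order_stat z m - order_stat w m\<bar>"
  proof -
    have e: "2 * order_stat z m / y - 2 * order_stat w m / y = 2 / y * (order_stat z m - order_stat w m)"
      by (simp add: algebra_simps)
    show ?thesis unfolding e abs_mult using assms by simp
  qed
  also have "\<dots> \<le> 2 / y * norm (z - w)"
    using assms order_stat_lipschitz[OF assms(1,2)] by (intro mult_left_mono) auto
  finally show ?thesis .
qed

lemma continuous_on_of_lipschitz_bound:
  fixes f :: "real ^ 'd::finite \<Rightarrow> real"
  assumes "\<And>z w. \<bar>f z - f w\<bar> \<le> K * norm (z - w)"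
  shows "continuous_on A f"
proof (rule lipschitz_on_continuous_on)
  show "K-lipschitz_on A f"
    using assms lipschitz_bound_nonneg[OF assms] by (intro lipschitz_onI) (auto simp: dist_norm)
qed

lemma ramp_continuous:
  assumes "1 \<le> m" "m \<le> CARD('d::finite)" "0 < y"
  shows "continuous_on A (ramp m y :: real ^ 'd \<Rightarrow> real)"
  using ramp_lipschitz[OF assms] by (rule continuous_on_of_lipschitz_bound)

context orthant_levy
begin

definition exceed :: "real \<Rightarrow> nat \<Rightarrow> real \<Rightarrow> real" where
  "exceed u m y = expectation (\<lambda>\<omega>. indicator (upper m y) (L u \<omega>))"

lemma exceed_nonneg: "0 \<le> exceed u m y"
  unfolding exceed_def by (intro Bochner_Integration.integral_nonneg) auto

lemma integrable_bounded_L: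
  fixes f :: "real ^ 'd \<Rightarrow> real"
  assumes "f \<in> borel_measurable borel" "\<And>z. \<bar>f z\<bar> \<le> C" "0 \<le> u"
  shows "integrable M (\<lambda>\<omega>. f (L u \<omega>))"
proof (rule integrable_const_bound[where B = C])
  show "(\<lambda>\<omega>. f (L u \<omega>)) \<in> borel_measurable M"
    using measurable_L[OF assms(3)] assms(1) by (rule measurable_compose)
qed (use assms in auto)

lemma integrable_bounded_L_increment:
  fixes f g :: "real ^ 'd \<Rightarrow> real"
  assumes "f \<in> borel_measurable borel" "\<And>z. \<bar>f z\<bar> \<le> C" "g \<in> borel_measurable borel" "\<And>z. \<bar>g z\<bar> \<le> D"
    and "0 \<le> u" "0 \<le> h"
  shows "integrable M (\<lambda>\<omega>. f (L u \<omega>) * g (L (u + h) \<omega> - L u \<omega>))"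
proof (rule integrable_const_bound[where B = "C * D"])
  have "(\<lambda>\<omega>. f (L u \<omega>)) \<in> borel_measurable M"
    using measurable_L[OF assms(5)] assms(1) by (rule measurable_compose)
  moreover have "(\<lambda>\<omega>. L (u + h) \<omega> - L u \<omega>) \<in> borel_measurable M"
    using assms by (intro borel_measurable_diff measurable_L) auto
  hence "(\<lambda>\<omega>. g (L (u + h) \<omega> - L u \<omega>)) \<in> borel_measurable M"
    using assms(3) by (rule measurable_compose)
  ultimately show "(\<lambda>\<omega>. f (L u \<omega>) * g (L (u + h) \<omega> - L u \<omega>)) \<in> borel_measurable M"
    by (rule borel_measurable_times)
  have "0 \<le> C" using assms(2)[of 0] by linarith
  thus "AE \<omega> in M. norm (f (L u \<omega>) * g (L (u + h) \<omega> - L u \<omega>)) \<le> C * D"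
    using assms(2,4) by (intro AE_I2) (auto simp: abs_mult intro!: mult_mono)
qed

lemma AE_L_mono:
  assumes "0 \<le> u" "u \<le> v"
  shows "AE \<omega> in M. \<forall>j. L u \<omega> $ j \<le> L v \<omega> $ j"
  using AE_increment_orthant[OF assms(1), of "v - u"] assms by (auto simp: orthant_def)

lemma expectation_L_mono:
  fixes f :: "real ^ 'd \<Rightarrow> real"
  assumes f: "f \<in> borel_measurable borel" "\<And>z. \<bar>f z\<bar> \<le> C" and u: "0 \<le> u" "u \<le> v"
    and mono: "\<And>z w. (\<And>j. z $ j \<le> w $ j) \<Longrightarrow> f z \<le> f w"
  shows "expectation (\<lambda>\<omega>. f (L u \<omega>)) \<le> expectation (\<lambda>\<omega>. f (L v \<omega>))"
proof (rule integral_mono_AE)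
  show "AE \<omega> in M. f (L u \<omega>) \<le> f (L v \<omega>)"
    using AE_L_mono[OF u] by eventually_elim (simp add: mono)
qed (use u in \<open>auto intro!: integrable_bounded_L[OF f]\<close>)

text \<open>The difference is telescoped over the mesh. With \<open>S\<close> the value at a mesh time and \<open>X\<close> the next
increment, each step contributes the mean of \<open>f (S + X) - f S - f X\<close>, scaled by \<open>c\<close>. The
pointwise bound factorises because \<open>S\<close> and \<open>X\<close> are independent, and monotonicity of the paths
replaces \<open>S\<close> by the final value \<open>L s\<close>.\<close>

lemma one_big_jump_mesh:
  fixes f :: "real ^ 'd \<Rightarrow> real"
  assumes i: "1 \<le> i" "i \<le> CARD('d)" and s: "0 < s" and c: "0 < c" and e: "0 < e"
    and C: "\<And>z. \<bar>f z\<bar> \<le> C" and K: "\<And>z w. \<bar>f z - f w\<bar> \<le> K * norm (z - w)"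
    and supp: "\<And>z. order_stat z i < e \<Longrightarrow> f z = 0"
  defines "y \<equiv> e / 2 * c" and "h \<equiv> \<lambda>n. s / real (Suc n)"
  shows "\<bar>expectation (\<lambda>\<omega>. f ((1 / c) *\<^sub>R L s \<omega>)) -
      real (Suc n) * expectation (\<lambda>\<omega>. f ((1 / c) *\<^sub>R L (h n) \<omega>))\<bar> \<le>
    (K + 3 * C + 6 * C / e) * (exceed s i y * smallness s c +
      (real (Suc n) * exceed (h n) i y) * smallness s c +
      (\<Sum>m\<in>{1..i-1}. (real (Suc n) * exceed (h n) m y) * exceed s (i - m) y))"
proof -
  define N where "N = Suc n"
  define d where "d = h n"
  define D where "D = K + 3 * C + 6 * C / e"
  define H where "H z = f ((1 / c) *\<^sub>R z)" for z
  \<comment> \<open>truncation at \<open>0\<close> keeps \<open>q\<close> bounded off the orthant\<close>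
  define q where "q z = min 1 (max 0 (coord_sum z / c))" for z :: "real ^ 'd"
  define V where "V m z = (indicator (upper m y) z :: real)" for m and z :: "real ^ 'd"
  have d: "0 < d" "0 \<le> d" using s by (auto simp: d_def h_def)
  have Nd: "real N * d = s" using s by (simp add: N_def d_def h_def)
  have kd: "0 \<le> real k * d" for k using d by simp
  have kds: "real k * d \<le> s" if "k < N" for k
    unfolding Nd[symmetric] using that d by (intro mult_right_mono) auto
  have fm: "f \<in> borel_measurable borel"
    using continuous_on_of_lipschitz_bound[OF K] by (rule borel_measurable_continuous_onI)
  have Hm: "H \<in> borel_measurable borel" unfolding H_def
    by (intro measurable_compose[OF _ fm]) measurable
  have Hb: "\<bar>H z\<bar> \<le> C" for z using C by (simp add: H_def)
  have qm: "q \<in> borel_measurable borel" unfolding q_def by measurable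
  have qb: "\<bar>q z\<bar> \<le> 1" "0 \<le> q z" for z by (auto simp: q_def)
  have Vm: "V m \<in> borel_measurable borel" if "m \<in> {1..i}" for m
    unfolding V_def using upper_borel[of m y] that i by (intro borel_measurable_indicator) auto
  have Vb: "\<bar>V m z\<bar> \<le> 1" "0 \<le> V m z" for m z by (auto simp: V_def indicator_def)
  have EV: "expectation (\<lambda>\<omega>. V m (L u \<omega>)) = exceed u m y" for u m by (simp add: V_def exceed_def)
  have D0: "0 \<le> D" unfolding D_def using e C K by (rule jump_constant_nonneg)
  have q_eq: "q z = min 1 (coord_sum z / c)" if "z \<in> orthant" for z
    using coord_sum_nonneg[OF that] c by (simp add: q_def)
  have Eq: "real (Suc k) * expectation (\<lambda>\<omega>. q (L (s / real (Suc k)) \<omega>)) \<le> smallness s c" for k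
  proof -
    have "expectation (\<lambda>\<omega>. q (L (s / real (Suc k)) \<omega>)) =
        expectation (\<lambda>\<omega>. min 1 (coord_sum (L (s / real (Suc k)) \<omega>) / c))"
      using s by (intro Bochner_Integration.integral_cong refl q_eq L_orthant) auto
    thus ?thesis using mesh_truncated_mean_le[OF c s, of k] by simp
  qed
  have pw: "\<bar>H (x + w) - H x - H w\<bar> \<le>
      D * (V i x * q w + q x * V i w + (\<Sum>m\<in>{1..i-1}. V (i - m) x * V m w))"
    if "x \<in> orthant" "w \<in> orthant" for x w
  proof -
    have Ve: "V m z = indicator {z. e / 2 \<le> order_stat z m} ((1 / c) *\<^sub>R z)" if "m \<in> {1..i}" for m z
      using upper_scaleR[of m c z "e / 2"] that i c by (simp add: V_def y_def upper_def indicator_def)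
    have o: "(1 / c) *\<^sub>R x \<in> orthant" "(1 / c) *\<^sub>R w \<in> orthant"
      using that c by (auto intro: scaleR_orthant)
    have qe: "q z = min 1 (coord_sum ((1 / c) *\<^sub>R z))" if "z \<in> orthant" for z
      using q_eq[OF that] by (simp add: coord_sum_scaleR)
    have Vs: "(\<Sum>m\<in>{1..i-1}. V (i - m) x * V m w) =
      (\<Sum>m\<in>{1..i-1}. indicator {z. e / 2 \<le> order_stat z m} ((1 / c) *\<^sub>R w) *
        indicator {z. e / 2 \<le> order_stat z (i - m)} ((1 / c) *\<^sub>R x))"
      by (intro sum.cong refl) (subst (1 2) Ve, auto)
    have "H (x + w) = f ((1 / c) *\<^sub>R x + (1 / c) *\<^sub>R w)" by (simp add: H_def scaleR_add_right)
    thus ?thesis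
      using one_big_jump_pointwise[OF i o e C K supp] i
      unfolding Vs by (simp add: H_def D_def Ve qe[OF that(1)] qe[OF that(2)] mult.commute)
  qed
  define a where "a k = expectation (\<lambda>\<omega>. H (L (real k * d) \<omega>))" for k
  have step: "\<bar>a (Suc k) - a k - expectation (\<lambda>\<omega>. H (L d \<omega>))\<bar> \<le>
      D * (exceed s i y * expectation (\<lambda>\<omega>. q (L d \<omega>)) +
        expectation (\<lambda>\<omega>. q (L s \<omega>)) * exceed d i y +
        (\<Sum>m\<in>{1..i-1}. exceed s (i - m) y * exceed d m y))" if k: "k < N" for k
  proof -
    define u where "u = real k * d"
    have u: "0 \<le> u" "u \<le> s" using kd kds k by (auto simp: u_def)
    have Su: "real (Suc k) * d = u + d" by (simp add: u_def algebra_simps)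
    define X where "X \<omega> = L (u + d) \<omega> - L u \<omega>" for \<omega>
    have Xm: "X \<in> borel_measurable M" unfolding X_def using u d
      by (intro borel_measurable_diff measurable_L) auto
    have EX: "expectation (\<lambda>\<omega>. H (X \<omega>)) = expectation (\<lambda>\<omega>. H (L d \<omega>))"
      unfolding X_def by (rule expectation_increment[OF Hm u(1) d(2)])
    have i1: "integrable M (\<lambda>\<omega>. H (L (u + d) \<omega>))" "integrable M (\<lambda>\<omega>. H (L u \<omega>))"
      using u d by (auto intro!: integrable_bounded_L[OF Hm Hb])
    have i2: "integrable M (\<lambda>\<omega>. H (X \<omega>))"
      by (rule integrable_const_bound[where B = C])
         (use Hb measurable_compose[OF Xm Hm] in auto)
    have i3: "integrable M (\<lambda>\<omega>. V i (L u \<omega>) * q (X \<omega>))"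
      "integrable M (\<lambda>\<omega>. q (L u \<omega>) * V i (X \<omega>))"
      unfolding X_def using i
      by (auto intro!: integrable_bounded_L_increment[OF Vm Vb(1) qm qb(1) u(1) d(2)]
        integrable_bounded_L_increment[OF qm qb(1) Vm Vb(1) u(1) d(2)])
    have i4: "integrable M (\<lambda>\<omega>. V (i - m) (L u \<omega>) * V m (X \<omega>))" if "m \<in> {1..i-1}" for m
      unfolding X_def using that
      by (intro integrable_bounded_L_increment[OF Vm Vb(1) Vm Vb(1) u(1) d(2)]) auto
    have i5: "integrable M (\<lambda>\<omega>. \<Sum>m\<in>{1..i-1}. V (i - m) (L u \<omega>) * V m (X \<omega>))"
      by (rule Bochner_Integration.integrable_sum[OF i4])
    have "\<bar>a (Suc k) - a k - expectation (\<lambda>\<omega>. H (L d \<omega>))\<bar> =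
        \<bar>expectation (\<lambda>\<omega>. H (L (u + d) \<omega>) - H (L u \<omega>) - H (X \<omega>))\<bar>"
      unfolding a_def Su u_def[symmetric] EX[symmetric] using i1 i2 by simp
    also have "\<dots> \<le> expectation (\<lambda>\<omega>. \<bar>H (L (u + d) \<omega>) - H (L u \<omega>) - H (X \<omega>)\<bar>)"
      by (rule integral_abs_bound)
    also have "\<dots> \<le> expectation (\<lambda>\<omega>. D * (V i (L u \<omega>) * q (X \<omega>) + q (L u \<omega>) * V i (X \<omega>) +
        (\<Sum>m\<in>{1..i-1}. V (i - m) (L u \<omega>) * V m (X \<omega>))))"
    proof (rule integral_mono_AE)
      have "AE \<omega> in M. \<omega> \<in> space M" by simp
      thus "AE \<omega> in M. \<bar>H (L (u + d) \<omega>) - H (L u \<omega>) - H (X \<omega>)\<bar> \<le>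
        D * (V i (L u \<omega>) * q (X \<omega>) + q (L u \<omega>) * V i (X \<omega>) +
        (\<Sum>m\<in>{1..i-1}. V (i - m) (L u \<omega>) * V m (X \<omega>)))"
        using AE_increment_orthant[OF u(1) d(2)]
      proof eventually_elim
        case (elim \<omega>)
        have "L (u + d) \<omega> = L u \<omega> + X \<omega>" by (simp add: X_def)
        thus ?case using pw[OF L_orthant[OF u(1) elim(1)], of "X \<omega>"] elim(2) by (simp add: X_def)
      qed
    qed (use i1 i2 i3 i4 in \<open>auto intro!: integrable_mult_right Bochner_Integration.integrable_add Bochner_Integration.integrable_sum\<close>)
    also have "\<dots> = D * (expectation (\<lambda>\<omega>. V i (L u \<omega>) * q (X \<omega>)) + expectation (\<lambda>\<omega>. q (L u \<omega>) * V i (X \<omega>)) +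
        expectation (\<lambda>\<omega>. \<Sum>m\<in>{1..i-1}. V (i - m) (L u \<omega>) * V m (X \<omega>)))"
      using i3 i5 by simp
    also have "expectation (\<lambda>\<omega>. \<Sum>m\<in>{1..i-1}. V (i - m) (L u \<omega>) * V m (X \<omega>)) =
        (\<Sum>m\<in>{1..i-1}. expectation (\<lambda>\<omega>. V (i - m) (L u \<omega>) * V m (X \<omega>)))"
      by (rule Bochner_Integration.integral_sum[OF i4])
    also have "expectation (\<lambda>\<omega>. V i (L u \<omega>) * q (X \<omega>)) = exceed u i y * expectation (\<lambda>\<omega>. q (L d \<omega>))"
      unfolding X_def EV[symmetric] using i
      by (intro expectation_indep_increment[OF Vm qm Vb(1) qb(1) u(1) d(1)]) auto
    also have "expectation (\<lambda>\<omega>. q (L u \<omega>) * V i (X \<omega>)) = expectation (\<lambda>\<omega>. q (L u \<omega>)) * exceed d i y"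
      unfolding X_def EV[symmetric] using i
      by (intro expectation_indep_increment[OF qm Vm qb(1) Vb(1) u(1) d(1)]) auto
    also have "(\<Sum>m\<in>{1..i-1}. expectation (\<lambda>\<omega>. V (i - m) (L u \<omega>) * V m (X \<omega>))) =
        (\<Sum>m\<in>{1..i-1}. exceed u (i - m) y * exceed d m y)"
    proof (rule sum.cong[OF refl])
      fix m assume m: "m \<in> {1..i-1}"
      show "expectation (\<lambda>\<omega>. V (i - m) (L u \<omega>) * V m (X \<omega>)) = exceed u (i - m) y * exceed d m y"
        unfolding X_def EV[symmetric] using m i
        by (intro expectation_indep_increment[OF Vm Vm Vb(1) Vb(1) u(1) d(1)]) auto
    qed
    also have "D * (exceed u i y * expectation (\<lambda>\<omega>. q (L d \<omega>)) +
        expectation (\<lambda>\<omega>. q (L u \<omega>)) * exceed d i y +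
        (\<Sum>m\<in>{1..i-1}. exceed u (i - m) y * exceed d m y)) \<le>
      D * (exceed s i y * expectation (\<lambda>\<omega>. q (L d \<omega>)) +
        expectation (\<lambda>\<omega>. q (L s \<omega>)) * exceed d i y +
        (\<Sum>m\<in>{1..i-1}. exceed s (i - m) y * exceed d m y))"
    proof -
      have ex: "exceed u m y \<le> exceed s m y" if "m \<in> {1..i}" for m
        unfolding EV[symmetric]
      proof (rule expectation_L_mono[OF Vm[OF that] Vb(1) u])
        fix z w :: "real ^ 'd" assume "\<And>j. z $ j \<le> w $ j"
        hence "order_stat z m \<le> order_stat w m" using that i by (intro order_stat_mono) auto
        thus "V m z \<le> V m w" by (auto simp: V_def upper_def indicator_def)
      qed
      have qq: "expectation (\<lambda>\<omega>. q (L u \<omega>)) \<le> expectation (\<lambda>\<omega>. q (L s \<omega>))"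
      proof (rule expectation_L_mono[OF qm qb(1) u])
        fix z w :: "real ^ 'd" assume "\<And>j. z $ j \<le> w $ j"
        hence "coord_sum z \<le> coord_sum w" unfolding coord_sum_def by (intro sum_mono)
        hence "coord_sum z / c \<le> coord_sum w / c" using c by (intro divide_right_mono) auto
        thus "q z \<le> q w" unfolding q_def by (intro min.mono max.mono) auto
      qed
      have q0: "0 \<le> expectation (\<lambda>\<omega>. q (L v \<omega>))" for v
        using qb by (intro Bochner_Integration.integral_nonneg) auto
      show ?thesis using i
        by (intro mult_left_mono[OF _ D0] add_mono sum_mono mult_right_mono ex qq exceed_nonneg q0) auto
    qed
    finally show ?thesis .
  qed
  have H0: "H 0 = 0"
    unfolding H_def using order_stat_le_norm[OF i, of "0 :: real ^ 'd"] e by (intro supp) auto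
  have a0: "a 0 = 0"
  proof -
    have "a 0 = expectation (\<lambda>\<omega>. 0)"
      unfolding a_def
    proof (rule integral_cong_AE)
      show "AE \<omega> in M. H (L (real 0 * d) \<omega>) = 0" using AE_L_0 by eventually_elim (simp add: H0)
      show "(\<lambda>\<omega>. H (L (real 0 * d) \<omega>)) \<in> borel_measurable M"
        by (rule measurable_compose[OF measurable_L Hm]) simp
    qed simp
    thus ?thesis by simp
  qed
  have "expectation (\<lambda>\<omega>. H (L s \<omega>)) - real N * expectation (\<lambda>\<omega>. H (L d \<omega>)) =
      (\<Sum>k<N. a (Suc k) - a k - expectation (\<lambda>\<omega>. H (L d \<omega>)))"
    using sum_lessThan_telescope[of a N] a0 by (simp add: sum_subtractf a_def Nd)
  hence "\<bar>expectation (\<lambda>\<omega>. H (L s \<omega>)) - real N * expectation (\<lambda>\<omega>. H (L d \<omega>))\<bar> \<le>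
      (\<Sum>k<N. \<bar>a (Suc k) - a k - expectation (\<lambda>\<omega>. H (L d \<omega>))\<bar>)" by (metis sum_abs)
  also have "\<dots> \<le> (\<Sum>k<N. D * (exceed s i y * expectation (\<lambda>\<omega>. q (L d \<omega>)) +
        expectation (\<lambda>\<omega>. q (L s \<omega>)) * exceed d i y +
        (\<Sum>m\<in>{1..i-1}. exceed s (i - m) y * exceed d m y)))"
    by (intro sum_mono step) auto
  also have "\<dots> = D * (exceed s i y * (real N * expectation (\<lambda>\<omega>. q (L d \<omega>))) +
        (real N * exceed d i y) * expectation (\<lambda>\<omega>. q (L s \<omega>)) +
        (\<Sum>m\<in>{1..i-1}. (real N * exceed d m y) * exceed s (i - m) y))"
    by (simp add: algebra_simps sum_distrib_left)
  also have "\<dots> \<le> D * (exceed s i y * smallness s c + (real N * exceed d i y) * smallness s c +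
        (\<Sum>m\<in>{1..i-1}. (real N * exceed d m y) * exceed s (i - m) y))"
    using Eq[of n] Eq[of 0] exceed_nonneg
    by (intro mult_left_mono[OF _ D0] add_mono mult_left_mono order_refl)
       (auto simp: N_def d_def h_def)
  finally show ?thesis by (simp add: H_def D_def N_def d_def)
qed

lemma integrable_levy_upper:
  assumes \<nu>: "is_levy_measure M L \<nu>" and m: "1 \<le> m" "m \<le> CARD('d)" and y: "0 < y"
  shows "integrable \<nu> (indicator (upper m y) :: real ^ 'd \<Rightarrow> real)"
    and "emeasure \<nu> (upper m y) < \<infinity>"
proof -
  have sets: "sets \<nu> = sets borel" using \<nu> by (simp add: is_levy_measure_def)
  have zero: "ramp m y z = 0" if "norm z \<le> y / 4" for z :: "real ^ 'd"
    using order_stat_le_norm[OF m, of z] that y by (intro ramp_eq_0) auto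
  have "integrable \<nu> (ramp m y)"
    using y by (intro small_time_limit_nonneg(1)[OF \<nu> zero_less_one _ ramp_continuous[OF m y] _ ramp_bounds,
        where r = "y / 4"] zero) auto
  thus int: "integrable \<nu> (indicator (upper m y) :: real ^ 'd \<Rightarrow> real)"
  proof (rule Bochner_Integration.integrable_bound)
    show "indicator (upper m y) \<in> borel_measurable \<nu>"
      using upper_borel[OF m, of y] by (intro borel_measurable_indicator) (simp add: sets)
    show "AE z in \<nu>. norm (indicator (upper m y) z :: real) \<le> norm (ramp m y z)"
      using order_trans[OF indicator_le_ramp[OF y] abs_ge_self] by (intro AE_I2) simp
  qed
  thus "emeasure \<nu> (upper m y) < \<infinity>"
    using upper_borel[OF m, of y] by (simp add: integrable_indicator_iff sets)
qed

text \<open>The limit of the mesh inequality for mesh width tending to zero. Only the terms with a single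
increment depend on the mesh, and they converge to integrals against the Levy measure.\<close>

theorem one_big_jump:
  fixes f :: "real ^ 'd \<Rightarrow> real"
  assumes \<nu>: "is_levy_measure M L \<nu>"
    and i: "1 \<le> i" "i \<le> CARD('d)" and s: "0 < s" and c: "0 < c" and e: "0 < e"
    and C: "\<And>z. \<bar>f z\<bar> \<le> C" and K: "\<And>z w. \<bar>f z - f w\<bar> \<le> K * norm (z - w)"
    and supp: "\<And>z. order_stat z i < e \<Longrightarrow> f z = 0"
  defines "y \<equiv> e / 2 * c"
  shows "\<bar>expectation (\<lambda>\<omega>. f ((1 / c) *\<^sub>R L s \<omega>)) - s * (LINT z|\<nu>. f ((1 / c) *\<^sub>R z))\<bar> \<le>
    (K + 3 * C + 6 * C / e) * (exceed s i y * smallness s c +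
      (s * measure \<nu> (upper i (y / 2))) * smallness s c +
      (\<Sum>m\<in>{1..i-1}. (s * measure \<nu> (upper m (y / 2))) * exceed s (i - m) y))"
proof -
  have sets: "sets \<nu> = sets borel" using \<nu> by (simp add: is_levy_measure_def)
  have y: "0 < y" using e c by (simp add: y_def)
  define h where "h n = s / real (Suc n)" for n
  define D where "D = K + 3 * C + 6 * C / e"
  have D0: "0 \<le> D" unfolding D_def using e C K by (rule jump_constant_nonneg)
  define W where "W m n = real (Suc n) * expectation (\<lambda>\<omega>. ramp m y (L (h n) \<omega>))" for m n
  have zero: "ramp m y z = 0" if "norm z \<le> y / 4" "m \<in> {1..i}" for m and z :: "real ^ 'd"
    using order_stat_le_norm[of m z] that y i by (intro ramp_eq_0) auto
  have rb: "\<bar>ramp m y z\<bar> \<le> 1" for m and z :: "real ^ 'd" using ramp_bounds[of m y z] by simp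
  have Wlim: "W m \<longlonglongrightarrow> s * integral\<^sup>L \<nu> (ramp m y)" and rint: "integrable \<nu> (ramp m y)"
    if m: "m \<in> {1..i}" for m
  proof -
    have m': "1 \<le> m" "m \<le> CARD('d)" using m i by auto
    note lim = small_time_limit[OF \<nu> s _ ramp_continuous[OF m' y] zero rb, of "y / 4"]
    show "W m \<longlonglongrightarrow> s * integral\<^sup>L \<nu> (ramp m y)" "integrable \<nu> (ramp m y)"
      unfolding W_def h_def using lim m y by auto
  qed
  have Wge: "real (Suc n) * exceed (h n) m y \<le> W m n" if m: "m \<in> {1..i}" for m n
  proof -
    have m': "1 \<le> m" "m \<le> CARD('d)" using m i by auto
    have h0: "0 \<le> h n" using s by (simp add: h_def)
    have "expectation (\<lambda>\<omega>. indicator (upper m y) (L (h n) \<omega>)) \<le> expectation (\<lambda>\<omega>. ramp m y (L (h n) \<omega>))"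
    proof (rule integral_mono)
      show "integrable M (\<lambda>\<omega>. indicator (upper m y) (L (h n) \<omega>) :: real)"
        by (rule integrable_bounded_L[where C = 1]) (use upper_borel[OF m', of y] h0 in \<open>auto simp: indicator_def\<close>)
      show "integrable M (\<lambda>\<omega>. ramp m y (L (h n) \<omega>))"
        using borel_measurable_continuous_onI[OF ramp_continuous[OF m' y]] rb h0 by (rule integrable_bounded_L)
    qed (rule indicator_le_ramp[OF y])
    thus ?thesis unfolding exceed_def W_def by (intro mult_left_mono) auto
  qed
  have rT: "integral\<^sup>L \<nu> (ramp m y) \<le> measure \<nu> (upper m (y / 2))" if m: "m \<in> {1..i}" for m
  proof -
    have m': "1 \<le> m" "m \<le> CARD('d)" using m i by auto
    have "integral\<^sup>L \<nu> (ramp m y) \<le> integral\<^sup>L \<nu> (indicator (upper m (y / 2)))"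
      using y by (intro integral_mono rint m integrable_levy_upper[OF \<nu> m'] ramp_le_indicator) auto
    also have "\<dots> = measure \<nu> (upper m (y / 2))" using sets_eq_imp_space_eq[OF sets] by simp
    finally show ?thesis .
  qed
  note k0 = smallness_nonneg[OF c s] and e0 = exceed_nonneg
  define E where "E u = expectation (\<lambda>\<omega>. f ((1 / c) *\<^sub>R L u \<omega>))" for u
  define J where "J = (LINT z|\<nu>. f ((1 / c) *\<^sub>R z))"
  define R where "R w = D * (exceed s i y * smallness s c + w i * smallness s c +
    (\<Sum>m\<in>{1..i-1}. w m * exceed s (i - m) y))" for w
  have R_mono: "R v \<le> R w" if "\<And>m. m \<in> {1..i} \<Longrightarrow> v m \<le> w m" for v w
    unfolding R_def using i that
    by (intro mult_left_mono[OF _ D0] add_mono sum_mono mult_right_mono k0 e0) auto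
  have "\<bar>E s - s * J\<bar> \<le> R (\<lambda>m. s * integral\<^sup>L \<nu> (ramp m y))"
  proof (rule LIMSEQ_le)
    have "(\<lambda>n. real (Suc n) * E (h n)) \<longlonglongrightarrow> s * J"
      unfolding E_def J_def h_def
    proof (rule small_time_limit(2)[OF \<nu> s, of "e * c / 2"])
      show "0 < e * c / 2" using e c by simp
      show "continuous_on UNIV (\<lambda>z. f ((1 / c) *\<^sub>R z))"
        by (rule continuous_on_compose2[OF continuous_on_of_lipschitz_bound[OF K, of UNIV]])
           (auto intro!: continuous_intros)
      show "f ((1 / c) *\<^sub>R z) = 0" if "norm z \<le> e * c / 2" for z
      proof (rule supp)
        have "order_stat ((1 / c) *\<^sub>R z) i \<le> norm ((1 / c) *\<^sub>R z)" by (rule order_stat_le_norm[OF i])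
        also have "\<dots> \<le> e / 2" using that c by (simp add: field_simps)
        also have "\<dots> < e" using e by simp
        finally show "order_stat ((1 / c) *\<^sub>R z) i < e" .
      qed
    qed (rule C)
    thus "(\<lambda>n. \<bar>E s - real (Suc n) * E (h n)\<bar>) \<longlonglongrightarrow> \<bar>E s - s * J\<bar>"
      by (rule tendsto_rabs[OF tendsto_diff[OF tendsto_const]])
    show "(\<lambda>n. R (\<lambda>m. W m n)) \<longlonglongrightarrow> R (\<lambda>m. s * integral\<^sup>L \<nu> (ramp m y))"
      unfolding R_def using i by (intro tendsto_intros Wlim) auto
    have "\<bar>E s - real (Suc n) * E (h n)\<bar> \<le> R (\<lambda>m. W m n)" for n
    proof -
      have "\<bar>E s - real (Suc n) * E (h n)\<bar> \<le> R (\<lambda>m. real (Suc n) * exceed (h n) m y)"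
        unfolding E_def R_def D_def y_def h_def by (rule one_big_jump_mesh[OF i s c e C K supp])
      also have "\<dots> \<le> R (\<lambda>m. W m n)" by (rule R_mono) (rule Wge)
      finally show ?thesis .
    qed
    thus "\<exists>n0. \<forall>n\<ge>n0. \<bar>E s - real (Suc n) * E (h n)\<bar> \<le> R (\<lambda>m. W m n)" by blast
  qed
  also have "\<dots> \<le> R (\<lambda>m. s * measure \<nu> (upper m (y / 2)))"
    using s by (intro R_mono mult_left_mono rT) auto
  finally show ?thesis by (simp add: D_def E_def J_def R_def)
qed

end

section \<open>Regularly varying tails along powers of two\<close>

lemma ratio_tendsto_imp_tendsto_0:
  fixes q :: "nat \<Rightarrow> real"
  assumes pos: "\<forall>\<^sub>F n in sequentially. 0 < q n"
    and lim: "(\<lambda>n. q (Suc n) / q n) \<longlonglongrightarrow> \<rho>" and \<rho>: "\<rho> < 1"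
  shows "q \<longlonglongrightarrow> 0"
proof -
  obtain c where c: "\<rho> < c" "c < 1" using dense[OF \<rho>] by blast
  have "\<forall>\<^sub>F n in sequentially. q (Suc n) / q n < c \<and> 0 < q n"
    using order_tendstoD(2)[OF lim c(1)] pos by (rule eventually_conj)
  then obtain N where N: "\<And>n. N \<le> n \<Longrightarrow> q (Suc n) / q n < c \<and> 0 < q n"
    unfolding eventually_sequentially by blast
  have "norm (q (Suc n)) \<le> c * norm (q n)" if "N \<le> n" for n
  proof -
    have "0 < q n" "0 < q (Suc n)" "q (Suc n) / q n < c" using N[of n] N[of "Suc n"] that by auto
    thus ?thesis by (simp add: field_simps)
  qed
  hence "summable q" using c(2) by (rule summable_ratio_test[rotated])
  thus ?thesis by (rule summable_LIMSEQ_zero)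
qed

lemma ratio_tendsto_imp_at_top:
  fixes q :: "nat \<Rightarrow> real"
  assumes pos: "\<forall>\<^sub>F n in sequentially. 0 < q n"
    and lim: "(\<lambda>n. q (Suc n) / q n) \<longlonglongrightarrow> \<rho>" and \<rho>: "1 < \<rho>"
  shows "filterlim q at_top sequentially"
proof -
  have "(\<lambda>n. inverse (q n)) \<longlonglongrightarrow> 0"
  proof (rule ratio_tendsto_imp_tendsto_0)
    show "\<forall>\<^sub>F n in sequentially. 0 < inverse (q n)" using pos by eventually_elim simp
    show "(\<lambda>n. inverse (q (Suc n)) / inverse (q n)) \<longlonglongrightarrow> inverse \<rho>"
      using tendsto_inverse[OF lim] \<rho> by (simp add: field_simps)
    show "inverse \<rho> < 1" using \<rho> by (simp add: field_simps)
  qed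
  hence "filterlim (\<lambda>n. inverse (inverse (q n))) at_top sequentially"
    using pos by (intro filterlim_inverse_at_top) (auto elim: eventually_mono)
  thus ?thesis by simp
qed

text \<open>The upper end of the bracket is the first index beyond \<open>N\<close> at which the sequence exceeds
\<open>x\<close>.\<close>

lemma eventually_bracketed:
  fixes a :: "nat \<Rightarrow> real"
  assumes "filterlim a at_top sequentially"
  shows "\<forall>\<^sub>F x in at_top. \<exists>n\<ge>N. a n \<le> x \<and> x < a (Suc n)"
  using eventually_ge_at_top[of "a N"]
proof eventually_elim
  case (elim x)
  have "\<forall>\<^sub>F n in sequentially. x < a n \<and> N < n"
    using assms by (intro eventually_conj eventually_gt_at_top) (simp add: filterlim_at_top_dense)
  then obtain m where m: "x < a m \<and> N < m"
    using eventually_happens'[OF sequentially_bot] by blast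
  define n where "n = (LEAST n. x < a n \<and> N < n)"
  have n: "x < a n" "N < n" unfolding n_def using LeastI[of "\<lambda>n. x < a n \<and> N < n", OF m] by auto
  have least: "\<not> (x < a k \<and> N < k)" if "k < n" for k
    using not_less_Least that unfolding n_def by blast
  obtain k where k: "n = Suc k" using n(2) by (cases n) auto
  have "a k \<le> x" using least[of k] elim k n(2) by (cases "k = N") auto
  thus ?case using n k by (intro exI[of _ k]) auto
qed

lemma RV_eventually_pos:
  assumes "b \<in> RV \<beta>"
  shows "\<forall>\<^sub>F t in at_top. 0 < b t"
proof -
  have lim: "((\<lambda>t. b (t * 2) / b t) \<longlongrightarrow> 2 powr \<beta>) at_top" and nonneg: "\<And>t. 0 \<le> t \<Longrightarrow> 0 \<le> b t"
    using assms by (auto simp: RV_def)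
  have "\<forall>\<^sub>F t in at_top. 0 < b (t * 2) / b t"
    using lim by (rule order_tendstoD) simp
  thus ?thesis using eventually_ge_at_top[of 0]
  proof eventually_elim
    case (elim t)
    thus ?case using nonneg[of t] by (cases "b t = 0") auto
  qed
qed

text \<open>What regular variation of a measure says about one tail function \<open>T\<close> with norming function
\<open>b\<close>: at the scale \<open>b t\<close> the tail has order \<open>1 / t\<close>. As \<open>T\<close> is monotone, it suffices
to follow \<open>b\<close> along the powers of two, where the ratio test applies.\<close>

locale tail_norming =
  fixes T b :: "real \<Rightarrow> real" and \<alpha> :: real
  assumes alpha_pos: "0 < \<alpha>" and RV: "b \<in> RV (1 / \<alpha>)"
    and T_nonneg: "0 \<le> T x" and T_antimono: "0 < x \<Longrightarrow> x \<le> y \<Longrightarrow> T y \<le> T x"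
    and lower: "\<exists>e>0. \<exists>c>0. \<forall>\<^sub>F t in at_top. c \<le> t * T (e * b t)"
    and upper: "0 < e \<Longrightarrow> \<exists>C. \<forall>\<^sub>F t in at_top. t * T (e * b t) \<le> C"
begin

definition a :: "nat \<Rightarrow> real" where "a n = b (2 ^ n)"

lemma pow2_at_top: "filterlim (\<lambda>n. 2 ^ n :: real) at_top sequentially"
  by (rule ratio_tendsto_imp_at_top[where \<rho> = 2]) simp_all

lemmas eventually_b_pos = RV_eventually_pos[OF RV]

lemma a_pos: "\<forall>\<^sub>F n in sequentially. 0 < a n"
  unfolding a_def using eventually_compose_filterlim[OF eventually_b_pos pow2_at_top] .

lemma a_ratio: "(\<lambda>n. a (Suc n) / a n) \<longlonglongrightarrow> 2 powr (1 / \<alpha>)"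
proof -
  have "((\<lambda>t. b (t * 2) / b t) \<longlongrightarrow> 2 powr (1 / \<alpha>)) at_top" using RV by (auto simp: RV_def)
  from filterlim_compose[OF this pow2_at_top] show ?thesis by (simp add: a_def mult.commute)
qed

lemma a_at_top: "filterlim a at_top sequentially"
proof (rule ratio_tendsto_imp_at_top[OF a_pos a_ratio])
  show "1 < 2 powr (1 / \<alpha>)" using powr_less_mono[of 0 "1 / \<alpha>" 2] alpha_pos by simp
qed

definition \<epsilon> :: real where "\<epsilon> = (SOME e. 0 < e \<and> (\<exists>c>0. \<forall>\<^sub>F t in at_top. c \<le> t * T (e * b t)))"

lemma eps: "0 < \<epsilon>" "\<exists>c>0. \<forall>\<^sub>F t in at_top. c \<le> t * T (\<epsilon> * b t)"
  using someI_ex[of "\<lambda>e. 0 < e \<and> (\<exists>c>0. \<forall>\<^sub>F t in at_top. c \<le> t * T (e * b t))"] lower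
  unfolding \<epsilon>_def by blast+

lemma T_a_lower: "\<exists>c>0. \<forall>\<^sub>F n in sequentially. c / 2 ^ n \<le> T (\<epsilon> * a n)"
proof -
  obtain c where c: "0 < c" "\<forall>\<^sub>F t in at_top. c \<le> t * T (\<epsilon> * b t)" using eps by blast
  have "\<forall>\<^sub>F n in sequentially. c \<le> 2 ^ n * T (\<epsilon> * a n)"
    unfolding a_def by (rule eventually_compose_filterlim[OF c(2) pow2_at_top])
  hence "\<forall>\<^sub>F n in sequentially. c / 2 ^ n \<le> T (\<epsilon> * a n)"
    by eventually_elim (simp add: field_simps)
  thus ?thesis using c(1) by blast
qed

lemma T_a_upper: "0 < e \<Longrightarrow> \<exists>C>0. \<forall>\<^sub>F n in sequentially. T (e * a n) \<le> C / 2 ^ n"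
proof -
  assume "0 < e"
  then obtain C where C: "\<forall>\<^sub>F t in at_top. t * T (e * b t) \<le> C" using upper by blast
  have "\<forall>\<^sub>F n in sequentially. 2 ^ n * T (e * a n) \<le> C"
    unfolding a_def by (rule eventually_compose_filterlim[OF C pow2_at_top])
  hence "\<forall>\<^sub>F n in sequentially. T (e * a n) \<le> max C 1 / 2 ^ n"
    by eventually_elim (simp add: field_simps le_max_iff_disj)
  thus ?thesis by (intro exI[of _ "max C 1"]) auto
qed

lemma eps_a_at_top: "filterlim (\<lambda>n. \<epsilon> * a n) at_top sequentially"
  by (rule filterlim_tendsto_pos_mult_at_top[OF tendsto_const eps(1) a_at_top])

lemma T_pos: "0 < x \<Longrightarrow> 0 < T x"
proof -
  assume x: "0 < x"
  obtain c where c: "0 < c" "\<forall>\<^sub>F n in sequentially. c / 2 ^ n \<le> T (\<epsilon> * a n)" using T_a_lower by blast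
  have "\<forall>\<^sub>F n in sequentially. x \<le> \<epsilon> * a n"
    using eps_a_at_top by (simp add: filterlim_at_top)
  hence "\<forall>\<^sub>F n in sequentially. 0 < T x" using c(2)
  proof eventually_elim
    case (elim n)
    have "0 < c / 2 ^ n" using c(1) by simp
    also have "\<dots> \<le> T (\<epsilon> * a n)" by (rule elim(2))
    also have "\<dots> \<le> T x" using T_antimono[OF x elim(1)] .
    finally show ?case .
  qed
  thus ?thesis by simp
qed

lemma b_at_top: "filterlim b at_top at_top"
  unfolding filterlim_at_top_gt[of _ _ 0]
proof (intro allI impI)
  fix B :: real assume B: "0 < B"
  obtain C where C: "\<forall>\<^sub>F t in at_top. t * T (1 * b t) \<le> C" using upper[of 1] by auto
  have "\<forall>\<^sub>F t in at_top. C / T B < t" by (rule eventually_gt_at_top)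
  with C eventually_b_pos show "\<forall>\<^sub>F t in at_top. B \<le> b t"
    using eventually_gt_at_top[of 0]
  proof eventually_elim
    case (elim t)
    show ?case
    proof (rule ccontr)
      assume "\<not> B \<le> b t"
      hence "T B \<le> T (b t)" using elim by (intro T_antimono) auto
      hence "t * T B \<le> t * T (b t)" using elim by (intro mult_left_mono) auto
      also have "t * T (b t) \<le> C" using elim by simp
      finally have "t * T B \<le> C" .
      thus False using elim T_pos[OF B] by (simp add: field_simps)
    qed
  qed
qed

text \<open>Both sides are of order \<open>1 / 2 ^ n\<close> when \<open>x\<close> lies between \<open>\<epsilon> * a n\<close> and
\<open>\<epsilon> * a (Suc n)\<close>.\<close>

lemma T_shrink: "0 < k \<Longrightarrow> \<exists>C>0. \<forall>\<^sub>F x in at_top. T (k * x) \<le> C * T x"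
proof -
  assume l: "0 < k"
  obtain c where c: "0 < c" "\<forall>\<^sub>F n in sequentially. c / 2 ^ n \<le> T (\<epsilon> * a n)" using T_a_lower by blast
  have "0 < k * \<epsilon>" using l eps by simp
  then obtain C where C: "0 < C" "\<forall>\<^sub>F n in sequentially. T (k * \<epsilon> * a n) \<le> C / 2 ^ n"
    using T_a_upper by blast
  obtain N where N: "\<And>n. N \<le> n \<Longrightarrow> c / 2 ^ n \<le> T (\<epsilon> * a n) \<and> T (k * \<epsilon> * a n) \<le> C / 2 ^ n \<and> 0 < a n"
    using eventually_conj[OF c(2) eventually_conj[OF C(2) a_pos]] unfolding eventually_sequentially by blast
  have "\<forall>\<^sub>F x in at_top. T (k * x) \<le> (2 * C / c) * T x"
    using eventually_bracketed[OF eps_a_at_top, of N]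
  proof eventually_elim
    case (elim x)
    then obtain n where n: "N \<le> n" "\<epsilon> * a n \<le> x" "x < \<epsilon> * a (Suc n)" by blast
    have an: "0 < \<epsilon> * a n" using N[OF n(1)] eps by simp
    have "T (k * x) \<le> T (k * \<epsilon> * a n)"
      using n(2) an l mult_left_mono[OF n(2), of k] by (intro T_antimono) (auto simp: mult.assoc)
    also have "\<dots> \<le> C / 2 ^ n" using N[OF n(1)] by simp
    also have "\<dots> = (2 * C / c) * (c / 2 ^ Suc n)" using c(1) by simp
    also have "\<dots> \<le> (2 * C / c) * T (\<epsilon> * a (Suc n))"
      using N[of "Suc n"] n(1) C(1) c(1) by (intro mult_left_mono) auto
    also have "\<dots> \<le> (2 * C / c) * T x"
      using n an C(1) c(1) by (intro mult_left_mono T_antimono) auto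
    finally show ?case .
  qed
  thus ?thesis using C(1) c(1) by (intro exI[of _ "2 * C / c"]) auto
qed

lemma geometric_ratio:
  "(\<lambda>n. (a (Suc n) powr p / 2 ^ Suc n) / (a n powr p / 2 ^ n)) \<longlonglongrightarrow> 2 powr (p / \<alpha>) / 2"
proof -
  have "(\<lambda>n. (a (Suc n) / a n) powr p / 2) \<longlonglongrightarrow> (2 powr (1 / \<alpha>)) powr p / 2"
    by (intro tendsto_intros a_ratio) auto
  hence "(\<lambda>n. (a (Suc n) / a n) powr p / 2) \<longlonglongrightarrow> 2 powr (p / \<alpha>) / 2"
    by (simp add: powr_powr)
  moreover have "\<forall>\<^sub>F n in sequentially. (a (Suc n) / a n) powr p / 2 =
      (a (Suc n) powr p / 2 ^ Suc n) / (a n powr p / 2 ^ n)"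
    using a_pos a_pos[unfolded eventually_sequentially_Suc[of "\<lambda>n. 0 < a n", symmetric]]
  proof eventually_elim
    case (elim n)
    thus ?case by (simp add: powr_divide field_simps)
  qed
  ultimately show ?thesis by (rule Lim_transform_eventually)
qed

lemma geometric_pos: "\<forall>\<^sub>F n in sequentially. 0 < a n powr p / 2 ^ n"
  using a_pos by eventually_elim simp

lemma powr_mult_T_tendsto_0:
  assumes p: "0 < p" "p < \<alpha>"
  shows "((\<lambda>x. x powr p * T x) \<longlongrightarrow> 0) at_top"
proof -
  have "2 powr (p / \<alpha>) < 2 powr (1::real)" using p alpha_pos by (intro powr_less_mono) auto
  hence q: "(\<lambda>n. a n powr p / 2 ^ n) \<longlonglongrightarrow> 0"
    by (intro ratio_tendsto_imp_tendsto_0[OF geometric_pos geometric_ratio]) simp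
  obtain C where C: "0 < C" "\<forall>\<^sub>F n in sequentially. T (\<epsilon> * a n) \<le> C / 2 ^ n"
    using T_a_upper[OF eps(1)] by blast
  define D where "D = 2 * C * \<epsilon> powr p"
  have D: "0 < D" using C eps by (simp add: D_def)
  show ?thesis
  proof (rule tendstoI)
    fix r :: real assume r: "0 < r"
    have ev: "\<forall>\<^sub>F n in sequentially. a n powr p / 2 ^ n < r / D"
      using q r D by (intro order_tendstoD(2)[OF q]) auto
    then obtain N where N: "\<And>n. N \<le> n \<Longrightarrow> a n powr p / 2 ^ n < r / D \<and> T (\<epsilon> * a n) \<le> C / 2 ^ n \<and> 0 < a n"
      using eventually_conj[OF ev eventually_conj[OF C(2) a_pos]] unfolding eventually_sequentially by blast
    show "\<forall>\<^sub>F x in at_top. dist (x powr p * T x) 0 < r"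
      using eventually_bracketed[OF eps_a_at_top, of N]
    proof eventually_elim
      case (elim x)
      then obtain n where n: "N \<le> n" "\<epsilon> * a n \<le> x" "x < \<epsilon> * a (Suc n)" by blast
      have an: "0 < \<epsilon> * a n" using N[OF n(1)] eps by simp
      have an': "0 < a (Suc n)" using N[of "Suc n"] n(1) by simp
      have "T x \<le> T (\<epsilon> * a n)" using n an by (intro T_antimono) auto
      hence "T x \<le> C / 2 ^ n" using N[OF n(1)] by simp
      moreover have "x powr p \<le> (\<epsilon> * a (Suc n)) powr p" using n an p by (intro powr_mono2) auto
      ultimately have "x powr p * T x \<le> (\<epsilon> * a (Suc n)) powr p * (C / 2 ^ n)"
        using T_nonneg by (intro mult_mono) auto
      also have "\<dots> = D * (a (Suc n) powr p / 2 ^ Suc n)"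
        using eps an' by (simp add: D_def powr_mult field_simps)
      also have "\<dots> < D * (r / D)" using N[of "Suc n"] n(1) D by (intro mult_strict_left_mono) auto
      also have "\<dots> = r" using D by simp
      finally show ?case using T_nonneg[of x] by simp
    qed
  qed
qed

lemma powr_mult_T_at_top:
  assumes p: "\<alpha> < p"
  shows "filterlim (\<lambda>x. x powr p * T x) at_top at_top"
proof -
  have p0: "0 < p" using p alpha_pos by simp
  have "2 powr (1::real) < 2 powr (p / \<alpha>)" using p alpha_pos by (intro powr_less_mono) auto
  hence q: "filterlim (\<lambda>n. a n powr p / 2 ^ n) at_top sequentially"
    by (intro ratio_tendsto_imp_at_top[OF geometric_pos geometric_ratio]) simp
  obtain c where c: "0 < c" "\<forall>\<^sub>F n in sequentially. c / 2 ^ n \<le> T (\<epsilon> * a n)" using T_a_lower by blast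
  define D where "D = c * \<epsilon> powr p / 2"
  have D: "0 < D" using c eps by (simp add: D_def)
  show ?thesis unfolding filterlim_at_top
  proof
    fix Z :: real
    have ev: "\<forall>\<^sub>F n in sequentially. Z / D \<le> a n powr p / 2 ^ n" using q by (simp add: filterlim_at_top)
    then obtain N where N: "\<And>n. N \<le> n \<Longrightarrow> Z / D \<le> a n powr p / 2 ^ n \<and> c / 2 ^ n \<le> T (\<epsilon> * a n) \<and> 0 < a n"
      using eventually_conj[OF ev eventually_conj[OF c(2) a_pos]] unfolding eventually_sequentially by blast
    show "\<forall>\<^sub>F x in at_top. Z \<le> x powr p * T x"
      using eventually_bracketed[OF eps_a_at_top, of N]
    proof eventually_elim
      case (elim x)
      then obtain n where n: "N \<le> n" "\<epsilon> * a n \<le> x" "x < \<epsilon> * a (Suc n)" by blast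
      have an: "0 < \<epsilon> * a n" using N[OF n(1)] eps by simp
      have "Z = D * (Z / D)" using D by simp
      also have "\<dots> \<le> D * (a n powr p / 2 ^ n)" using N[OF n(1)] D by (intro mult_left_mono) auto
      also have "\<dots> = (\<epsilon> * a n) powr p * (c / 2 ^ Suc n)"
        using eps N[OF n(1)] by (simp add: D_def powr_mult field_simps)
      also have "\<dots> \<le> x powr p * T x"
      proof (rule mult_mono)
        show "(\<epsilon> * a n) powr p \<le> x powr p" using n an p0 by (intro powr_mono2) auto
        have "c / 2 ^ Suc n \<le> T (\<epsilon> * a (Suc n))" using N[of "Suc n"] n(1) by simp
        also have "\<dots> \<le> T x" using n an by (intro T_antimono) auto
        finally show "c / 2 ^ Suc n \<le> T x" .
      qed (use c in auto)
      finally show ?case .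
    qed
  qed
qed

end

text \<open>Each tail is a power function up to an arbitrarily small change of the exponent. The strict
inequality leaves room to shrink \<open>\<alpha>1\<close> and \<open>\<alpha>2\<close> by a common factor \<open>r < 1\<close> and still exceed
\<open>\<alpha>\<close>.\<close>

lemma tail_product_negligible:
  assumes "tail_norming T b \<alpha>" "tail_norming T1 b1 \<alpha>1" "tail_norming T2 b2 \<alpha>2"
    and less: "\<alpha> < \<alpha>1 + \<alpha>2"
  shows "((\<lambda>x. T1 x * T2 x / T x) \<longlongrightarrow> 0) at_top"
proof -
  interpret T: tail_norming T b \<alpha> by fact
  interpret T1: tail_norming T1 b1 \<alpha>1 by fact
  interpret T2: tail_norming T2 b2 \<alpha>2 by fact
  obtain r where r: "\<alpha> / (\<alpha>1 + \<alpha>2) < r" "r < 1"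
    using dense[of "\<alpha> / (\<alpha>1 + \<alpha>2)" 1] less T.alpha_pos by auto
  have "0 < \<alpha> / (\<alpha>1 + \<alpha>2)" using T.alpha_pos T1.alpha_pos T2.alpha_pos by simp
  hence r0: "0 < r" using r by linarith
  \<comment> \<open>exponents below \<open>\<alpha>1\<close> and \<open>\<alpha>2\<close> whose sum is above \<open>\<alpha>\<close>\<close>
  define p1 p2 where "p1 = r * \<alpha>1" and "p2 = r * \<alpha>2"
  have p: "0 < p1" "p1 < \<alpha>1" "0 < p2" "p2 < \<alpha>2" "\<alpha> < p1 + p2"
    using r r0 T1.alpha_pos T2.alpha_pos by (auto simp: p1_def p2_def field_simps)
  have l: "((\<lambda>x. (x powr p1 * T1 x) * (x powr p2 * T2 x)) \<longlongrightarrow> 0 * 0) at_top"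
    by (intro tendsto_mult T1.powr_mult_T_tendsto_0 T2.powr_mult_T_tendsto_0 p)
  have m: "((\<lambda>x. inverse (x powr (p1 + p2) * T x)) \<longlongrightarrow> 0) at_top"
    by (rule tendsto_inverse_0_at_top[OF T.powr_mult_T_at_top[OF p(5)]])
  have "((\<lambda>x. ((x powr p1 * T1 x) * (x powr p2 * T2 x)) * inverse (x powr (p1 + p2) * T x)) \<longlongrightarrow> 0 * 0 * 0) at_top"
    by (rule tendsto_mult[OF l m])
  moreover have "\<forall>\<^sub>F x in at_top. ((x powr p1 * T1 x) * (x powr p2 * T2 x)) * inverse (x powr (p1 + p2) * T x) =
      T1 x * T2 x / T x"
    using eventually_gt_at_top[of 0]
  proof eventually_elim
    case (elim x)
    thus ?case using T.T_pos[OF elim] by (simp add: powr_add field_simps)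
  qed
  ultimately have "((\<lambda>x. T1 x * T2 x / T x) \<longlongrightarrow> 0 * 0 * 0) at_top"
    by (rule Lim_transform_eventually)
  thus ?thesis by simp
qed

section \<open>Regular variation tested with ramp functions\<close>

lemma abs_ramp: "\<bar>ramp m y z\<bar> = ramp m y z"
  using ramp_bounds[of m y z] by simp

lemma EE_subset_orthant: "EE i \<subseteq> orthant"
  by (simp add: EE_def)

lemma EE_borel [measurable]:
  assumes "1 \<le> i" "i \<le> CARD('d::finite)"
  shows "(EE i :: (real ^ 'd) set) \<in> sets borel"
proof -
  have [measurable]: "(\<lambda>z :: real ^ 'd. order_stat z i) \<in> borel_measurable borel"
    by (rule borel_measurable_order_stat[OF assms])
  have "EE i = orthant \<inter> {z :: real ^ 'd. 0 < order_stat z i}" using EE_iff[OF assms] by auto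
  also have "\<dots> \<in> sets borel" by measurable
  finally show ?thesis .
qed

text \<open>This makes the theory of integration with respect to densities available for scaled measures.\<close>

lemma scale_measure_eq_density:
  "0 \<le> t \<Longrightarrow> scale_measure (ennreal t) N = density N (\<lambda>_. ennreal t)"
  by (rule measure_eqI) (simp_all add: emeasure_density_const)

lemma integral_scale_measure:
  fixes f :: "'a \<Rightarrow> real"
  assumes "f \<in> borel_measurable N" "0 \<le> t"
  shows "(LINT z|scale_measure (ennreal t) N. f z) = t * (LINT z|N. f z)"
  using assms by (simp add: scale_measure_eq_density integral_density)

lemma integral_rescaled:
  fixes f :: "real ^ 'd::finite \<Rightarrow> real"
  assumes i: "1 \<le> i" "i \<le> CARD('d)" and sets: "sets \<nu> = sets borel" and t: "0 \<le> t"
    and f: "f \<in> borel_measurable (restrict_space borel (EE i))"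
  shows "(LINT z|rescaled i t c \<nu>. f z) =
    t * (LINT z|\<nu>. indicator (EE i) ((1 / c) *\<^sub>R z) * f ((1 / c) *\<^sub>R z))"
proof -
  have EEb: "EE i \<in> sets (borel :: (real ^ 'd) measure)" by (rule EE_borel[OF i])
  have fm: "(\<lambda>z. indicator (EE i) z * f z) \<in> borel_measurable borel"
    using f EEb by (subst (asm) borel_measurable_restrict_space_iff) (simp_all add: mult.commute)
  have cm: "(\<lambda>z. z /\<^sub>R c) \<in> measurable \<nu> borel"
    unfolding measurable_cong_sets[OF sets refl] by measurable
  have "sets (restrict_space (distr \<nu> borel (\<lambda>z. z /\<^sub>R c)) (EE i)) = sets (restrict_space borel (EE i))"
    by (rule sets_restrict_space_cong) simp
  hence "f \<in> borel_measurable (restrict_space (distr \<nu> borel (\<lambda>z. z /\<^sub>R c)) (EE i))"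
    using f measurable_cong_sets[OF _ refl] by blast
  hence "(LINT z|rescaled i t c \<nu>. f z) =
      t * (LINT z|restrict_space (distr \<nu> borel (\<lambda>z. z /\<^sub>R c)) (EE i). f z)"
    unfolding rescaled_def using t by (rule integral_scale_measure)
  also have "(LINT z|restrict_space (distr \<nu> borel (\<lambda>z. z /\<^sub>R c)) (EE i). f z) =
      (LINT z|distr \<nu> borel (\<lambda>z. z /\<^sub>R c). indicator (EE i) z * f z)"
    using EEb by (subst integral_restrict_space) simp_all
  also have "\<dots> = (LINT z|\<nu>. indicator (EE i) (z /\<^sub>R c) * f (z /\<^sub>R c))"
    by (rule integral_distr[OF cm fm])
  finally show ?thesis by (simp add: inverse_eq_divide)
qed

lemma borel_measurable_EE:
  fixes f :: "real ^ 'd::finite \<Rightarrow> real"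
  assumes "1 \<le> i" "i \<le> CARD('d)" "continuous_on (EE i) f"
  shows "f \<in> borel_measurable (restrict_space borel (EE i))"
  using borel_measurable_continuous_on_restrict[OF assms(3)] .

lemma integral_rescaled_vanishing:
  fixes f :: "real ^ 'd::finite \<Rightarrow> real"
  assumes i: "1 \<le> i" "i \<le> CARD('d)" and sets: "sets \<nu> = sets borel" and ae: "AE z in \<nu>. z \<in> orthant"
    and t: "0 \<le> t" and c: "0 < c" and e: "0 < e"
    and f: "f \<in> borel_measurable borel" and supp: "\<And>z. order_stat z i < e \<Longrightarrow> f z = 0"
  shows "(LINT z|rescaled i t c \<nu>. f z) = t * (LINT z|\<nu>. f ((1 / c) *\<^sub>R z))"
proof -
  have fr: "f \<in> borel_measurable (restrict_space borel (EE i))"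
    using f by (rule measurable_restrict_space1)
  have EEb: "EE i \<in> sets (borel :: (real ^ 'd) measure)" by (rule EE_borel[OF i])
  have cm: "(\<lambda>z. (1 / c) *\<^sub>R z) \<in> measurable \<nu> borel"
    unfolding measurable_cong_sets[OF sets refl] by measurable
  have fm: "(\<lambda>z. indicator (EE i) z * f z) \<in> borel_measurable borel"
    using f EEb by (intro borel_measurable_times borel_measurable_indicator)
  have "(LINT z|\<nu>. indicator (EE i) ((1 / c) *\<^sub>R z) * f ((1 / c) *\<^sub>R z)) = (LINT z|\<nu>. f ((1 / c) *\<^sub>R z))"
  proof (rule integral_cong_AE)
    show "AE z in \<nu>. indicator (EE i) ((1 / c) *\<^sub>R z) * f ((1 / c) *\<^sub>R z) = f ((1 / c) *\<^sub>R z)"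
      using ae
    proof eventually_elim
      case (elim z)
      have "(1 / c) *\<^sub>R z \<in> orthant" using elim c by (intro scaleR_orthant) auto
      thus ?case using EE_iff[OF i, of "(1 / c) *\<^sub>R z"] supp[of "(1 / c) *\<^sub>R z"] e
        by (cases "order_stat ((1 / c) *\<^sub>R z) i < e") auto
    qed
    show "(\<lambda>z. indicator (EE i) ((1 / c) *\<^sub>R z) * f ((1 / c) *\<^sub>R z)) \<in> borel_measurable \<nu>"
      using cm fm by (rule measurable_compose)
    show "(\<lambda>z. f ((1 / c) *\<^sub>R z)) \<in> borel_measurable \<nu>"
      using cm f by (rule measurable_compose)
  qed
  thus ?thesis using integral_rescaled[OF i sets t fr] by simp
qed

lemma MRV_tendsto:
  fixes f :: "real ^ 'd::finite \<Rightarrow> real"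
  assumes M: "MRV \<alpha> b \<mu> i \<nu>" and i: "1 \<le> i" "i \<le> CARD('d)"
    and sets: "sets \<nu> = sets borel" and ae: "AE z in \<nu>. z \<in> orthant"
    and f: "continuous_on UNIV f" "\<And>z. \<bar>f z\<bar> \<le> C" and e: "0 < e" "\<And>z. order_stat z i < e \<Longrightarrow> f z = 0"
  shows "((\<lambda>t. t * (LINT z|\<nu>. f ((1 / b t) *\<^sub>R z))) \<longlongrightarrow> (LINT z|\<mu>. f z)) at_top"
proof -
  have tm: "tendsto_MM i (\<lambda>t. rescaled i t (b t) \<nu>) \<mu>" and rv: "b \<in> RV (1 / \<alpha>)"
    using M by (auto simp: MRV_def)
  have cont: "continuous_on (EE i) f" using f(1) by (rule continuous_on_subset) simp
  have bd: "bounded (f ` EE i)" using f(2) by (auto simp: bounded_iff)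
  have ba: "bounded_away {z \<in> EE i. f z \<noteq> 0} (CA (i - 1))"
  proof (subst bounded_away_CA_iff[OF i])
    show "{z \<in> EE i. f z \<noteq> 0} \<subseteq> orthant" using EE_subset_orthant by blast
    show "\<exists>e>0. \<forall>x\<in>{z \<in> EE i. f z \<noteq> 0}. e \<le> order_stat x i"
      using e by (intro exI[of _ e]) (auto simp: not_less[symmetric])
  qed
  have lim: "((\<lambda>t. LINT z|rescaled i t (b t) \<nu>. f z) \<longlongrightarrow> (LINT z|\<mu>. f z)) at_top"
    using tm cont bd ba unfolding tendsto_MM_def by blast
  have "\<forall>\<^sub>F t in at_top. (LINT z|rescaled i t (b t) \<nu>. f z) = t * (LINT z|\<nu>. f ((1 / b t) *\<^sub>R z))"
    using RV_eventually_pos[OF rv] eventually_ge_at_top[of 0]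
  proof eventually_elim
    case (elim t)
    show ?case
      by (rule integral_rescaled_vanishing[OF i sets ae elim(2,1) e(1)
        borel_measurable_continuous_onI[OF f(1)] e(2)])
  qed
  with lim show ?thesis by (rule Lim_transform_eventually)
qed

lemma MM_finite:
  fixes \<mu> :: "(real ^ 'd::finite) measure"
  assumes "\<mu> \<in> MM i" and i: "1 \<le> i" "i \<le> CARD('d)" and e: "0 < e"
  shows "EE i \<inter> upper i e \<in> sets \<mu>" and "emeasure \<mu> (EE i \<inter> upper i e) < \<infinity>"
    and "space \<mu> = EE i" and "sets \<mu> = sets (restrict_space borel (EE i))"
proof -
  show sets: "sets \<mu> = sets (restrict_space borel (EE i))" using assms by (simp add: MM_def)
  have "upper i e \<in> sets (borel :: (real ^ 'd) measure)" by (rule upper_borel[OF i])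
  thus S: "EE i \<inter> upper i e \<in> sets \<mu>" unfolding sets sets_restrict_space by blast
  show "space \<mu> = EE i" using sets_eq_imp_space_eq[OF sets] by (simp add: space_restrict_space)
  have sub: "EE i \<inter> upper i e \<subseteq> (orthant :: (real ^ 'd) set)" using EE_subset_orthant by blast
  have "bounded_away (EE i \<inter> upper i e :: (real ^ 'd) set) (CA (i - 1))"
    unfolding bounded_away_CA_iff[OF i sub] using e by (auto simp: upper_def)
  thus "emeasure \<mu> (EE i \<inter> upper i e) < \<infinity>" using assms S by (auto simp: MM_def)
qed

lemma MM_integrable:
  fixes \<mu> :: "(real ^ 'd::finite) measure" and f :: "real ^ 'd \<Rightarrow> real"
  assumes \<mu>: "\<mu> \<in> MM i" and i: "1 \<le> i" "i \<le> CARD('d)" and e: "0 < e"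
    and f: "f \<in> borel_measurable \<mu>" "\<And>z. z \<in> EE i \<Longrightarrow> \<bar>f z\<bar> \<le> C"
      "\<And>z. z \<in> EE i \<Longrightarrow> order_stat z i < e \<Longrightarrow> f z = 0"
  shows "integrable \<mu> f"
proof (rule Bochner_Integration.integrable_bound)
  note F = MM_finite[OF \<mu> i e]
  have "integrable \<mu> (indicator (EE i \<inter> upper i e) :: _ \<Rightarrow> real)"
    by (rule integrable_real_indicator[OF F(1,2)])
  thus "integrable \<mu> (\<lambda>z. C * indicator (EE i \<inter> upper i e) z)" by simp
  show "AE z in \<mu>. norm (f z) \<le> norm (C * indicator (EE i \<inter> upper i e) z)"
  proof (rule AE_I2)
    fix z assume "z \<in> space \<mu>"
    hence z: "z \<in> EE i" using F by simp
    show "norm (f z) \<le> norm (C * indicator (EE i \<inter> upper i e) z)"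
    proof (cases "order_stat z i < e")
      case True
      thus ?thesis using f(3)[OF z] by simp
    next
      case False
      thus ?thesis using z f(2)[OF z] by (simp add: upper_def)
    qed
  qed
qed (rule f(1))

text \<open>A non-null limit measure charges some set bounded away from \<open>CA (i - 1)\<close>; this is the source of the
lower tail bounds.\<close>

lemma MRV_exists_positive_ramp:
  fixes \<mu> :: "(real ^ 'd::finite) measure"
  assumes \<mu>: "\<mu> \<in> MM i" and i: "1 \<le> i" "i \<le> CARD('d)" and nz: "emeasure \<mu> (space \<mu>) \<noteq> 0"
  shows "\<exists>y>0. 0 < (LINT z|\<mu>. ramp i y z)"
proof -
  define A where "A n = (EE i \<inter> upper i (1 / real (Suc n)) :: (real ^ 'd) set)" for n
  have F: "A n \<in> sets \<mu>" "emeasure \<mu> (A n) < \<infinity>" "space \<mu> = EE i" for n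
    using MM_finite[OF \<mu> i, of "1 / real (Suc n)"] by (auto simp: A_def)
  have "EE i \<subseteq> (\<Union>n. A n)"
  proof
    fix z :: "real ^ 'd" assume z: "z \<in> EE i"
    hence "0 < order_stat z i" using EE_iff[OF i] by blast
    then obtain n where "1 / real (Suc n) < order_stat z i" by (rule nat_approx_posE)
    thus "z \<in> (\<Union>n. A n)" using z by (auto simp: A_def upper_def intro!: exI[of _ n])
  qed
  hence "emeasure \<mu> (space \<mu>) \<le> emeasure \<mu> (\<Union>n. A n)"
    using F by (intro emeasure_mono) auto
  hence "emeasure \<mu> (\<Union>n. A n) \<noteq> 0" using nz by auto
  then obtain n where n: "emeasure \<mu> (A n) \<noteq> 0"
    using F(1) emeasure_UN_eq_0[of \<mu> A] by auto
  define y where "y = 1 / real (Suc n)"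
  have y: "0 < y" by (simp add: y_def)
  have m: "(ramp i y :: real ^ 'd \<Rightarrow> real) \<in> borel_measurable \<mu>"
    unfolding measurable_cong_sets[OF MM_finite(4)[OF \<mu> i y] refl]
    by (intro measurable_restrict_space1 borel_measurable_continuous_onI ramp_continuous[OF i y])
  have int: "integrable \<mu> (ramp i y :: real ^ 'd \<Rightarrow> real)"
    using y ramp_bounds[of i y]
    by (intro MM_integrable[OF \<mu> i _ m, where C = 1 and e = "y / 2"]) (auto intro: ramp_eq_0 simp: abs_ramp)
  have "0 < measure \<mu> (A n)" using n F(2)[of n] by (simp add: measure_def enn2real_positive_iff zero_less_iff_neq_zero)
  also have "\<dots> = (LINT z|\<mu>. indicator (A n) z)"
    using F(1)[of n] sets.sets_into_space[OF F(1)[of n]] by (simp add: Int_absorb2)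
  also have "\<dots> \<le> (LINT z|\<mu>. ramp i y z)"
  proof (rule integral_mono[OF _ int])
    show "integrable \<mu> (indicator (A n) :: _ \<Rightarrow> real)" by (rule integrable_real_indicator[OF F(1,2)])
    show "indicator (A n) z \<le> ramp i y z" for z
      using indicator_le_ramp[OF y, of i z] ramp_bounds[of i y z] by (auto simp: A_def y_def indicator_def)
  qed
  finally show ?thesis using y by blast
qed

text \<open>A Gronwall-type argument along \<open>x, x / 4, x / 16, \<dots>\<close>: once \<open>k x * A\<close> is below \<open>1 / 2\<close>,
a bound with constant \<open>C\<close> at \<open>x / 4\<close> reproduces itself at \<open>x\<close> provided \<open>2 * B \<le> C\<close>.\<close>

lemma recursive_bound:
  fixes g T k :: "real \<Rightarrow> real"
  assumes T: "\<And>x. 0 < x \<Longrightarrow> 0 < T x" "\<And>x y. 0 < x \<Longrightarrow> x \<le> y \<Longrightarrow> T y \<le> T x"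
    and g: "\<And>x. g x \<le> 1" and k: "\<And>x. 0 < x \<Longrightarrow> 0 \<le> k x" "(k \<longlongrightarrow> 0) at_top"
    and rec: "\<forall>\<^sub>F x in at_top. g x \<le> B * T x + k x * g (x / 4)"
    and shrink: "\<forall>\<^sub>F x in at_top. T (x / 4) \<le> A * T x"
  shows "\<exists>C>0. \<forall>\<^sub>F x in at_top. g x \<le> C * T x"
proof -
  have "((\<lambda>x. k x * A) \<longlongrightarrow> 0 * A) at_top" by (intro tendsto_intros k)
  hence "\<forall>\<^sub>F x in at_top. k x * A < 1 / 2" by (rule order_tendstoD) simp
  with rec shrink have "\<forall>\<^sub>F x in at_top. g x \<le> B * T x + k x * g (x / 4) \<and> T (x / 4) \<le> A * T x \<and> k x * A < 1 / 2"
    by eventually_elim simp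
  then obtain x1 where x1: "\<And>x. x1 \<le> x \<Longrightarrow>
      g x \<le> B * T x + k x * g (x / 4) \<and> T (x / 4) \<le> A * T x \<and> k x * A < 1 / 2"
    unfolding eventually_at_top_linorder by blast
  define x0 where "x0 = max x1 1"
  have x0: "0 < x0" "x1 \<le> x0" by (auto simp: x0_def)
  define C where "C = max (2 * B) (1 / T x0)"
  have C: "2 * B \<le> C" "1 \<le> C * T x0" "0 < C"
  proof -
    have "1 / T x0 \<le> C" by (simp add: C_def)
    thus "1 \<le> C * T x0" using T(1)[OF x0(1)] by (simp add: field_simps)
    show "0 < C" using T(1)[OF x0(1)] unfolding C_def by (simp add: less_max_iff_disj)
  qed (simp add: C_def)
  have base: "g x \<le> C * T x" if "0 < x" "x \<le> x0" for x
  proof -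
    have "g x \<le> C * T x0" using g[of x] C by linarith
    also have "\<dots> \<le> C * T x" using C T(2)[OF that] by (intro mult_left_mono) auto
    finally show ?thesis .
  qed
  have ind: "0 < x \<Longrightarrow> x \<le> 4 ^ n * x0 \<Longrightarrow> g x \<le> C * T x" for n x
  proof (induction n arbitrary: x)
    case 0
    thus ?case using base by simp
  next
    case (Suc n)
    show ?case
    proof (cases "x \<le> x0")
      case True
      thus ?thesis using base Suc.prems by simp
    next
      case False
      hence x: "x1 \<le> x" "0 < x" using x0 by auto
      have "g (x / 4) \<le> C * T (x / 4)" using Suc by simp
      also have "\<dots> \<le> C * (A * T x)" using x1[OF x(1)] C by (intro mult_left_mono) auto
      finally have "k x * g (x / 4) \<le> k x * (C * (A * T x))" using k(1)[OF x(2)] by (intro mult_left_mono) auto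
      also have "\<dots> = (k x * A) * (C * T x)" by simp
      also have "\<dots> \<le> 1 / 2 * (C * T x)"
        using x1[OF x(1)] C T(1)[OF x(2)] by (intro mult_right_mono) auto
      finally have "g x \<le> B * T x + 1 / 2 * (C * T x)" using x1[OF x(1)] by simp
      moreover have "2 * B * T x \<le> C * T x" using C T(1)[OF x(2)] by (intro mult_right_mono) auto
      ultimately show ?thesis by simp
    qed
  qed
  have "g x \<le> C * T x" if "0 < x" for x
  proof -
    obtain n where "x / x0 < 4 ^ n" using real_arch_pow[of 4 "x / x0"] by auto
    hence "x \<le> 4 ^ n * x0" using x0 by (simp add: field_simps)
    thus ?thesis by (rule ind[OF that])
  qed
  hence "\<forall>\<^sub>F x in at_top. g x \<le> C * T x" by (intro eventually_mono[OF eventually_gt_at_top[of 0]])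
  thus ?thesis using C(3) by blast
qed

section \<open>Tails of a regularly varying Levy process\<close>

locale regular_levy = orthant_levy M L
  for M :: "'w measure" and L :: "real \<Rightarrow> 'w \<Rightarrow> real ^ 'd::finite" +
  fixes \<nu> :: "(real ^ 'd) measure" and \<alpha> :: "nat \<Rightarrow> real" and b :: "nat \<Rightarrow> real \<Rightarrow> real"
    and \<mu> :: "nat \<Rightarrow> (real ^ 'd) measure" and s :: real
  assumes levy_measure: "is_levy_measure M L \<nu>"
    and MRV: "1 \<le> i \<Longrightarrow> i \<le> CARD('d) \<Longrightarrow> MRV (\<alpha> i) (b i) (\<mu> i) i \<nu>"
    and subadd: "i \<le> CARD('d) \<Longrightarrow> 1 \<le> m \<Longrightarrow> m < i \<Longrightarrow> \<alpha> i < \<alpha> m + \<alpha> (i - m)"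
    and s_pos: "0 < s"
begin

lemma sets_\<nu>: "sets \<nu> = sets borel"
  using levy_measure by (simp add: is_levy_measure_def)

lemma AE_\<nu>_orthant: "AE z in \<nu>. z \<in> orthant"
  by (rule levy_measure_AE_orthant[OF levy_measure])

definition T :: "nat \<Rightarrow> real \<Rightarrow> real" where
  "T i x = measure \<nu> (upper i x)"

lemma T_antimono:
  assumes i: "1 \<le> i" "i \<le> CARD('d)" and "0 < x" "x \<le> y"
  shows "T i y \<le> T i x"
  unfolding T_def
proof (rule measure_mono_fmeasurable)
  show "upper i y \<subseteq> (upper i x :: (real ^ 'd) set)" using assms(4) by (auto simp: upper_def)
  show "(upper i y :: (real ^ 'd) set) \<in> sets \<nu>" using upper_borel[OF i] by (simp add: sets_\<nu>)
  show "upper i x \<in> fmeasurable \<nu>"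
    using upper_borel[OF i] integrable_levy_upper(2)[OF levy_measure i assms(3)]
    by (intro fmeasurableI) (simp_all add: sets_\<nu>)
qed

lemma integral_upper_scaled:
  assumes i: "1 \<le> i" "i \<le> CARD('d)" and c: "0 < c" and y: "0 < y"
  shows "(LINT z|\<nu>. indicator (upper i y) ((1 / c) *\<^sub>R z)) = T i (y * c)"
    and "integrable \<nu> (\<lambda>z. indicator (upper i y) ((1 / c) *\<^sub>R z) :: real)"
proof -
  have e: "(\<lambda>z. indicator (upper i y) ((1 / c) *\<^sub>R z) :: real) = indicator (upper i (y * c) :: (real ^ 'd) set)"
    using upper_scaleR[OF i c] by (auto simp: indicator_def fun_eq_iff)
  show "(LINT z|\<nu>. indicator (upper i y) ((1 / c) *\<^sub>R z)) = T i (y * c)"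
    unfolding e T_def using sets_eq_imp_space_eq[OF sets_\<nu>] by simp
  show "integrable \<nu> (\<lambda>z. indicator (upper i y) ((1 / c) *\<^sub>R z) :: real)"
    unfolding e using c y by (intro integrable_levy_upper[OF levy_measure i]) simp
qed

lemma integrable_ramp_scaled:
  assumes i: "1 \<le> i" "i \<le> CARD('d)" and c: "0 < c" and y: "0 < y"
  shows "integrable \<nu> (\<lambda>z. ramp i y ((1 / c) *\<^sub>R z))"
proof (rule Bochner_Integration.integrable_bound[OF integral_upper_scaled(2)[OF i c half_gt_zero[OF y]]])
  have "(\<lambda>z. (1 / c) *\<^sub>R z) \<in> measurable \<nu> borel"
    unfolding measurable_cong_sets[OF sets_\<nu> refl] by measurable
  thus "(\<lambda>z. ramp i y ((1 / c) *\<^sub>R z)) \<in> borel_measurable \<nu>"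
    using borel_measurable_continuous_onI[OF ramp_continuous[OF i y]] by (rule measurable_compose)
  show "AE z in \<nu>. norm (ramp i y ((1 / c) *\<^sub>R z)) \<le> norm (indicator (upper i (y / 2)) ((1 / c) *\<^sub>R z) :: real)"
    using ramp_le_indicator[OF y, of i] by (intro AE_I2) (simp add: abs_ramp)
qed

lemma ramp_scaled_bounds:
  assumes i: "1 \<le> i" "i \<le> CARD('d)" and c: "0 < c" and y: "0 < y"
  shows "T i (y * c) \<le> (LINT z|\<nu>. ramp i y ((1 / c) *\<^sub>R z))"
    and "(LINT z|\<nu>. ramp i y ((1 / c) *\<^sub>R z)) \<le> T i (y / 2 * c)"
proof -
  show "T i (y * c) \<le> (LINT z|\<nu>. ramp i y ((1 / c) *\<^sub>R z))"
    unfolding integral_upper_scaled(1)[OF i c y, symmetric]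
    by (intro integral_mono integral_upper_scaled(2)[OF i c y] integrable_ramp_scaled[OF i c y] indicator_le_ramp y)
  show "(LINT z|\<nu>. ramp i y ((1 / c) *\<^sub>R z)) \<le> T i (y / 2 * c)"
    unfolding integral_upper_scaled(1)[OF i c half_gt_zero[OF y], symmetric]
    by (intro integral_mono integral_upper_scaled(2)[OF i c half_gt_zero[OF y]]
        integrable_ramp_scaled[OF i c y] ramp_le_indicator y)
qed

text \<open>Ramp functions turn the convergence of integrals into two-sided bounds for the tail.\<close>

lemma tail_norming_T:
  assumes i: "1 \<le> i" "i \<le> CARD('d)"
  shows "tail_norming (T i) (b i) (\<alpha> i)"
proof
  note M = MRV[OF i]
  have rv: "b i \<in> RV (1 / \<alpha> i)" and mm: "\<mu> i \<in> MM i" "emeasure (\<mu> i) (space (\<mu> i)) \<noteq> 0"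
    using M by (auto simp: MRV_def)
  show "0 < \<alpha> i" using M by (simp add: MRV_def)
  show "b i \<in> RV (1 / \<alpha> i)" by (rule rv)
  show "0 \<le> T i x" for x by (simp add: T_def)
  show "T i y \<le> T i x" if "0 < x" "x \<le> y" for x y using that by (rule T_antimono[OF i])
  have lim: "((\<lambda>t. t * (LINT z|\<nu>. ramp i y ((1 / b i t) *\<^sub>R z))) \<longlongrightarrow> (LINT z|\<mu> i. ramp i y z)) at_top"
    if y: "0 < y" for y
    using y ramp_bounds[of i y]
    by (intro MRV_tendsto[OF M i sets_\<nu> AE_\<nu>_orthant ramp_continuous[OF i y], where C = 1 and e = "y / 2"])
       (auto intro: ramp_eq_0 simp: abs_ramp)
  show "\<exists>C. \<forall>\<^sub>F t in at_top. t * T i (e * b i t) \<le> C" if e: "0 < e" for e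
  proof
    have "\<forall>\<^sub>F t in at_top. t * (LINT z|\<nu>. ramp i e ((1 / b i t) *\<^sub>R z)) < (LINT z|\<mu> i. ramp i e z) + 1"
      by (rule order_tendstoD(2)[OF lim[OF e]]) simp
    with RV_eventually_pos[OF rv] eventually_ge_at_top[of 0]
    show "\<forall>\<^sub>F t in at_top. t * T i (e * b i t) \<le> (LINT z|\<mu> i. ramp i e z) + 1"
    proof eventually_elim
      case (elim t)
      have "t * T i (e * b i t) \<le> t * (LINT z|\<nu>. ramp i e ((1 / b i t) *\<^sub>R z))"
        using elim e by (intro mult_left_mono ramp_scaled_bounds(1)[OF i]) auto
      thus ?case using elim by simp
    qed
  qed
  obtain y where y: "0 < y" "0 < (LINT z|\<mu> i. ramp i y z)"
    using MRV_exists_positive_ramp[OF mm(1) i mm(2)] by blast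
  show "\<exists>e>0. \<exists>c>0. \<forall>\<^sub>F t in at_top. c \<le> t * T i (e * b i t)"
  proof (intro exI conjI)
    show "0 < y / 2" "0 < (LINT z|\<mu> i. ramp i y z) / 2" using y by auto
    have "\<forall>\<^sub>F t in at_top. (LINT z|\<mu> i. ramp i y z) / 2 < t * (LINT z|\<nu>. ramp i y ((1 / b i t) *\<^sub>R z))"
      using y by (intro order_tendstoD(1)[OF lim]) auto
    with RV_eventually_pos[OF rv] eventually_ge_at_top[of 0]
    show "\<forall>\<^sub>F t in at_top. (LINT z|\<mu> i. ramp i y z) / 2 \<le> t * T i (y / 2 * b i t)"
    proof eventually_elim
      case (elim t)
      have "t * (LINT z|\<nu>. ramp i y ((1 / b i t) *\<^sub>R z)) \<le> t * T i (y / 2 * b i t)"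
        using elim y by (intro mult_left_mono ramp_scaled_bounds(2)[OF i]) auto
      thus ?case using elim by simp
    qed
  qed
qed

lemma eventually_scaled: "0 < k \<Longrightarrow> eventually P at_top \<Longrightarrow> \<forall>\<^sub>F x in at_top. P (k * x :: real)"
proof -
  assume k: "0 < k" and P: "eventually P at_top"
  have "filterlim (\<lambda>x. k * x) at_top at_top"
    by (rule filterlim_tendsto_pos_mult_at_top[OF tendsto_const k filterlim_ident])
  with P show ?thesis by (rule eventually_compose_filterlim)
qed

lemma exceed_scaled:
  assumes i: "1 \<le> i" "i \<le> CARD('d)" and k: "0 < k"
    and C: "\<exists>C>0. \<forall>\<^sub>F x in at_top. exceed s i x \<le> C * T i x"
  shows "\<exists>C>0. \<forall>\<^sub>F x in at_top. exceed s i (k * x) \<le> C * T i x"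
proof -
  interpret T: tail_norming "T i" "b i" "\<alpha> i" by (rule tail_norming_T[OF i])
  obtain C where C: "0 < C" "\<forall>\<^sub>F x in at_top. exceed s i x \<le> C * T i x" using C by blast
  obtain A where A: "0 < A" "\<forall>\<^sub>F x in at_top. T i (k * x) \<le> A * T i x" using T.T_shrink[OF k] by blast
  have "\<forall>\<^sub>F x in at_top. exceed s i (k * x) \<le> C * A * T i x"
    using eventually_scaled[OF k C(2)] A(2)
  proof eventually_elim
    case (elim x)
    have "C * T i (k * x) \<le> C * (A * T i x)" using elim C by (intro mult_left_mono) auto
    thus ?case using elim by simp
  qed
  thus ?thesis using C A by (intro exI[of _ "C * A"]) auto
qed

text \<open>The only place where the condition on the indices enters: a jump with \<open>m\<close> large coordinates
together with \<open>i - m\<close> large coordinates from the rest of the path is of smaller order than one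
jump with \<open>i\<close> large coordinates.\<close>

lemma cross_term_negligible:
  assumes i: "i \<le> CARD('d)" and m: "1 \<le> m" "m < i" and k: "0 < k" "0 < l"
    and C: "\<exists>C>0. \<forall>\<^sub>F x in at_top. exceed s (i - m) x \<le> C * T (i - m) x"
  shows "((\<lambda>x. T m (k * x) * exceed s (i - m) (l * x) / T i x) \<longlongrightarrow> 0) at_top"
proof -
  have r: "1 \<le> i" "i \<le> CARD('d)" "1 \<le> m" "m \<le> CARD('d)" "1 \<le> i - m" "i - m \<le> CARD('d)"
    using i m by auto
  interpret T: tail_norming "T i" "b i" "\<alpha> i" by (rule tail_norming_T[OF r(1,2)])
  interpret Tm: tail_norming "T m" "b m" "\<alpha> m" by (rule tail_norming_T[OF r(3,4)])
  obtain A where A: "0 < A" "\<forall>\<^sub>F x in at_top. T m (k * x) \<le> A * T m x" using Tm.T_shrink[OF k(1)] by blast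
  obtain C where C: "0 < C" "\<forall>\<^sub>F x in at_top. exceed s (i - m) (l * x) \<le> C * T (i - m) x"
    using exceed_scaled[OF r(5,6) k(2) C] by blast
  have "((\<lambda>x. T m x * T (i - m) x / T i x) \<longlongrightarrow> 0) at_top"
    by (rule tail_product_negligible[OF tail_norming_T[OF r(1,2)] tail_norming_T[OF r(3,4)]
      tail_norming_T[OF r(5,6)] subadd[OF i m]])
  from tendsto_mult_right_zero[OF this, of "A * C"]
  have lim: "((\<lambda>x. (A * C) * (T m x * T (i - m) x / T i x)) \<longlongrightarrow> 0) at_top" .
  have hi: "\<forall>\<^sub>F x in at_top. T m (k * x) * exceed s (i - m) (l * x) / T i x \<le> (A * C) * (T m x * T (i - m) x / T i x)"
    using A(2) C(2) eventually_gt_at_top[of 0]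
  proof eventually_elim
    case (elim x)
    have "T m (k * x) * exceed s (i - m) (l * x) \<le> (A * T m x) * (C * T (i - m) x)"
      using elim A C by (intro mult_mono exceed_nonneg) (auto simp: T_def)
    hence "T m (k * x) * exceed s (i - m) (l * x) / T i x \<le> (A * T m x) * (C * T (i - m) x) / T i x"
      using T.T_pos[OF elim(3)] by (intro divide_right_mono) auto
    thus ?case by (simp add: mult_ac)
  qed
  have lo: "\<forall>\<^sub>F x in at_top. 0 \<le> T m (k * x) * exceed s (i - m) (l * x) / T i x"
    by (intro always_eventually allI divide_nonneg_nonneg mult_nonneg_nonneg exceed_nonneg) (auto simp: T_def)
  show ?thesis by (rule tendsto_sandwich[OF lo hi tendsto_const lim])
qed

text \<open>The error of the big jump comparison in terms of the tails, up to the constant of the test function.\<close>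

definition jump_error :: "nat \<Rightarrow> real \<Rightarrow> real \<Rightarrow> real" where
  "jump_error i e c = exceed s i (e / 2 * c) * smallness s c + (s * T i (e / 4 * c)) * smallness s c +
     (\<Sum>m\<in>{1..i-1}. (s * T m (e / 4 * c)) * exceed s (i - m) (e / 2 * c))"

lemma expectation_minus_levy_integral_le:
  fixes f :: "real ^ 'd \<Rightarrow> real"
  assumes i: "1 \<le> i" "i \<le> CARD('d)" and c: "0 < c" and e: "0 < e"
    and f: "\<And>z. \<bar>f z\<bar> \<le> C" "\<And>z w. \<bar>f z - f w\<bar> \<le> K * norm (z - w)"
      "\<And>z. order_stat z i < e \<Longrightarrow> f z = 0"
  shows "\<bar>expectation (\<lambda>\<omega>. f ((1 / c) *\<^sub>R L s \<omega>)) - s * (LINT z|\<nu>. f ((1 / c) *\<^sub>R z))\<bar> \<le>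
    (K + 3 * C + 6 * C / e) * jump_error i e c"
  using one_big_jump[OF levy_measure i s_pos c e f] by (simp add: jump_error_def T_def)

lemma jump_error_bound:
  assumes i: "1 \<le> i" "i \<le> CARD('d)" and e: "0 < e"
    and below: "\<And>m. 1 \<le> m \<Longrightarrow> m < i \<Longrightarrow> \<exists>C>0. \<forall>\<^sub>F x in at_top. exceed s m x \<le> C * T m x"
  shows "\<exists>\<rho>. (\<rho> \<longlongrightarrow> 0) at_top \<and>
    (\<forall>\<^sub>F x in at_top. jump_error i e x \<le> exceed s i (e / 2 * x) * smallness s x + \<rho> x * T i x)"
proof -
  interpret T: tail_norming "T i" "b i" "\<alpha> i" by (rule tail_norming_T[OF i])
  obtain A where A: "0 < A" "\<forall>\<^sub>F x in at_top. T i (e / 4 * x) \<le> A * T i x"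
    using T.T_shrink[of "e / 4"] e by auto
  define cross where
    "cross x = (\<Sum>m\<in>{1..i-1}. T m (e / 4 * x) * exceed s (i - m) (e / 2 * x) / T i x)" for x
  have "(cross \<longlongrightarrow> (\<Sum>m\<in>{1..i-1}. 0)) at_top"
    unfolding cross_def[abs_def]
  proof (rule tendsto_sum)
    fix m assume m: "m \<in> {1..i-1}"
    show "((\<lambda>x. T m (e / 4 * x) * exceed s (i - m) (e / 2 * x) / T i x) \<longlongrightarrow> 0) at_top"
      using m i e below[of "i - m"] by (intro cross_term_negligible) auto
  qed
  hence cross: "(cross \<longlongrightarrow> 0) at_top" by simp
  define \<rho> where "\<rho> x = s * A * smallness s x + s * cross x" for x
  have "(\<rho> \<longlongrightarrow> s * A * 0 + s * 0) at_top"
    unfolding \<rho>_def[abs_def] by (intro tendsto_intros smallness_tendsto_0 s_pos cross)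
  moreover have "\<forall>\<^sub>F x in at_top. jump_error i e x \<le> exceed s i (e / 2 * x) * smallness s x + \<rho> x * T i x"
    using A(2) eventually_gt_at_top[of 0]
  proof eventually_elim
    case (elim x)
    have "(\<Sum>m\<in>{1..i-1}. (s * T m (e / 4 * x)) * exceed s (i - m) (e / 2 * x)) = s * (cross x * T i x)"
      using T.T_pos[OF elim(2)] by (simp add: cross_def sum_distrib_left sum_distrib_right mult.assoc)
    moreover have "(s * T i (e / 4 * x)) * smallness s x \<le> (s * (A * T i x)) * smallness s x"
      using elim s_pos smallness_nonneg[OF elim(2) s_pos] by (intro mult_right_mono mult_left_mono) auto
    ultimately show ?case by (simp add: jump_error_def \<rho>_def algebra_simps)
  qed
  ultimately show ?thesis by auto
qed

text \<open>Induction on \<open>i\<close>. The comparison with a ramp function bounds the tail of \<open>L s\<close> by that of the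
Levy measure, plus cross terms covered by the induction hypothesis, plus a vanishing multiple of
the tail of \<open>L s\<close> itself at a smaller argument. The last term is absorbed by
\<open>recursive_bound\<close>.\<close>

theorem exceed_le_tail:
  "1 \<le> i \<Longrightarrow> i \<le> CARD('d) \<Longrightarrow> \<exists>C>0. \<forall>\<^sub>F x in at_top. exceed s i x \<le> C * T i x"
proof (induction i rule: less_induct)
  case (less i)
  note i = less.prems
  interpret T: tail_norming "T i" "b i" "\<alpha> i" by (rule tail_norming_T[OF i])
  \<comment> \<open>the comparison constant of \<open>ramp i 1\<close>: Lipschitz constant \<open>2\<close>, bound \<open>1\<close>, zero below \<open>1 / 2\<close>\<close>
  define D :: real where "D = 2 + 3 * 1 + 6 * 1 / (1 / 2)"
  have D: "0 < D" by (simp add: D_def)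
  obtain \<rho> where \<rho>: "(\<rho> \<longlongrightarrow> 0) at_top"
    "\<forall>\<^sub>F x in at_top. jump_error i (1 / 2) x \<le> exceed s i (1 / 2 / 2 * x) * smallness s x + \<rho> x * T i x"
    using jump_error_bound[OF i, of "1 / 2"] less.IH i by auto
  have small: "\<forall>\<^sub>F x in at_top. \<rho> x < 1"
    by (rule order_tendstoD(2)[OF \<rho>(1)]) simp
  obtain A1 where A1: "0 < A1" "\<forall>\<^sub>F x in at_top. T i (1 / 2 * x) \<le> A1 * T i x" using T.T_shrink[of "1/2"] by auto
  obtain A3 where A3: "0 < A3" "\<forall>\<^sub>F x in at_top. T i (1 / 4 * x) \<le> A3 * T i x" using T.T_shrink[of "1/4"] by auto
  define B where "B = s * A1 + D"
  show ?case
  proof (rule recursive_bound[where k = "\<lambda>x. D * smallness s x" and A = A3 and B = B])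
    show "0 < T i x" if "0 < x" for x using T.T_pos[OF that] .
    show "T i y \<le> T i x" if "0 < x" "x \<le> y" for x y using T_antimono[OF i that] .
    show "exceed s i x \<le> 1" for x
    proof -
      have "exceed s i x \<le> expectation (\<lambda>\<omega>. 1)"
        unfolding exceed_def
        using s_pos upper_borel[OF i, of x] by (intro integral_mono integrable_bounded_L[where C = 1]) (auto simp: indicator_def)
      thus ?thesis using prob_space by simp
    qed
    show "0 \<le> D * smallness s x" if "0 < x" for x using smallness_nonneg[OF that s_pos] D by simp
    show "((\<lambda>x. D * smallness s x) \<longlongrightarrow> 0) at_top"
      using tendsto_mult[OF tendsto_const smallness_tendsto_0[OF s_pos], of D] by simp
    show "\<forall>\<^sub>F x in at_top. T i (x / 4) \<le> A3 * T i x" using A3(2) by simp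
    show "\<forall>\<^sub>F x in at_top. exceed s i x \<le> B * T i x + D * smallness s x * exceed s i (x / 4)"
      using A1(2) \<rho>(2) small eventually_gt_at_top[of 0]
    proof eventually_elim
      case (elim x)
      have x: "0 < x" by (rule elim(4))
      have Tx: "0 < T i x" using T.T_pos[OF x] .
      have rb: "\<bar>ramp i 1 z\<bar> \<le> 1" for z :: "real ^ 'd" using ramp_bounds[of i 1 z] by simp
      have rl: "\<bar>ramp i 1 z - ramp i 1 w\<bar> \<le> 2 * norm (z - w)" for z w :: "real ^ 'd"
        using ramp_lipschitz[OF i, of 1 z w] by simp
      have rs: "ramp i 1 z = 0" if "order_stat z i < 1 / 2" for z :: "real ^ 'd"
        using that by (intro ramp_eq_0) auto
      have jump: "\<bar>expectation (\<lambda>\<omega>. ramp i 1 ((1 / x) *\<^sub>R L s \<omega>)) - s * (LINT z|\<nu>. ramp i 1 ((1 / x) *\<^sub>R z))\<bar> \<le>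
        D * jump_error i (1 / 2) x"
        unfolding D_def by (rule expectation_minus_levy_integral_le[OF i x _ rb rl rs]) simp
      have "exceed s i x \<le> expectation (\<lambda>\<omega>. ramp i 1 ((1 / x) *\<^sub>R L s \<omega>))"
        unfolding exceed_def
      proof (rule integral_mono)
        show "integrable M (\<lambda>\<omega>. indicator (upper i x) (L s \<omega>) :: real)"
          using s_pos upper_borel[OF i, of x] by (intro integrable_bounded_L[where C = 1]) (auto simp: indicator_def)
        have "(\<lambda>z. ramp i 1 ((1 / x) *\<^sub>R z)) \<in> borel_measurable (borel :: (real ^ 'd) measure)"
          by (rule measurable_compose[OF _ borel_measurable_continuous_onI[OF ramp_continuous[OF i]]]) auto
        thus "integrable M (\<lambda>\<omega>. ramp i 1 ((1 / x) *\<^sub>R L s \<omega>))"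
          using rb s_pos by (intro integrable_bounded_L[where f = "\<lambda>z. ramp i 1 ((1 / x) *\<^sub>R z)" and C = 1]) auto
        show "indicator (upper i x) (L s \<omega>) \<le> ramp i 1 ((1 / x) *\<^sub>R L s \<omega>)" for \<omega>
          using indicator_le_ramp[of 1 i "(1 / x) *\<^sub>R L s \<omega>"] upper_scaleR[OF i x, of "L s \<omega>" 1]
          by (simp add: indicator_def)
      qed
      also have "\<dots> \<le> s * (LINT z|\<nu>. ramp i 1 ((1 / x) *\<^sub>R z)) + D * jump_error i (1 / 2) x"
        using jump by linarith
      also have "\<dots> \<le> s * (A1 * T i x) + D * (exceed s i (x / 4) * smallness s x + 1 * T i x)"
      proof (intro add_mono mult_left_mono)
        have "(LINT z|\<nu>. ramp i 1 ((1 / x) *\<^sub>R z)) \<le> T i (1 / 2 * x)"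
          using ramp_scaled_bounds(2)[OF i x, of 1] by simp
        thus "(LINT z|\<nu>. ramp i 1 ((1 / x) *\<^sub>R z)) \<le> A1 * T i x" using elim(1) by simp
        have "\<rho> x * T i x \<le> 1 * T i x" using elim(3) Tx by (intro mult_right_mono) auto
        thus "jump_error i (1 / 2) x \<le> exceed s i (x / 4) * smallness s x + 1 * T i x"
          using elim(2) by simp
      qed (use s_pos D in auto)
      also have "\<dots> = B * T i x + D * smallness s x * exceed s i (x / 4)"
        by (simp add: B_def algebra_simps)
      finally show ?case .
    qed
  qed
qed

text \<open>The error of the comparison is of smaller order than \<open>T i c\<close>, and \<open>t * T i (b i t)\<close> stays
bounded. Hence \<open>L s\<close> inherits the limit of \<open>s * \<nu>\<close>.\<close>

theorem lipschitz_limit: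
  fixes f :: "real ^ 'd \<Rightarrow> real"
  assumes i: "1 \<le> i" "i \<le> CARD('d)" and e: "0 < e"
    and C: "\<And>z. \<bar>f z\<bar> \<le> C" and K: "\<And>z w. \<bar>f z - f w\<bar> \<le> K * norm (z - w)"
    and supp: "\<And>z. order_stat z i < e \<Longrightarrow> f z = 0"
  shows "((\<lambda>t. t * expectation (\<lambda>\<omega>. f ((1 / b i t) *\<^sub>R L s \<omega>))) \<longlongrightarrow> s * (LINT z|\<mu> i. f z)) at_top"
proof -
  interpret T: tail_norming "T i" "b i" "\<alpha> i" by (rule tail_norming_T[OF i])
  define D where "D = K + 3 * C + 6 * C / e"
  have D0: "0 \<le> D" unfolding D_def using e C K by (rule jump_constant_nonneg)
  define E where "E c = expectation (\<lambda>\<omega>. f ((1 / c) *\<^sub>R L s \<omega>))" for c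
  define J where "J c = (LINT z|\<nu>. f ((1 / c) *\<^sub>R z))" for c
  obtain A where A: "0 < A" "\<forall>\<^sub>F x in at_top. exceed s i (e / 2 * x) \<le> A * T i x"
    using exceed_scaled[OF i _ exceed_le_tail[OF i], of "e / 2"] e by auto
  obtain \<rho> where \<rho>: "(\<rho> \<longlongrightarrow> 0) at_top"
    "\<forall>\<^sub>F x in at_top. jump_error i e x \<le> exceed s i (e / 2 * x) * smallness s x + \<rho> x * T i x"
    using jump_error_bound[OF i e] exceed_le_tail i by auto
  define \<eta> where "\<eta> x = D * (A * smallness s x + \<rho> x)" for x
  have "(\<eta> \<longlongrightarrow> D * (A * 0 + 0)) at_top"
    unfolding \<eta>_def[abs_def] by (intro tendsto_intros smallness_tendsto_0 s_pos \<rho>)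
  hence \<eta>: "(\<eta> \<longlongrightarrow> 0) at_top" by simp
  have err: "\<forall>\<^sub>F x in at_top. \<bar>E x - s * J x\<bar> \<le> T i x * \<eta> x"
    using A(2) \<rho>(2) eventually_gt_at_top[of 0]
  proof eventually_elim
    case (elim x)
    have "\<bar>E x - s * J x\<bar> \<le> D * jump_error i e x"
      unfolding D_def E_def J_def by (rule expectation_minus_levy_integral_le[OF i elim(3) e C K supp])
    also have "\<dots> \<le> D * ((A * T i x) * smallness s x + \<rho> x * T i x)"
    proof (rule mult_left_mono[OF _ D0])
      have "exceed s i (e / 2 * x) * smallness s x \<le> (A * T i x) * smallness s x"
        using elim smallness_nonneg[OF elim(3) s_pos] by (intro mult_right_mono) auto
      thus "jump_error i e x \<le> (A * T i x) * smallness s x + \<rho> x * T i x" using elim by linarith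
    qed
    also have "\<dots> = T i x * \<eta> x" by (simp add: \<eta>_def algebra_simps)
    finally show ?case .
  qed
  obtain C' where C': "\<forall>\<^sub>F t in at_top. t * T i (1 * b i t) \<le> C'" using T.upper[of 1] by auto
  have \<eta>b: "((\<lambda>t. C' * \<bar>\<eta> (b i t)\<bar>) \<longlongrightarrow> C' * \<bar>0\<bar>) at_top"
    by (intro tendsto_intros filterlim_compose[OF \<eta> T.b_at_top])
  have diff: "((\<lambda>t. t * E (b i t) - s * (t * J (b i t))) \<longlongrightarrow> 0) at_top"
  proof (rule Lim_null_comparison)
    show "((\<lambda>t. C' * \<bar>\<eta> (b i t)\<bar>) \<longlongrightarrow> 0) at_top" using \<eta>b by simp
    show "\<forall>\<^sub>F t in at_top. norm (t * E (b i t) - s * (t * J (b i t))) \<le> C' * \<bar>\<eta> (b i t)\<bar>"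
      using C' eventually_ge_at_top[of 0] eventually_compose_filterlim[OF err T.b_at_top]
    proof eventually_elim
      case (elim t)
      have "t * E (b i t) - s * (t * J (b i t)) = t * (E (b i t) - s * J (b i t))"
        by (simp add: algebra_simps)
      hence "norm (t * E (b i t) - s * (t * J (b i t))) = t * \<bar>E (b i t) - s * J (b i t)\<bar>"
        using elim(2) by (simp only: real_norm_def abs_mult abs_of_nonneg)
      also have "\<dots> \<le> t * (T i (b i t) * \<eta> (b i t))"
        using elim by (intro mult_left_mono) auto
      also have "\<dots> \<le> (t * T i (b i t)) * \<bar>\<eta> (b i t)\<bar>"
        unfolding mult.assoc[symmetric] using elim by (intro mult_left_mono) (auto simp: T_def)
      also have "\<dots> \<le> C' * \<bar>\<eta> (b i t)\<bar>" using elim by (intro mult_right_mono) auto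
      finally show ?case .
    qed
  qed
  have main: "((\<lambda>t. s * (t * J (b i t))) \<longlongrightarrow> s * (LINT z|\<mu> i. f z)) at_top"
    unfolding J_def by (intro tendsto_intros MRV_tendsto[OF MRV[OF i] i sets_\<nu> AE_\<nu>_orthant
      continuous_on_of_lipschitz_bound[OF K] C e supp])
  show ?thesis using tendsto_add[OF diff main] by (simp add: E_def)
qed

end

section \<open>From Lipschitz to continuous test functions\<close>

text \<open>A 1-Lipschitz retraction onto the orthant. Composition with it extends test functions to
the whole space so that they still vanish wherever the order statistic in question is small.\<close>

definition positive_part :: "real ^ 'd::finite \<Rightarrow> real ^ 'd" where
  "positive_part z = (\<chi> j. max 0 (z $ j))"

lemma positive_part_orthant: "positive_part z \<in> orthant"
  by (simp add: positive_part_def orthant_def)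

lemma positive_part_eq: "z \<in> orthant \<Longrightarrow> positive_part z = z"
  by (simp add: positive_part_def orthant_def vec_eq_iff)

lemma dist_positive_part: "dist (positive_part z) (positive_part w) \<le> dist z w"
  unfolding dist_norm
  by (rule norm_le_componentwise_cart) (auto simp: positive_part_def max_def)

lemma order_stat_positive_part:
  fixes z :: "real ^ 'd::finite"
  assumes i: "1 \<le> i" "i \<le> CARD('d)" and e: "0 < e"
  shows "order_stat (positive_part z) i < e \<longleftrightarrow> order_stat z i < e"
proof -
  have "{j. e \<le> positive_part z $ j} = {j. e \<le> z $ j}" using e by (auto simp: positive_part_def)
  thus ?thesis using order_stat_ge_iff[OF i, of e] by (simp add: not_le[symmetric])
qed

text \<open>The greatest \<open>k\<close>-Lipschitz function below \<open>g\<close> on the orthant.\<close>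

definition inf_convolution :: "real \<Rightarrow> (real ^ 'd::finite \<Rightarrow> real) \<Rightarrow> real ^ 'd \<Rightarrow> real" where
  "inf_convolution k g z = (INF w\<in>orthant. g w + k * dist z w)"

context
  fixes g :: "real ^ 'd::finite \<Rightarrow> real" and k :: real
  assumes g: "\<And>z. 0 \<le> g z" and k: "0 \<le> k"
begin

lemma zero_orthant: "0 \<in> (orthant :: (real ^ 'd) set)"
  by (simp add: orthant_def)

lemma inf_convolution_bdd: "bdd_below ((\<lambda>w. g w + k * dist z w) ` orthant)"
  using g k by (intro bdd_belowI2[where m = 0]) simp

lemma inf_convolution_lower: "w \<in> orthant \<Longrightarrow> inf_convolution k g z \<le> g w + k * dist z w"
  unfolding inf_convolution_def by (rule cINF_lower[OF inf_convolution_bdd])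

lemma inf_convolution_greatest:
  "(\<And>w. w \<in> orthant \<Longrightarrow> c \<le> g w + k * dist z w) \<Longrightarrow> c \<le> inf_convolution k g z"
  unfolding inf_convolution_def using zero_orthant by (intro cINF_greatest) auto

lemma inf_convolution_le: "z \<in> orthant \<Longrightarrow> inf_convolution k g z \<le> g z"
  using inf_convolution_lower[of z z] by simp

lemma inf_convolution_nonneg: "0 \<le> inf_convolution k g z"
  using g k by (intro inf_convolution_greatest) simp

lemma inf_convolution_lipschitz: "\<bar>inf_convolution k g z - inf_convolution k g w\<bar> \<le> k * dist z w"
proof -
  have "inf_convolution k g z - k * dist z w \<le> inf_convolution k g w" for z w
  proof (rule inf_convolution_greatest)
    fix v :: "real ^ 'd" assume "v \<in> orthant"
    hence "inf_convolution k g z \<le> g v + k * dist z v" by (rule inf_convolution_lower)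
    also have "k * dist z v \<le> k * (dist z w + dist w v)" using k by (intro mult_left_mono dist_triangle)
    finally show "inf_convolution k g z - k * dist z w \<le> g v + k * dist w v" by (simp add: algebra_simps)
  qed
  from this[of z w] this[of w z] show ?thesis by (simp add: dist_commute)
qed

lemma inf_convolution_ge:
  assumes "\<And>w. w \<in> orthant \<Longrightarrow> dist z w < \<delta> \<Longrightarrow> g z - r \<le> g w" and "g z - r \<le> k * \<delta>"
  shows "g z - r \<le> inf_convolution k g z"
proof (rule inf_convolution_greatest)
  fix w :: "real ^ 'd" assume w: "w \<in> orthant"
  show "g z - r \<le> g w + k * dist z w"
  proof (cases "dist z w < \<delta>")
    case True
    have "0 \<le> k * dist z w" using k by simp
    thus ?thesis using assms(1)[OF w True] by linarith
  next
    case False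
    hence "k * \<delta> \<le> k * dist z w" using k by (intro mult_left_mono) auto
    thus ?thesis using assms(2) g[of w] by linarith
  qed
qed

end

text \<open>A nonnegative continuous \<open>g\<close> is the pointwise limit from below of its inf-convolutions, which are
Lipschitz and vanish wherever \<open>g\<close> does. Their integrals therefore bound the lower limit of the
integrals of \<open>g\<close>.\<close>

lemma eventually_integral_gt_of_lipschitz_limits:
  fixes N :: "real \<Rightarrow> (real ^ 'd::finite) measure" and g :: "real ^ 'd \<Rightarrow> real"
  assumes i: "1 \<le> i" "i \<le> CARD('d)" and \<mu>: "\<mu> \<in> MM i" and N: "\<forall>\<^sub>F t in F. N t \<in> MM i"
    and lip: "\<And>f C K e. 0 < e \<Longrightarrow> (\<And>z. \<bar>f z\<bar> \<le> C) \<Longrightarrow> (\<And>z w. \<bar>f z - f w\<bar> \<le> K * norm (z - w)) \<Longrightarrow>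
      (\<And>z. order_stat z i < e \<Longrightarrow> f z = 0) \<Longrightarrow> ((\<lambda>t. LINT z|N t. f z) \<longlongrightarrow> (LINT z|\<mu>. f z)) F"
    and g: "continuous_on (EE i) g" "\<And>z. z \<in> EE i \<Longrightarrow> 0 \<le> g z" "\<And>z. z \<in> EE i \<Longrightarrow> g z \<le> C"
      "\<And>z. z \<in> EE i \<Longrightarrow> order_stat z i < e \<Longrightarrow> g z = 0"
    and e: "0 < e" and r: "0 < r"
  shows "\<forall>\<^sub>F t in F. (LINT z|\<mu>. g z) - r < (LINT z|N t. g z)"
proof -
  define C' where "C' = max C 0"
  have C': "C \<le> C'" "0 \<le> C'" by (auto simp: C'_def)
  define G where "G z = (if z \<in> EE i then g z else 0)" for z
  have G: "0 \<le> G z" "G z \<le> C'" for z using g(2,3)[of z] C' by (auto simp: G_def)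
  have G0: "G z = 0" if "order_stat z i < e" for z using g(4) that by (auto simp: G_def)
  define f where "f n z = inf_convolution (real n) G (positive_part z)" for n z
  have fl: "\<bar>f n z - f n w\<bar> \<le> real n * norm (z - w)" for n z w
  proof -
    have "\<bar>f n z - f n w\<bar> \<le> real n * dist (positive_part z) (positive_part w)"
      unfolding f_def by (rule inf_convolution_lipschitz[OF G(1)]) simp
    also have "\<dots> \<le> real n * dist z w" by (intro mult_left_mono dist_positive_part) simp
    finally show ?thesis by (simp add: dist_norm)
  qed
  have f0: "0 \<le> f n z" for n z unfolding f_def by (rule inf_convolution_nonneg[OF G(1)]) simp
  have fG: "f n z \<le> G (positive_part z)" for n z
    unfolding f_def by (rule inf_convolution_le[OF G(1) _ positive_part_orthant]) simp
  have fb: "\<bar>f n z\<bar> \<le> C'" for n z using f0[of n z] order_trans[OF fG G(2), of n z] by simp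
  have fs: "f n z = 0" if "order_stat z i < e" for n z
    using fG[of n z] f0[of n z] G0[of "positive_part z"] order_stat_positive_part[OF i e] that by simp
  have fg: "f n z \<le> g z" if z: "z \<in> EE i" for n z
  proof -
    have "z \<in> orthant" using z EE_subset_orthant by blast
    thus ?thesis using fG[of n z] z by (simp add: G_def positive_part_eq)
  qed
  have flim: "(\<lambda>n. f n z) \<longlonglongrightarrow> g z" if z: "z \<in> EE i" for z
  proof (rule LIMSEQ_I)
    fix \<eta> :: real assume \<eta>: "0 < \<eta>"
    have zo: "z \<in> orthant" and zp: "0 < order_stat z i" using z EE_iff[OF i] by auto
    obtain d where d: "0 < d" "\<And>w. w \<in> EE i \<Longrightarrow> dist w z < d \<Longrightarrow> dist (g w) (g z) < \<eta> / 2"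
      using g(1) z half_gt_zero[OF \<eta>] unfolding continuous_on_iff by blast
    define \<delta> where "\<delta> = min d (order_stat z i)"
    have \<delta>: "0 < \<delta>" using d zp by (simp add: \<delta>_def)
    have near: "G z - \<eta> / 2 \<le> G w" if w: "w \<in> orthant" "dist z w < \<delta>" for w
    proof -
      have "0 < order_stat w i"
        using order_stat_lipschitz[OF i, of z w] w(2) unfolding \<delta>_def dist_norm by linarith
      hence wE: "w \<in> EE i" using w(1) EE_iff[OF i] by blast
      moreover have "dist (g w) (g z) < \<eta> / 2" using w(2) by (intro d(2)[OF wE]) (simp add: \<delta>_def dist_commute)
      moreover have "G z = g z" "G w = g w" using z wE by (simp_all add: G_def)
      ultimately show ?thesis unfolding dist_real_def by linarith
    qed
    obtain n0 where n0: "C' / \<delta> < real n0" using reals_Archimedean2 by blast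
    have "norm (f n z - g z) < \<eta>" if n: "n0 \<le> n" for n
    proof -
      have "C' / \<delta> < real n" using n0 n by linarith
      hence "G z - \<eta> / 2 \<le> real n * \<delta>" using \<delta> \<eta> G(2)[of z] by (simp add: field_simps)
      hence "G z - \<eta> / 2 \<le> inf_convolution (real n) G z"
        by (intro inf_convolution_ge[where \<delta> = \<delta>] G(1) near) auto
      hence "g z - \<eta> / 2 \<le> f n z" using z positive_part_eq[OF zo] by (simp add: G_def f_def)
      thus ?thesis using fg[OF z, of n] \<eta> by (simp add: abs_less_iff)
    qed
    thus "\<exists>n0. \<forall>n\<ge>n0. norm (f n z - g z) < \<eta>" by blast
  qed
  have gm: "g \<in> borel_measurable \<rho>" if "\<rho> \<in> MM i" for \<rho>
    using borel_measurable_EE[OF i g(1)] measurable_cong_sets[OF MM_finite(4)[OF that i e] refl] by blast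
  have fm: "f n \<in> borel_measurable \<rho>" if "\<rho> \<in> MM i" for n \<rho>
    unfolding measurable_cong_sets[OF MM_finite(4)[OF that i e] refl]
    by (intro measurable_restrict_space1 borel_measurable_continuous_onI continuous_on_of_lipschitz_bound[OF fl])
  have gi: "integrable \<rho> g" if "\<rho> \<in> MM i" for \<rho>
    using g C' by (intro MM_integrable[OF that i e gm[OF that], where C = C']) (auto intro: order_trans)
  have fi: "integrable \<rho> (f n)" if "\<rho> \<in> MM i" for n \<rho>
    using fb fs by (intro MM_integrable[OF that i e fm[OF that], where C = C']) auto
  have "(\<lambda>n. LINT z|\<mu>. f n z) \<longlonglongrightarrow> (LINT z|\<mu>. g z)"
  proof (rule integral_dominated_convergence[where w = g])
    show "AE z in \<mu>. (\<lambda>n. f n z) \<longlonglongrightarrow> g z"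
      using flim MM_finite(3)[OF \<mu> i e] by (intro AE_I2) simp
    show "AE z in \<mu>. norm (f n z) \<le> g z" for n
      using fg f0 MM_finite(3)[OF \<mu> i e] by (intro AE_I2) simp
  qed (use gm fm gi \<mu> in auto)
  hence "\<forall>\<^sub>F n in sequentially. (LINT z|\<mu>. g z) - r / 2 < (LINT z|\<mu>. f n z)"
    using r by (intro order_tendstoD(1)) auto
  then obtain n where n: "(LINT z|\<mu>. g z) - r / 2 < (LINT z|\<mu>. f n z)"
    using eventually_happens'[OF sequentially_bot] by blast
  have "\<forall>\<^sub>F t in F. (LINT z|\<mu>. f n z) - r / 2 < (LINT z|N t. f n z)"
    using r by (intro order_tendstoD(1)[OF lip[OF e fb fl fs]]) auto
  with N show ?thesis
  proof eventually_elim
    case (elim t)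
    have "(LINT z|N t. f n z) \<le> (LINT z|N t. g z)"
      using MM_finite(3)[OF elim(1) i e] fg by (intro integral_mono gi fi elim) auto
    thus ?case using elim n by linarith
  qed
qed

text \<open>Let \<open>\<psi>\<close> be a ramp that equals \<open>1\<close> on the support of \<open>f\<close>, and let \<open>C\<close> bound \<open>f\<close>. The lower bound applies to the nonnegative functions
\<open>C * \<psi> + f\<close> and \<open>C * \<psi> - f\<close>; since the integrals of the Lipschitz function \<open>\<psi>\<close>
converge, this gives lower and upper bounds for the integrals of \<open>f\<close>.\<close>

theorem tendsto_MM_of_lipschitz_limits:
  fixes N :: "real \<Rightarrow> (real ^ 'd::finite) measure"
  assumes i: "1 \<le> i" "i \<le> CARD('d)" and \<mu>: "\<mu> \<in> MM i" and N: "\<forall>\<^sub>F t in at_top. N t \<in> MM i"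
    and lip: "\<And>f C K e. 0 < e \<Longrightarrow> (\<And>z. \<bar>f z\<bar> \<le> C) \<Longrightarrow> (\<And>z w. \<bar>f z - f w\<bar> \<le> K * norm (z - w)) \<Longrightarrow>
      (\<And>z. order_stat z i < e \<Longrightarrow> f z = 0) \<Longrightarrow> ((\<lambda>t. LINT z|N t. f z) \<longlongrightarrow> (LINT z|\<mu>. f z)) at_top"
  shows "tendsto_MM i N \<mu>"
  unfolding tendsto_MM_def
proof (intro conjI allI impI N \<mu>)
  fix f :: "real ^ 'd \<Rightarrow> real"
  assume f: "continuous_on (EE i) f" "bounded (f ` EE i)" and ba: "bounded_away {z \<in> EE i. f z \<noteq> 0} (CA (i - 1))"
  obtain C where C: "\<And>z. z \<in> EE i \<Longrightarrow> \<bar>f z\<bar> \<le> C" using f(2) by (auto simp: bounded_iff)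
  have sub: "{z \<in> EE i. f z \<noteq> 0} \<subseteq> orthant" using EE_subset_orthant by blast
  obtain e where e: "0 < e" "\<And>z. z \<in> EE i \<Longrightarrow> f z \<noteq> 0 \<Longrightarrow> e \<le> order_stat z i"
    using ba unfolding bounded_away_CA_iff[OF i sub] by blast
  define \<psi> where "\<psi> z = ramp i e z" for z :: "real ^ 'd"
  have e2: "0 < e / 2" using e by simp
  have \<psi>1: "\<psi> z = 1" if "e \<le> order_stat z i" for z
    using indicator_le_ramp[OF e(1), of i z] ramp_bounds[of i e z] that by (simp add: \<psi>_def upper_def)
  have \<psi>0: "\<psi> z = 0" if "order_stat z i < e / 2" for z
    unfolding \<psi>_def by (rule ramp_eq_0[OF e(1) that])
  have \<psi>b: "0 \<le> \<psi> z" "\<psi> z \<le> 1" for z using ramp_bounds by (auto simp: \<psi>_def)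
  have \<psi>c: "continuous_on A \<psi>" for A
    unfolding \<psi>_def by (rule ramp_continuous[OF i e(1)])
  have \<psi>lim: "((\<lambda>t. LINT z|N t. \<psi> z) \<longlongrightarrow> (LINT z|\<mu>. \<psi> z)) at_top"
    by (rule lip[of "e / 2" _ 1 "2 / e"])
       (use e2 ramp_lipschitz[OF i e(1)] ramp_bounds[of i e] \<psi>0 in \<open>auto simp: \<psi>_def abs_ramp\<close>)
  have f0: "f z = 0" if "z \<in> EE i" "order_stat z i < e / 2" for z using e(2)[OF that(1)] that(2) e(1) by force
  have key: "0 \<le> C * \<psi> z + \<sigma> * f z \<and> C * \<psi> z + \<sigma> * f z \<le> 2 * C" if "z \<in> EE i" "\<bar>\<sigma>\<bar> = 1" for z \<sigma>
  proof (cases "e \<le> order_stat z i")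
    case True
    have "\<bar>\<sigma> * f z\<bar> \<le> C" using C[OF that(1)] that(2) by (simp add: abs_mult)
    thus ?thesis using \<psi>1[OF True] by (simp add: abs_le_iff)
  next
    case False
    hence "f z = 0" using e(2)[OF that(1)] by blast
    moreover have "0 \<le> C" using C[OF that(1)] by linarith
    ultimately show ?thesis using \<psi>b[of z] by (simp add: mult_left_le order_trans[of _ C])
  qed
  have low: "\<forall>\<^sub>F t in at_top. (LINT z|\<mu>. C * \<psi> z + \<sigma> * f z) - r < (LINT z|N t. C * \<psi> z + \<sigma> * f z)"
    if \<sigma>: "\<bar>\<sigma>\<bar> = 1" and r: "0 < r" for \<sigma> r
  proof (rule eventually_integral_gt_of_lipschitz_limits[OF i \<mu> N lip, where C = "2 * C"])
    show "continuous_on (EE i) (\<lambda>z. C * \<psi> z + \<sigma> * f z)" by (intro continuous_intros \<psi>c f(1))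
    show "0 \<le> C * \<psi> z + \<sigma> * f z" "C * \<psi> z + \<sigma> * f z \<le> 2 * C" if "z \<in> EE i" for z
      using key[OF that \<sigma>] by auto
    show "C * \<psi> z + \<sigma> * f z = 0" if "z \<in> EE i" "order_stat z i < e / 2" for z
      using f0[OF that] \<psi>0[OF that(2)] by simp
  qed (use e2 r in auto)
  have int: "integrable \<rho> \<psi>" "integrable \<rho> f" if \<rho>: "\<rho> \<in> MM i" for \<rho>
  proof -
    note meas = measurable_cong_sets[OF MM_finite(4)[OF \<rho> i e(1)] refl]
    have "\<psi> \<in> borel_measurable \<rho>" "f \<in> borel_measurable \<rho>"
      using borel_measurable_EE[OF i \<psi>c] borel_measurable_EE[OF i f(1)] unfolding meas by auto
    thus "integrable \<rho> \<psi>" "integrable \<rho> f"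
      using \<psi>b \<psi>0 f0 C by (auto intro!: MM_integrable[OF \<rho> i e2])
  qed
  have lin: "(LINT z|\<rho>. C * \<psi> z + \<sigma> * f z) = C * (LINT z|\<rho>. \<psi> z) + \<sigma> * (LINT z|\<rho>. f z)"
    if "\<rho> \<in> MM i" for \<rho> \<sigma> using int[OF that] by simp
  have C\<psi>: "((\<lambda>t. C * (LINT z|N t. \<psi> z)) \<longlongrightarrow> C * (LINT z|\<mu>. \<psi> z)) at_top"
    by (intro tendsto_intros \<psi>lim)
  show "((\<lambda>t. LINT z|N t. f z) \<longlongrightarrow> (LINT z|\<mu>. f z)) at_top"
  proof (rule tendstoI)
    fix r :: real assume r: "0 < r"
    have "\<forall>\<^sub>F t in at_top. dist (C * (LINT z|N t. \<psi> z)) (C * (LINT z|\<mu>. \<psi> z)) < r / 2"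
      using r by (intro tendstoD[OF C\<psi>]) simp
    moreover note N
    moreover have "\<forall>\<^sub>F t in at_top. (LINT z|\<mu>. C * \<psi> z + 1 * f z) - r / 2 < (LINT z|N t. C * \<psi> z + 1 * f z)"
      using r by (intro low) auto
    moreover have "\<forall>\<^sub>F t in at_top. (LINT z|\<mu>. C * \<psi> z + (-1) * f z) - r / 2 < (LINT z|N t. C * \<psi> z + (-1) * f z)"
      using r by (intro low) auto
    ultimately show "\<forall>\<^sub>F t in at_top. dist (LINT z|N t. f z) (LINT z|\<mu>. f z) < r"
    proof eventually_elim
      case (elim t)
      show ?case using elim(1,3,4) unfolding lin[OF \<mu>] lin[OF elim(2)] dist_real_def by linarith
    qed
  qed
qed

section \<open>Regular variation of the process\<close>

lemma rescaled_prob_in_MM: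
  fixes \<nu> :: "(real ^ 'd::finite) measure"
  assumes i: "1 \<le> i" "i \<le> CARD('d)" and \<nu>: "prob_space \<nu>" "sets \<nu> = sets borel"
  shows "rescaled i t c \<nu> \<in> MM i"
proof -
  interpret prob_space \<nu> by fact
  have EEb: "EE i \<in> sets (borel :: (real ^ 'd) measure)" by (rule EE_borel[OF i])
  have cm: "(\<lambda>z. z /\<^sub>R c) \<in> measurable \<nu> borel"
    unfolding measurable_cong_sets[OF \<nu>(2) refl] by measurable
  interpret D: prob_space "distr \<nu> borel (\<lambda>z. z /\<^sub>R c)" by (rule prob_space_distr[OF cm])
  have sets: "sets (rescaled i t c \<nu>) = sets (restrict_space borel (EE i))"
    unfolding rescaled_def sets_scale_measure by (rule sets_restrict_space_cong) simp
  have "emeasure (rescaled i t c \<nu>) B < \<infinity>" if B: "B \<in> sets (rescaled i t c \<nu>)" for B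
  proof -
    have "B \<subseteq> EE i" using B unfolding sets sets_restrict_space by auto
    hence "emeasure (rescaled i t c \<nu>) B = ennreal t * emeasure (distr \<nu> borel (\<lambda>z. z /\<^sub>R c)) B"
      using EEb by (simp add: rescaled_def emeasure_restrict_space)
    moreover have "emeasure (distr \<nu> borel (\<lambda>z. z /\<^sub>R c)) B < top"
      using D.emeasure_finite[of B] less_top by blast
    ultimately show ?thesis by (simp only: ennreal_mult_less_top infinity_ennreal_def) simp
  qed
  thus ?thesis using sets by (simp add: MM_def)
qed

lemma scale_measure_in_MM: "\<mu> \<in> MM i \<Longrightarrow> scale_measure (ennreal s) \<mu> \<in> MM i"
  by (auto simp: MM_def ennreal_mult_less_top)

theorem (in regular_levy) MRV_L:
  assumes i: "1 \<le> i" "i \<le> CARD('d)"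
  shows "MRV (\<alpha> i) (b i) (scale_measure (ennreal s) (\<mu> i)) i (distr M borel (L s))"
proof -
  note mrv = MRV[OF i]
  have m: "L s \<in> borel_measurable M" using s_pos by (intro measurable_L) simp
  have mm: "\<mu> i \<in> MM i" and rv: "b i \<in> RV (1 / \<alpha> i)" using mrv by (auto simp: MRV_def)
  interpret D: prob_space "distr M borel (L s)" by (rule prob_space_distr[OF m])
  have ae: "AE z in distr M borel (L s). z \<in> orthant"
    using L_orthant[of s] s_pos by (subst AE_distr_iff[OF m]) (auto simp: orthant_borel)
  have "tendsto_MM i (\<lambda>t. rescaled i t (b i t) (distr M borel (L s))) (scale_measure (ennreal s) (\<mu> i))"
  proof (rule tendsto_MM_of_lipschitz_limits[OF i scale_measure_in_MM[OF mm]])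
    show "\<forall>\<^sub>F t in at_top. rescaled i t (b i t) (distr M borel (L s)) \<in> MM i"
      by (intro always_eventually allI rescaled_prob_in_MM[OF i D.prob_space_axioms]) simp
  next
    fix f :: "real ^ 'd \<Rightarrow> real" and C K e
    assume f: "0 < e" "\<And>z. \<bar>f z\<bar> \<le> C" "\<And>z w. \<bar>f z - f w\<bar> \<le> K * norm (z - w)"
      "\<And>z. order_stat z i < e \<Longrightarrow> f z = 0"
    have fm: "f \<in> borel_measurable borel"
      using continuous_on_of_lipschitz_bound[OF f(3)] by (rule borel_measurable_continuous_onI)
    have "f \<in> borel_measurable (\<mu> i)"
      unfolding measurable_cong_sets[OF MM_finite(4)[OF mm i f(1)] refl]
      using fm by (rule measurable_restrict_space1)
    hence eq: "(LINT z|scale_measure (ennreal s) (\<mu> i). f z) = s * (LINT z|\<mu> i. f z)"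
      using s_pos by (intro integral_scale_measure) auto
    have "\<forall>\<^sub>F t in at_top. t * expectation (\<lambda>\<omega>. f ((1 / b i t) *\<^sub>R L s \<omega>)) =
        (LINT z|rescaled i t (b i t) (distr M borel (L s)). f z)"
      using RV_eventually_pos[OF rv] eventually_ge_at_top[of 0]
    proof eventually_elim
      case (elim t)
      have "(LINT z|rescaled i t (b i t) (distr M borel (L s)). f z) =
          t * (LINT z|distr M borel (L s). f ((1 / b i t) *\<^sub>R z))"
        by (rule integral_rescaled_vanishing[OF i _ ae elim(2) elim(1) f(1) fm f(4)]) simp
      also have "(LINT z|distr M borel (L s). f ((1 / b i t) *\<^sub>R z)) = expectation (\<lambda>\<omega>. f ((1 / b i t) *\<^sub>R L s \<omega>))"
        by (rule integral_distr[OF m]) (rule measurable_compose[OF _ fm], measurable)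
      finally show ?case by simp
    qed
    with lipschitz_limit[OF i f]
    show "((\<lambda>t. LINT z|rescaled i t (b i t) (distr M borel (L s)). f z) \<longlongrightarrow>
        (LINT z|scale_measure (ennreal s) (\<mu> i). f z)) at_top"
      unfolding eq by (rule Lim_transform_eventually)
  qed
  thus ?thesis using mrv s_pos scale_measure_in_MM[OF mm]
    by (simp add: MRV_def space_scale_measure)
qed

theorem proposition5p1:
  fixes M :: "'w measure"
    and L :: "real \<Rightarrow> 'w \<Rightarrow> real ^ 'd::finite"
    and \<nu> :: "(real ^ 'd) measure"
    and \<nu>\<^sub>m :: "'d \<Rightarrow> real measure"
    and \<alpha> :: "nat \<Rightarrow> real"
    and b :: "nat \<Rightarrow> real \<Rightarrow> real"
    and \<mu> :: "nat \<Rightarrow> (real ^ 'd) measure"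
    and s :: real
  assumes "levy_process M L"
    and "\<And>t \<omega>. 0 \<le> t \<Longrightarrow> \<omega> \<in> space M \<Longrightarrow> L t \<omega> \<in> orthant"
    and "is_levy_measure M L \<nu>"
    and "\<And>j. is_levy_measure M (\<lambda>t \<omega>. L t \<omega> $ j) (\<nu>\<^sub>m j)"
    and "\<And>i. i \<in> {1..CARD('d)} \<Longrightarrow> MRV (\<alpha> i) (b i) (\<mu> i) i \<nu>"
    and "\<And>j k. tail_equivalent (\<nu>\<^sub>m j) (\<nu>\<^sub>m k)"
    and "\<And>i m. i \<in> {2..CARD('d)} \<Longrightarrow> m \<in> {1..i - 1} \<Longrightarrow> \<alpha> i < \<alpha> m + \<alpha> (i - m)"
    and "0 < s"
  shows "\<forall>i\<in>{1..CARD('d)}. MRV_rv M (\<alpha> i) (b i) (scale_measure (ennreal s) (\<mu> i)) i (L s)"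
proof
  fix i assume i: "i \<in> {1..CARD('d)}"
  interpret prob_space M using assms(1) by (simp add: levy_process_def)
  interpret regular_levy M L \<nu> \<alpha> b \<mu> s
    using assms by unfold_locales auto
  show "MRV_rv M (\<alpha> i) (b i) (scale_measure (ennreal s) (\<mu> i)) i (L s)"
    unfolding MRV_rv_def using i by (intro MRV_L) auto
qed

end
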